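(* Let $p$ and $q$ be prime positive integers with $p\equiv 1\pmod q$, let $\xi$ be a primitive $q$-th root of unity, and let $K=\mathbb{Q}(\xi)$ be the cyclotomic field. Then there exists an integer $\alpha$ not divisible by $p$ whose residue class modulo $p$ does not belong to $(\mathbb{F}_p^{*})^{q}$, and for every such $\alpha$ we have: (i) the algebra $A\otimes_K\mathbb{Q}_p$ is a division algebra over $\mathbb{Q}_p$, where $A$ is the symbol algebra $A=\left(\frac{\alpha,\,p}{K,\xi}\right)$ and $K$ is regarded as a subfield of $\mathbb{Q}_p$ (which contains the $q$-th roots of unity since $p\equiv 1 \pmod q$); (ii) the symbol algebra $A$ is a division algebra over $K$.
   Context: For a field $F$ whose characteristic does not divide $n$ and which contains a primitive $n$-th root of unity $\omega$, and for $a,b\in F^{*}$, the symbol algebra $\left(\frac{a,\,b}{F,\omega}\right)$ is the $F$-algebra generated by elements $x,y$ subject to $x^n=a$, $y^n=b$, $yx=\omega xy$; it is a central simple $F$-algebra of dimension $n^2$. $\mathbb{Q}_p$ denotes the field of $p$-adic numbers and $\mathbb{F}_p$ the field with $p$ elements; $(\mathbb{F}_p^* )^q$ is the subgroup of $q$-th powers in $\mathbb{F}_p^*$. An algebra is a division algebra if every nonzero element is invertible. *)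

theory Defs
  imports
    Complex_Main
    "HOL-Algebra.Algebra"
    "HOL-Algebra.Algebraic_Closure_Type"
    "HOL-Number_Theory.Residues"
begin

section \<open>Monoid algebras\<close>

text \<open>
  \<open>monoid_algebra R M\<close> is the algebra \<open>R[M]\<close> of finitely supported functions from \<open>M\<close> to \<open>R\<close>
  under convolution.  Functions are required to vanish outside \<open>carrier M\<close>.
\<close>

definition single :: "('r, 'u) ring_scheme \<Rightarrow> 'm \<Rightarrow> 'm \<Rightarrow> 'r" where
  "single R x = (\<lambda>y. if y = x then \<one>\<^bsub>R\<^esub> else \<zero>\<^bsub>R\<^esub>)"

definition monoid_algebra ::
    "('r, 'u) ring_scheme \<Rightarrow> ('m, 'v) monoid_scheme \<Rightarrow> ('r, 'm \<Rightarrow> 'r) module" where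
  "monoid_algebra R M =
    \<lparr>carrier = {f. (\<forall>x\<in>carrier M. f x \<in> carrier R) \<and> (\<forall>x. x \<notin> carrier M \<longrightarrow> f x = \<zero>\<^bsub>R\<^esub>)
                   \<and> finite {x. f x \<noteq> \<zero>\<^bsub>R\<^esub>}},
     monoid.mult = (\<lambda>f g z. finsum R (\<lambda>(x, y). f x \<otimes>\<^bsub>R\<^esub> g y)
               {(x, y). f x \<noteq> \<zero>\<^bsub>R\<^esub> \<and> g y \<noteq> \<zero>\<^bsub>R\<^esub> \<and> x \<otimes>\<^bsub>M\<^esub> y = z}),
     monoid.one = single R \<one>\<^bsub>M\<^esub>,
     ring.zero = (\<lambda>x. \<zero>\<^bsub>R\<^esub>),
     ring.add = (\<lambda>f g x. f x \<oplus>\<^bsub>R\<^esub> g x),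
     module.smult = (\<lambda>c f x. c \<otimes>\<^bsub>R\<^esub> f x)\<rparr>"

section \<open>Associative algebras and division algebras\<close>

text \<open>
  The locale \<^locale>\<open>algebra\<close> of the library covers commutative algebras only.
\<close>

definition assoc_algebra :: "('r, 'u) ring_scheme \<Rightarrow> ('r, 'a, 'v) module_scheme \<Rightarrow> bool" where
  "assoc_algebra R A \<longleftrightarrow> module R A \<and> ring A \<and>
     (\<forall>c\<in>carrier R. \<forall>x\<in>carrier A. \<forall>y\<in>carrier A.
        (c \<odot>\<^bsub>A\<^esub> x) \<otimes>\<^bsub>A\<^esub> y = c \<odot>\<^bsub>A\<^esub> (x \<otimes>\<^bsub>A\<^esub> y) \<and>
        x \<otimes>\<^bsub>A\<^esub> (c \<odot>\<^bsub>A\<^esub> y) = c \<odot>\<^bsub>A\<^esub> (x \<otimes>\<^bsub>A\<^esub> y))"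

definition division_algebra :: "('r, 'u) ring_scheme \<Rightarrow> ('r, 'a, 'v) module_scheme \<Rightarrow> bool" where
  "division_algebra F A \<longleftrightarrow>
     field F \<and> assoc_algebra F A \<and> Units A = carrier A - {\<zero>\<^bsub>A\<^esub>}"

text \<open>
  The quotient ring \<open>P/I\<close>, viewed as an \<open>F\<close>-algebra through a structure map \<open>h\<close> from \<open>F\<close>
  to \<open>P\<close> (which only needs to be a central ring homomorphism modulo \<open>I\<close>).
\<close>

definition quot_algebra ::
    "('f \<Rightarrow> 'a) \<Rightarrow> ('a, 'u) ring_scheme \<Rightarrow> 'a set \<Rightarrow> ('f, 'a set) module" where
  "quot_algebra h P I =
    \<lparr>carrier = carrier (P Quot I),
     monoid.mult = monoid.mult (P Quot I),
     monoid.one = monoid.one (P Quot I),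
     ring.zero = ring.zero (P Quot I),
     ring.add = ring.add (P Quot I),
     module.smult = (\<lambda>c u. (I +>\<^bsub>P\<^esub> h c) \<otimes>\<^bsub>P Quot I\<^esub> u)\<rparr>"

section \<open>Symbol algebras\<close>

datatype symbol_gen = Gen_x | Gen_y

definition symbol_words :: "symbol_gen list monoid" where
  "symbol_words = \<lparr>carrier = UNIV, monoid.mult = (@), monoid.one = []\<rparr>"

text \<open>The free associative algebra on two noncommuting variables.\<close>

definition free_xy :: "('f, 'u) ring_scheme \<Rightarrow> ('f, symbol_gen list \<Rightarrow> 'f) module" where
  "free_xy F = monoid_algebra F symbol_words"

definition symbol_relators ::
    "('f, 'u) ring_scheme \<Rightarrow> nat \<Rightarrow> 'f \<Rightarrow> 'f \<Rightarrow> 'f \<Rightarrow> (symbol_gen list \<Rightarrow> 'f) set" where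
  "symbol_relators F n \<omega> a b =
    (let P = free_xy F; x = single F [Gen_x]; y = single F [Gen_y]
     in {x [^]\<^bsub>P\<^esub> n \<ominus>\<^bsub>P\<^esub> a \<odot>\<^bsub>P\<^esub> \<one>\<^bsub>P\<^esub>,
         y [^]\<^bsub>P\<^esub> n \<ominus>\<^bsub>P\<^esub> b \<odot>\<^bsub>P\<^esub> \<one>\<^bsub>P\<^esub>,
         y \<otimes>\<^bsub>P\<^esub> x \<ominus>\<^bsub>P\<^esub> \<omega> \<odot>\<^bsub>P\<^esub> (x \<otimes>\<^bsub>P\<^esub> y)})"

definition symbol_algebra ::
    "('f, 'u) ring_scheme \<Rightarrow> nat \<Rightarrow> 'f \<Rightarrow> 'f \<Rightarrow> 'f \<Rightarrow> ('f, (symbol_gen list \<Rightarrow> 'f) set) module" where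
  "symbol_algebra F n \<omega> a b =
    quot_algebra (\<lambda>c. c \<odot>\<^bsub>free_xy F\<^esub> \<one>\<^bsub>free_xy F\<^esub>) (free_xy F)
      (Idl\<^bsub>free_xy F\<^esub> (symbol_relators F n \<omega> a b))"

section \<open>Extension of scalars\<close>

text \<open>
  For a \<open>K\<close>-algebra \<open>A\<close> and a homomorphism \<open>\<iota>\<close> from \<open>K\<close> to a commutative ring \<open>L\<close>, this is
  \<open>A \<otimes>\<^sub>K L\<close> as an \<open>L\<close>-algebra.  The additive group of the monoid ring of \<open>A \<times> L\<close> (with
  componentwise multiplication) over the integers is the free abelian group on \<open>A \<times> L\<close>.  The
  subgroup generated by the bilinearity relators is already a two-sided ideal, because
  multiplying a relator by a basis element gives a relator again.  So the quotient by the ideal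
  they generate is the usual tensor product, with \<open>(a \<otimes> l) (a' \<otimes> l') = a a' \<otimes> l l'\<close>.
\<close>

definition tensor_relators ::
    "('k, 'u) ring_scheme \<Rightarrow> ('k, 'a, 'v) module_scheme \<Rightarrow> ('l, 'w) ring_scheme \<Rightarrow> ('k \<Rightarrow> 'l)
      \<Rightarrow> ('a \<times> 'l \<Rightarrow> int) set" where
  "tensor_relators K A L \<iota> =
    (let P = monoid_algebra \<Z> (A \<times>\<times> L); e = single \<Z>
     in {e (a \<oplus>\<^bsub>A\<^esub> a', l) \<ominus>\<^bsub>P\<^esub> (e (a, l) \<oplus>\<^bsub>P\<^esub> e (a', l)) | a a' l.
            a \<in> carrier A \<and> a' \<in> carrier A \<and> l \<in> carrier L}
      \<union> {e (a, l \<oplus>\<^bsub>L\<^esub> l') \<ominus>\<^bsub>P\<^esub> (e (a, l) \<oplus>\<^bsub>P\<^esub> e (a, l')) | a l l'.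
            a \<in> carrier A \<and> l \<in> carrier L \<and> l' \<in> carrier L}
      \<union> {e (k \<odot>\<^bsub>A\<^esub> a, l) \<ominus>\<^bsub>P\<^esub> e (a, \<iota> k \<otimes>\<^bsub>L\<^esub> l) | k a l.
            k \<in> carrier K \<and> a \<in> carrier A \<and> l \<in> carrier L})"

definition scalar_extension ::
    "('k, 'u) ring_scheme \<Rightarrow> ('k, 'a, 'v) module_scheme \<Rightarrow> ('l, 'w) ring_scheme \<Rightarrow> ('k \<Rightarrow> 'l)
      \<Rightarrow> ('l, ('a \<times> 'l \<Rightarrow> int) set) module" where
  "scalar_extension K A L \<iota> =
    quot_algebra (\<lambda>c. single \<Z> (\<one>\<^bsub>A\<^esub>, c)) (monoid_algebra \<Z> (A \<times>\<times> L))
      (Idl\<^bsub>monoid_algebra \<Z> (A \<times>\<times> L)\<^esub> (tensor_relators K A L \<iota>))"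

section \<open>The fields involved\<close>

text \<open>The subfield \<open>\<rat>(\<xi>)\<close> of the complex numbers.\<close>

definition cyclotomic_field :: "complex \<Rightarrow> complex ring" where
  "cyclotomic_field \<xi> =
    (ring_of_type_algebra :: complex ring)
      \<lparr>carrier := generate_field (ring_of_type_algebra :: complex ring) {\<xi>}\<rparr>"

definition primitive_root_of_unity :: "nat \<Rightarrow> complex \<Rightarrow> bool" where
  "primitive_root_of_unity n \<xi> \<longleftrightarrow> 0 < n \<and> \<xi> ^ n = 1 \<and> (\<forall>k. 0 < k \<and> k < n \<longrightarrow> \<xi> ^ k \<noteq> 1)"

text \<open>\<open>\<rat>\<^sub>p\<close> is the completion of \<open>\<rat>\<close>: Cauchy sequences modulo null sequences.\<close>

definition padic_val :: "nat \<Rightarrow> rat \<Rightarrow> int" where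
  "padic_val p x =
     int (multiplicity (int p) (fst (quotient_of x))) -
     int (multiplicity (int p) (snd (quotient_of x)))"

definition padic_abs :: "nat \<Rightarrow> rat \<Rightarrow> real" where
  "padic_abs p x = (if x = 0 then 0 else real p powi (- padic_val p x))"

definition padic_Cauchy :: "nat \<Rightarrow> (nat \<Rightarrow> rat) \<Rightarrow> bool" where
  "padic_Cauchy p s \<longleftrightarrow> (\<forall>e>0. \<exists>N. \<forall>m\<ge>N. \<forall>n\<ge>N. padic_abs p (s m - s n) < e)"

definition padic_null :: "nat \<Rightarrow> (nat \<Rightarrow> rat) set" where
  "padic_null p = {s. (\<lambda>n. padic_abs p (s n)) \<longlonglongrightarrow> 0}"

definition padic_Cauchy_ring :: "nat \<Rightarrow> (nat \<Rightarrow> rat) ring" where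
  "padic_Cauchy_ring p =
    \<lparr>carrier = {s. padic_Cauchy p s},
     monoid.mult = (\<lambda>s t n. s n * t n),
     monoid.one = (\<lambda>n. 1),
     ring.zero = (\<lambda>n. 0),
     ring.add = (\<lambda>s t n. s n + t n)\<rparr>"

definition padic_field :: "nat \<Rightarrow> (nat \<Rightarrow> rat) set ring" where
  "padic_field p = padic_Cauchy_ring p Quot padic_null p"

text \<open>The subgroup \<open>(F\<^sub>p\<^sup>*)\<^sup>q\<close>, with residue classes represented by \<open>0, \<dots>, p - 1\<close>.\<close>

definition residue_powers :: "nat \<Rightarrow> nat \<Rightarrow> int set" where
  "residue_powers p q =
     (\<lambda>x. x [^]\<^bsub>residue_ring (int p)\<^esub> q) ` Units (residue_ring (int p))"

end

theory Submission
  imports Defs "HOL-Computational_Algebra.Computational_Algebra" "HOL-Number_Theory.Number_Theory"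
begin

text \<open>
  In coordinates with respect to the monomials \<open>x\<^sup>i y\<^sup>j\<close>, the symbol algebra is a cocycle-twisted group
  algebra of \<open>(\<int>/q)\<^sup>2\<close>.  By their universal properties, the presented algebra \<open>A\<close> and its scalar
  extension to \<open>\<rat>\<^sub>p\<close> are nonzero homomorphic images of such coordinate models, so it is enough that
  the models are division rings; and since they are finite dimensional, that they have no zero
  divisors.  As \<open>K\<close> embeds in \<open>\<rat>\<^sub>p\<close>, only the model over \<open>\<rat>\<^sub>p\<close> matters.  There, after scaling to
  integral coordinates, one compares leading terms in the filtration by the powers of \<open>y\<close>, where
  \<open>y\<^sup>q = p\<close>.  Multiplication of leading terms takes place, up to a twist \<open>x \<mapsto> \<omega> x\<close>, in
  \<open>F\<^sub>p[X] / (X\<^sup>q - \<alpha>)\<close>, which is a field because \<open>\<alpha>\<close> is not a \<open>q\<close>-th power modulo \<open>p\<close>.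
\<close>

section \<open>Twisted monoid algebras\<close>

text \<open>A presented algebra might collapse to zero. A homomorphism into the coordinate model
  excludes this, and a homomorphism from the model onto the algebra then transports inverses; so a
  universal property on each side takes the place of a basis theorem. The obstacle over Q_p is that
  its elements are classes of rational Cauchy sequences, so leading terms are compared on rational
  representatives. There \<omega> is only approximated by rationals w with |w| = 1, and the
  coordinate product with w in place of \<omega> is in general not associative. The leading-term
  argument is therefore a bare inequality about this bilinear product: some coordinate of the
  product has absolute value at least |s_x| |t_y| / p. The constant does not depend on w, s and t,
  so the bound contradicts a product all of whose coordinates are null sequences. The factor 1/p
  arises because the two leading rows have indices below q, so their sum is below 2q and at most one
  factor y^q = p splits off.\<close>

definition monomial :: "('r, 'u) ring_scheme \<Rightarrow> 'r \<Rightarrow> 'm \<Rightarrow> 'm \<Rightarrow> 'r" where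
  "monomial R a x = (\<lambda>y. if y = x then a else \<zero>\<^bsub>R\<^esub>)"

lemma single_eq_monomial: "single R x = monomial R \<one>\<^bsub>R\<^esub> x"
  by (simp add: single_def monomial_def fun_eq_iff)

text \<open>
  A twisted monoid algebra has basis \<open>M\<close> and product \<open>x \<cdot> y = c x y (x y)\<close> for a normalized
  2-cocycle \<open>c\<close>.  The product is only prescribed on the carrier, so that
  \<^const>\<open>monoid_algebra\<close> is the case of the constant cocycle \<open>1\<close>.
\<close>

locale twisted_algebra = R: cring R + M: monoid M
  for R (structure) and M :: "('m, 'v) monoid_scheme" +
  fixes c :: "'m \<Rightarrow> 'm \<Rightarrow> 'a" and P :: "('m \<Rightarrow> 'a, 'w) ring_scheme"
  assumes cocycle_closed [simp]: "\<lbrakk>x \<in> carrier M; y \<in> carrier M\<rbrakk> \<Longrightarrow> c x y \<in> carrier R"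
    and cocycle_one_left: "x \<in> carrier M \<Longrightarrow> c \<one>\<^bsub>M\<^esub> x = \<one>"
    and cocycle_one_right: "x \<in> carrier M \<Longrightarrow> c x \<one>\<^bsub>M\<^esub> = \<one>"
    and cocycle: "\<lbrakk>x \<in> carrier M; y \<in> carrier M; z \<in> carrier M\<rbrakk>
      \<Longrightarrow> c x y \<otimes> c (x \<otimes>\<^bsub>M\<^esub> y) z = c y z \<otimes> c x (y \<otimes>\<^bsub>M\<^esub> z)"
    and carrier_eq: "carrier P = {f. (\<forall>x\<in>carrier M. f x \<in> carrier R) \<and>
      (\<forall>x. x \<notin> carrier M \<longrightarrow> f x = \<zero>) \<and> finite {x. f x \<noteq> \<zero>}}"
    and one_eq: "\<one>\<^bsub>P\<^esub> = monomial R \<one> \<one>\<^bsub>M\<^esub>"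
    and zero_eq: "\<zero>\<^bsub>P\<^esub> = (\<lambda>x. \<zero>)"
    and add_eq: "f \<oplus>\<^bsub>P\<^esub> g = (\<lambda>x. f x \<oplus> g x)"
    and mult_eq: "\<lbrakk>f \<in> carrier P; g \<in> carrier P\<rbrakk> \<Longrightarrow> f \<otimes>\<^bsub>P\<^esub> g = (\<lambda>z. finsum R
      (\<lambda>(x, y). c x y \<otimes> (f x \<otimes> g y)) {(x, y). f x \<noteq> \<zero> \<and> g y \<noteq> \<zero> \<and> x \<otimes>\<^bsub>M\<^esub> y = z})"
begin

lemma coeff_closed: "f \<in> carrier P \<Longrightarrow> f x \<in> carrier R"
  by (cases "x \<in> carrier M") (auto simp: carrier_eq)

lemma finite_support: "f \<in> carrier P \<Longrightarrow> finite {x. f x \<noteq> \<zero>}"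
  by (simp add: carrier_eq)

lemma support_subset: "f \<in> carrier P \<Longrightarrow> f x \<noteq> \<zero> \<Longrightarrow> x \<in> carrier M"
  by (auto simp: carrier_eq)

text \<open>The defining sum runs over the exact supports, which differ between \<open>f\<close>,
  \<open>g\<close> and their sum. Enlarging them to common finite sets \<open>S\<close> and
  \<open>T\<close> adds only zero terms and makes such sums comparable.\<close>

lemma mult_coeff:
  assumes f: "f \<in> carrier P" and g: "g \<in> carrier P"
    and S: "finite S" "S \<subseteq> carrier M" "{x. f x \<noteq> \<zero>} \<subseteq> S"
    and T: "finite T" "T \<subseteq> carrier M" "{x. g x \<noteq> \<zero>} \<subseteq> T"
  shows "(f \<otimes>\<^bsub>P\<^esub> g) z =
    finsum R (\<lambda>(x, y). c x y \<otimes> (f x \<otimes> g y)) {(x, y) \<in> S \<times> T. x \<otimes>\<^bsub>M\<^esub> y = z}"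
proof -
  note [simp] = coeff_closed[OF f] coeff_closed[OF g] subsetD[OF S(2)] subsetD[OF T(2)]
  have fin: "finite {(x, y) \<in> S \<times> T. x \<otimes>\<^bsub>M\<^esub> y = z}"
    by (rule finite_subset[of _ "S \<times> T"]) (use S T in auto)
  have "finsum R (\<lambda>(x, y). c x y \<otimes> (f x \<otimes> g y)) {(x, y). f x \<noteq> \<zero> \<and> g y \<noteq> \<zero> \<and> x \<otimes>\<^bsub>M\<^esub> y = z}
    = finsum R (\<lambda>(x, y). c x y \<otimes> (f x \<otimes> g y)) {(x, y) \<in> S \<times> T. x \<otimes>\<^bsub>M\<^esub> y = z}"
  proof (rule R.add.finprod_mono_neutral_cong_left[OF fin])
    show "(case i of (x, y) \<Rightarrow> c x y \<otimes> (f x \<otimes> g y)) = \<zero>"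
      if "i \<in> {(x, y) \<in> S \<times> T. x \<otimes>\<^bsub>M\<^esub> y = z} - {(x, y). f x \<noteq> \<zero> \<and> g y \<noteq> \<zero> \<and> x \<otimes>\<^bsub>M\<^esub> y = z}" for i
    proof -
      obtain x y where i: "i = (x, y)" by (cases i)
      with that have "x \<in> carrier M" "y \<in> carrier M" "f x = \<zero> \<or> g y = \<zero>"
        using S T by auto
      then show ?thesis using f g by (auto simp: i)
    qed
  qed (use f g S(2) T(2) subsetD[OF S(3)] subsetD[OF T(3)] in auto)
  then show ?thesis by (simp add: mult_eq[OF f g])
qed

lemma monomial_closed [simp]: "\<lbrakk>a \<in> carrier R; x \<in> carrier M\<rbrakk> \<Longrightarrow> monomial R a x \<in> carrier P"
  by (auto simp: carrier_eq monomial_def intro: finite_subset[of _ "{x}"])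

lemma zero_closed' [simp]: "(\<lambda>x. \<zero>) \<in> carrier P"
  by (simp add: carrier_eq)

lemma add_closed' [simp]:
  assumes "f \<in> carrier P" "g \<in> carrier P" shows "(\<lambda>x. f x \<oplus> g x) \<in> carrier P"
  using assms by (auto simp: carrier_eq intro: finite_subset[of _ "{x. f x \<noteq> \<zero>} \<union> {x. g x \<noteq> \<zero>}"])

lemma neg_closed': "f \<in> carrier P \<Longrightarrow> (\<lambda>x. \<ominus> f x) \<in> carrier P"
  by (auto simp: carrier_eq elim!: rev_finite_subset)

text \<open>Every element is a finite sum of monomials, so a property compatible with sums reduces
  to one-point functions; the induction removes one point of the support at a time.\<close>

lemma twisted_induct [consumes 1, case_names zero add monomial]:
  assumes f: "f \<in> carrier P"
    and zero: "Q \<zero>\<^bsub>P\<^esub>"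
    and add: "\<And>f g. \<lbrakk>f \<in> carrier P; g \<in> carrier P; Q f; Q g\<rbrakk> \<Longrightarrow> Q (f \<oplus>\<^bsub>P\<^esub> g)"
    and mono: "\<And>a x. \<lbrakk>a \<in> carrier R; x \<in> carrier M\<rbrakk> \<Longrightarrow> Q (monomial R a x)"
  shows "Q f"
proof -
  have "\<lbrakk>finite S; f \<in> carrier P; {x. f x \<noteq> \<zero>} \<subseteq> S\<rbrakk> \<Longrightarrow> Q f" for S f
  proof (induction S arbitrary: f rule: finite_induct)
    case empty
    then have "f = \<zero>\<^bsub>P\<^esub>" by (auto simp: zero_eq)
    then show ?case using zero by simp
  next
    case (insert x S)
    let ?g = "f(x := \<zero>)"
    have g: "?g \<in> carrier P"
      using insert.prems(1) by (auto simp: carrier_eq elim!: rev_finite_subset)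
    have Qg: "Q ?g" using insert.prems by (intro insert.IH g) auto
    show ?case
    proof (cases "x \<in> carrier M")
      case True
      have "f = monomial R (f x) x \<oplus>\<^bsub>P\<^esub> ?g"
        using coeff_closed[OF insert.prems(1)] by (auto simp: add_eq monomial_def fun_eq_iff)
      then show ?thesis using add[OF _ g mono Qg, of "f x" x] True
          coeff_closed[OF insert.prems(1)] by simp
    next
      case False
      then have "f x = \<zero>" using insert.prems(1) support_subset by blast
      then have "?g = f" by (simp add: fun_upd_idem)
      then show ?thesis using Qg by simp
    qed
  qed
  from this[OF finite_support[OF f] f] show ?thesis by simp
qed

lemma mult_closed':
  assumes f: "f \<in> carrier P" and g: "g \<in> carrier P" shows "f \<otimes>\<^bsub>P\<^esub> g \<in> carrier P"
proof -
  note [simp] = coeff_closed[OF f] coeff_closed[OF g]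
    support_subset[OF f] support_subset[OF g]
  let ?X = "{x. f x \<noteq> \<zero>}" and ?Y = "{x. g x \<noteq> \<zero>}"
  have sub: "?X \<subseteq> carrier M" "?Y \<subseteq> carrier M" using f g support_subset by auto
  have fin: "finite ?X" "finite ?Y" using f g finite_support by auto
  have eq: "(f \<otimes>\<^bsub>P\<^esub> g) z = finsum R (\<lambda>(x, y). c x y \<otimes> (f x \<otimes> g y))
      {(x, y) \<in> ?X \<times> ?Y. x \<otimes>\<^bsub>M\<^esub> y = z}" for z
    by (rule mult_coeff[OF f g]) (use sub fin in auto)
  have zero: "(f \<otimes>\<^bsub>P\<^esub> g) z = \<zero>" if "z \<notin> (\<lambda>(x, y). x \<otimes>\<^bsub>M\<^esub> y) ` (?X \<times> ?Y)" for z
  proof -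
    have empty: "{(x, y) \<in> ?X \<times> ?Y. x \<otimes>\<^bsub>M\<^esub> y = z} = {}" using that by auto
    show ?thesis unfolding eq empty by simp
  qed
  have "(f \<otimes>\<^bsub>P\<^esub> g) z \<in> carrier R" for z
    unfolding eq by (rule R.finsum_closed) (use f g sub in auto)
  moreover have "(f \<otimes>\<^bsub>P\<^esub> g) z = \<zero>" if "z \<notin> carrier M" for z
    by (rule zero) (use that sub in auto)
  moreover have "finite {z. (f \<otimes>\<^bsub>P\<^esub> g) z \<noteq> \<zero>}"
    by (rule finite_subset[of _ "(\<lambda>(x, y). x \<otimes>\<^bsub>M\<^esub> y) ` (?X \<times> ?Y)"]) (use zero fin in auto)
  ultimately show ?thesis by (simp add: carrier_eq)
qed

lemma mult_distrib_right:
  assumes f: "f \<in> carrier P" and g: "g \<in> carrier P" and h: "h \<in> carrier P"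
  shows "(f \<oplus>\<^bsub>P\<^esub> g) \<otimes>\<^bsub>P\<^esub> h = f \<otimes>\<^bsub>P\<^esub> h \<oplus>\<^bsub>P\<^esub> g \<otimes>\<^bsub>P\<^esub> h"
proof
  note [simp] = coeff_closed[OF f] coeff_closed[OF g] coeff_closed[OF h]
    support_subset[OF f] support_subset[OF g] support_subset[OF h]
  fix z
  let ?X = "{x. f x \<noteq> \<zero>} \<union> {x. g x \<noteq> \<zero>}" and ?Y = "{x. h x \<noteq> \<zero>}"
  let ?S = "{(x, y) \<in> ?X \<times> ?Y. x \<otimes>\<^bsub>M\<^esub> y = z}"
  have sub: "?X \<subseteq> carrier M" "?Y \<subseteq> carrier M" and fin: "finite ?X" "finite ?Y"
    using f g h support_subset finite_support by auto
  have fg: "f \<oplus>\<^bsub>P\<^esub> g \<in> carrier P" using f g by (simp add: add_eq)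
  have "((f \<oplus>\<^bsub>P\<^esub> g) \<otimes>\<^bsub>P\<^esub> h) z = finsum R (\<lambda>(x, y). c x y \<otimes> ((f x \<oplus> g x) \<otimes> h y)) ?S"
    by (subst mult_coeff[OF fg h fin(1) sub(1) _ fin(2) sub(2)]) (use f g in \<open>auto simp: add_eq\<close>)
  also have "\<dots> = finsum R (\<lambda>p. (\<lambda>(x, y). c x y \<otimes> (f x \<otimes> h y)) p
      \<oplus> (\<lambda>(x, y). c x y \<otimes> (g x \<otimes> h y)) p) ?S"
    by (rule R.finsum_cong') (use f g h sub in \<open>auto simp: R.l_distr R.r_distr\<close>)
  also have "\<dots> = finsum R (\<lambda>(x, y). c x y \<otimes> (f x \<otimes> h y)) ?S
      \<oplus> finsum R (\<lambda>(x, y). c x y \<otimes> (g x \<otimes> h y)) ?S"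
    by (rule R.finsum_addf) (use f g h sub in auto)
  also have "finsum R (\<lambda>(x, y). c x y \<otimes> (f x \<otimes> h y)) ?S = (f \<otimes>\<^bsub>P\<^esub> h) z"
    by (subst mult_coeff[OF f h fin(1) sub(1) _ fin(2) sub(2)]) auto
  also have "finsum R (\<lambda>(x, y). c x y \<otimes> (g x \<otimes> h y)) ?S = (g \<otimes>\<^bsub>P\<^esub> h) z"
    by (subst mult_coeff[OF g h fin(1) sub(1) _ fin(2) sub(2)]) auto
  finally show "((f \<oplus>\<^bsub>P\<^esub> g) \<otimes>\<^bsub>P\<^esub> h) z = (f \<otimes>\<^bsub>P\<^esub> h \<oplus>\<^bsub>P\<^esub> g \<otimes>\<^bsub>P\<^esub> h) z"
    by (simp add: add_eq)
qed

lemma mult_distrib_left: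
  assumes f: "f \<in> carrier P" and g: "g \<in> carrier P" and h: "h \<in> carrier P"
  shows "h \<otimes>\<^bsub>P\<^esub> (f \<oplus>\<^bsub>P\<^esub> g) = h \<otimes>\<^bsub>P\<^esub> f \<oplus>\<^bsub>P\<^esub> h \<otimes>\<^bsub>P\<^esub> g"
proof
  note [simp] = coeff_closed[OF f] coeff_closed[OF g] coeff_closed[OF h]
    support_subset[OF f] support_subset[OF g] support_subset[OF h]
  fix z
  let ?Y = "{x. f x \<noteq> \<zero>} \<union> {x. g x \<noteq> \<zero>}" and ?X = "{x. h x \<noteq> \<zero>}"
  let ?S = "{(x, y) \<in> ?X \<times> ?Y. x \<otimes>\<^bsub>M\<^esub> y = z}"
  have sub: "?X \<subseteq> carrier M" "?Y \<subseteq> carrier M" and fin: "finite ?X" "finite ?Y"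
    using f g h support_subset finite_support by auto
  have fg: "f \<oplus>\<^bsub>P\<^esub> g \<in> carrier P" using f g by (simp add: add_eq)
  have "(h \<otimes>\<^bsub>P\<^esub> (f \<oplus>\<^bsub>P\<^esub> g)) z = finsum R (\<lambda>(x, y). c x y \<otimes> (h x \<otimes> (f y \<oplus> g y))) ?S"
    by (subst mult_coeff[OF h fg fin(1) sub(1) _ fin(2) sub(2)]) (use f g in \<open>auto simp: add_eq\<close>)
  also have "\<dots> = finsum R (\<lambda>p. (\<lambda>(x, y). c x y \<otimes> (h x \<otimes> f y)) p
      \<oplus> (\<lambda>(x, y). c x y \<otimes> (h x \<otimes> g y)) p) ?S"
    by (rule R.finsum_cong') (use f g h sub in \<open>auto simp: R.l_distr R.r_distr\<close>)
  also have "\<dots> = finsum R (\<lambda>(x, y). c x y \<otimes> (h x \<otimes> f y)) ?S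
      \<oplus> finsum R (\<lambda>(x, y). c x y \<otimes> (h x \<otimes> g y)) ?S"
    by (rule R.finsum_addf) (use f g h sub in auto)
  also have "finsum R (\<lambda>(x, y). c x y \<otimes> (h x \<otimes> f y)) ?S = (h \<otimes>\<^bsub>P\<^esub> f) z"
    by (subst mult_coeff[OF h f fin(1) sub(1) _ fin(2) sub(2)]) auto
  also have "finsum R (\<lambda>(x, y). c x y \<otimes> (h x \<otimes> g y)) ?S = (h \<otimes>\<^bsub>P\<^esub> g) z"
    by (subst mult_coeff[OF h g fin(1) sub(1) _ fin(2) sub(2)]) auto
  finally show "(h \<otimes>\<^bsub>P\<^esub> (f \<oplus>\<^bsub>P\<^esub> g)) z = (h \<otimes>\<^bsub>P\<^esub> f \<oplus>\<^bsub>P\<^esub> h \<otimes>\<^bsub>P\<^esub> g) z"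
    by (simp add: add_eq)
qed

lemma monomial_mult:
  assumes "a \<in> carrier R" "b \<in> carrier R" "x \<in> carrier M" "y \<in> carrier M"
  shows "monomial R a x \<otimes>\<^bsub>P\<^esub> monomial R b y = monomial R (c x y \<otimes> (a \<otimes> b)) (x \<otimes>\<^bsub>M\<^esub> y)"
proof
  fix z
  have "(monomial R a x \<otimes>\<^bsub>P\<^esub> monomial R b y) z = finsum R (\<lambda>(u, v).
      c u v \<otimes> (monomial R a x u \<otimes> monomial R b y v)) {(u, v) \<in> {x} \<times> {y}. u \<otimes>\<^bsub>M\<^esub> v = z}"
    by (rule mult_coeff[OF monomial_closed monomial_closed])
      (use assms in \<open>auto simp: monomial_def\<close>)
  also have "{(u, v) \<in> {x} \<times> {y}. u \<otimes>\<^bsub>M\<^esub> v = z} = (if x \<otimes>\<^bsub>M\<^esub> y = z then {(x, y)} else {})"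
    by auto
  finally show "(monomial R a x \<otimes>\<^bsub>P\<^esub> monomial R b y) z
      = monomial R (c x y \<otimes> (a \<otimes> b)) (x \<otimes>\<^bsub>M\<^esub> y) z"
    using assms by (auto simp: monomial_def)
qed

lemma monomial_zero [simp]: "monomial R \<zero> x = \<zero>\<^bsub>P\<^esub>"
  by (simp add: monomial_def zero_eq fun_eq_iff)

lemma monomial_add:
  "\<lbrakk>a \<in> carrier R; b \<in> carrier R\<rbrakk> \<Longrightarrow> monomial R a x \<oplus>\<^bsub>P\<^esub> monomial R b x = monomial R (a \<oplus> b) x"
  by (simp add: monomial_def add_eq fun_eq_iff)

lemma abelian_group: "abelian_group P"
proof (rule abelian_groupI)
  fix f assume f: "f \<in> carrier P"
  show "\<exists>g\<in>carrier P. g \<oplus>\<^bsub>P\<^esub> f = \<zero>\<^bsub>P\<^esub>"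
    by (rule bexI[OF _ neg_closed'[OF f]]) (use coeff_closed[OF f] in \<open>simp add: add_eq zero_eq R.l_neg\<close>)
qed (simp_all add: add_eq zero_eq coeff_closed R.a_ac)

sublocale abelian_group P by (rule abelian_group)

lemma zero_mult: "f \<in> carrier P \<Longrightarrow> \<zero>\<^bsub>P\<^esub> \<otimes>\<^bsub>P\<^esub> f = \<zero>\<^bsub>P\<^esub>"
  using mult_distrib_right[of "\<zero>\<^bsub>P\<^esub>" "\<zero>\<^bsub>P\<^esub>" f] mult_closed'[of "\<zero>\<^bsub>P\<^esub>" f] by simp

lemma mult_zero: "f \<in> carrier P \<Longrightarrow> f \<otimes>\<^bsub>P\<^esub> \<zero>\<^bsub>P\<^esub> = \<zero>\<^bsub>P\<^esub>"
  using mult_distrib_left[of "\<zero>\<^bsub>P\<^esub>" "\<zero>\<^bsub>P\<^esub>" f] mult_closed'[of f "\<zero>\<^bsub>P\<^esub>"] by simp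

text \<open>Both sides are additive in each argument, so three nested inductions leave only
  monomials, where associativity is the cocycle identity.\<close>

lemma mult_assoc:
  assumes "f \<in> carrier P" "g \<in> carrier P" "h \<in> carrier P"
  shows "(f \<otimes>\<^bsub>P\<^esub> g) \<otimes>\<^bsub>P\<^esub> h = f \<otimes>\<^bsub>P\<^esub> (g \<otimes>\<^bsub>P\<^esub> h)"
  using assms
proof (induction f rule: twisted_induct)
  case zero
  then show ?case by (simp add: zero_mult mult_closed')
next
  case (add f f')
  then show ?case by (simp add: mult_distrib_right mult_closed')
next
  case (monomial a x)
  note ax = this(1,2)
  show ?case using monomial(3,4)
  proof (induction g rule: twisted_induct)
    case zero
    then show ?case using ax by (simp add: zero_mult mult_zero)
  next
    case (add g g')
    then show ?case using ax by (simp add: mult_distrib_right mult_distrib_left mult_closed')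
  next
    case (monomial b y)
    note yb = this(1,2)
    show ?case using monomial(3)
    proof (induction h rule: twisted_induct)
      case zero
      then show ?case using ax yb by (simp add: mult_zero mult_closed')
    next
      case (add h h')
      then show ?case using ax yb by (simp add: mult_distrib_left mult_closed')
    next
      case (monomial d z)
      have "c (x \<otimes>\<^bsub>M\<^esub> y) z \<otimes> (c x y \<otimes> (a \<otimes> b) \<otimes> d) = (c x y \<otimes> c (x \<otimes>\<^bsub>M\<^esub> y) z) \<otimes> (a \<otimes> b \<otimes> d)"
        using ax yb monomial by (simp add: R.m_ac)
      also have "\<dots> = (c y z \<otimes> c x (y \<otimes>\<^bsub>M\<^esub> z)) \<otimes> (a \<otimes> b \<otimes> d)"
        using ax yb monomial by (simp only: cocycle)
      also have "\<dots> = c x (y \<otimes>\<^bsub>M\<^esub> z) \<otimes> (a \<otimes> (c y z \<otimes> (b \<otimes> d)))"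
        using ax yb monomial by (simp add: R.m_ac)
      finally show ?case using ax yb monomial by (simp add: monomial_mult M.m_assoc)
    qed
  qed
qed

lemma one_mult: "f \<in> carrier P \<Longrightarrow> \<one>\<^bsub>P\<^esub> \<otimes>\<^bsub>P\<^esub> f = f"
proof (induction f rule: twisted_induct)
  case (add f g)
  then show ?case by (simp add: mult_distrib_left one_eq)
qed (simp_all add: one_eq mult_zero monomial_mult cocycle_one_left)

lemma mult_one: "f \<in> carrier P \<Longrightarrow> f \<otimes>\<^bsub>P\<^esub> \<one>\<^bsub>P\<^esub> = f"
proof (induction f rule: twisted_induct)
  case (add f g)
  then show ?case by (simp add: mult_distrib_right one_eq)
qed (simp_all add: one_eq zero_mult monomial_mult cocycle_one_right)

lemma ring: "ring P"
proof (intro ringI abelian_group monoidI)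
  show "\<one>\<^bsub>P\<^esub> \<in> carrier P" by (simp add: one_eq)
qed (simp_all add: mult_closed' mult_assoc one_mult mult_one mult_distrib_left mult_distrib_right)

sublocale P: ring P by (rule ring)

end

text \<open>An algebra over \<open>R\<close> is carried by its structure map alone. This suits
  noncommutative targets given as arbitrary ring records, and it serves scalars from a field and
  from the integers alike.\<close>

definition central_hom :: "('r, 'u) ring_scheme \<Rightarrow> ('b, 'v) ring_scheme \<Rightarrow> ('r \<Rightarrow> 'b) \<Rightarrow> bool" where
  "central_hom R B \<eta> \<longleftrightarrow> \<eta> \<in> ring_hom R B \<and>
    (\<forall>r\<in>carrier R. \<forall>b\<in>carrier B. \<eta> r \<otimes>\<^bsub>B\<^esub> b = b \<otimes>\<^bsub>B\<^esub> \<eta> r)"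

lemma central_homD:
  assumes "central_hom R B \<eta>"
  shows "\<eta> \<in> ring_hom R B"
    and "\<lbrakk>r \<in> carrier R; b \<in> carrier B\<rbrakk> \<Longrightarrow> \<eta> r \<otimes>\<^bsub>B\<^esub> b = b \<otimes>\<^bsub>B\<^esub> \<eta> r"
    and "r \<in> carrier R \<Longrightarrow> \<eta> r \<in> carrier B"
  using assms by (auto simp: central_hom_def ring_hom_closed)

text \<open>The map \<open>h\<close> extends \<phi> linearly. On monomials the scalar
  \<open>\<eta> b\<close> has to move past \<open>\<phi> x\<close>, which is where centrality
  enters; what remains is the assumption that the values of \<phi> multiply with the same twist
  \<open>c\<close>.\<close>

lemma (in twisted_algebra) twisted_universal:
  assumes B: "ring B" and \<eta>: "central_hom R B \<eta>"
    and \<phi>: "\<And>x. x \<in> carrier M \<Longrightarrow> \<phi> x \<in> carrier B"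
    and \<phi>_one: "\<phi> \<one>\<^bsub>M\<^esub> = \<one>\<^bsub>B\<^esub>"
    and \<phi>_mult: "\<And>x y. \<lbrakk>x \<in> carrier M; y \<in> carrier M\<rbrakk>
      \<Longrightarrow> \<phi> x \<otimes>\<^bsub>B\<^esub> \<phi> y = \<eta> (c x y) \<otimes>\<^bsub>B\<^esub> \<phi> (x \<otimes>\<^bsub>M\<^esub> y)"
  shows "\<exists>h\<in>ring_hom P B. \<forall>a\<in>carrier R. \<forall>x\<in>carrier M. h (monomial R a x) = \<eta> a \<otimes>\<^bsub>B\<^esub> \<phi> x"
proof -
  interpret B: ring B by (rule B)
  interpret \<eta>: ring_hom_ring R B \<eta>
    using \<eta> by (intro ring_hom_ringI2) (auto simp: central_hom_def R.ring_axioms B)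
  define h where "h f = finsum B (\<lambda>x. \<eta> (f x) \<otimes>\<^bsub>B\<^esub> \<phi> x) {x. f x \<noteq> \<zero>}" for f
  have h_eq: "h f = finsum B (\<lambda>x. \<eta> (f x) \<otimes>\<^bsub>B\<^esub> \<phi> x) S"
    if f: "f \<in> carrier P" and S: "finite S" "S \<subseteq> carrier M" "{x. f x \<noteq> \<zero>} \<subseteq> S" for f S
    unfolding h_def
    by (rule B.add.finprod_mono_neutral_cong_left)
      (use coeff_closed[OF f] subsetD[OF S(2)] S \<phi> in auto)
  have h_closed [simp]: "h f \<in> carrier B" if f: "f \<in> carrier P" for f
    unfolding h_def by (rule B.finsum_closed) (use coeff_closed[OF f] f \<phi> support_subset in auto)
  have h_zero: "h \<zero>\<^bsub>P\<^esub> = \<zero>\<^bsub>B\<^esub>" by (simp add: h_def zero_eq)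
  have h_add: "h (f \<oplus>\<^bsub>P\<^esub> g) = h f \<oplus>\<^bsub>B\<^esub> h g" if f: "f \<in> carrier P" and g: "g \<in> carrier P" for f g
  proof -
    let ?X = "{x. f x \<noteq> \<zero>} \<union> {x. g x \<noteq> \<zero>}"
    note [simp] = coeff_closed[OF f] coeff_closed[OF g]
    have S: "finite ?X" "?X \<subseteq> carrier M" using f g support_subset finite_support by auto
    have "h (f \<oplus>\<^bsub>P\<^esub> g) = finsum B (\<lambda>x. \<eta> ((f \<oplus>\<^bsub>P\<^esub> g) x) \<otimes>\<^bsub>B\<^esub> \<phi> x) ?X"
      by (rule h_eq) (use f g S in \<open>auto simp: add_eq\<close>)
    also have "\<dots> = finsum B (\<lambda>x. \<eta> (f x) \<otimes>\<^bsub>B\<^esub> \<phi> x \<oplus>\<^bsub>B\<^esub> \<eta> (g x) \<otimes>\<^bsub>B\<^esub> \<phi> x) ?X"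
      by (rule B.finsum_cong') (use f g S \<phi> support_subset[OF f] support_subset[OF g] in \<open>auto simp: add_eq B.l_distr\<close>)
    also have "\<dots> = finsum B (\<lambda>x. \<eta> (f x) \<otimes>\<^bsub>B\<^esub> \<phi> x) ?X \<oplus>\<^bsub>B\<^esub> finsum B (\<lambda>x. \<eta> (g x) \<otimes>\<^bsub>B\<^esub> \<phi> x) ?X"
      by (rule B.finsum_addf) (use f g S \<phi> support_subset[OF f] support_subset[OF g] in auto)
    also have "finsum B (\<lambda>x. \<eta> (f x) \<otimes>\<^bsub>B\<^esub> \<phi> x) ?X = h f" by (rule h_eq[symmetric]) (use f S in auto)
    also have "finsum B (\<lambda>x. \<eta> (g x) \<otimes>\<^bsub>B\<^esub> \<phi> x) ?X = h g" by (rule h_eq[symmetric]) (use g S in auto)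
    finally show ?thesis .
  qed
  have h_mono: "h (monomial R a x) = \<eta> a \<otimes>\<^bsub>B\<^esub> \<phi> x" if "a \<in> carrier R" "x \<in> carrier M" for a x
    by (subst h_eq[OF monomial_closed[OF that], of "{x}"])
      (use that \<phi> in \<open>auto simp: monomial_def\<close>)
  have h_mult: "h (f \<otimes>\<^bsub>P\<^esub> g) = h f \<otimes>\<^bsub>B\<^esub> h g" if "f \<in> carrier P" "g \<in> carrier P" for f g
    using that
  proof (induction f rule: twisted_induct)
    case zero
    then show ?case by (simp add: h_zero)
  next
    case (add f f')
    then show ?case by (simp add: P.l_distr h_add B.l_distr)
  next
    case (monomial a x)
    note ax = this(1,2)
    show ?case using monomial(3)
    proof (induction g rule: twisted_induct)
      case zero
      then show ?case using ax \<phi> by (simp add: h_zero)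
    next
      case (add g g')
      then show ?case using ax by (simp add: P.r_distr h_add B.r_distr)
    next
      case (monomial b y)
      have cl: "\<eta> a \<in> carrier B" "\<eta> b \<in> carrier B" "\<phi> x \<in> carrier B" "\<phi> y \<in> carrier B"
          "\<eta> (c x y) \<in> carrier B" "\<phi> (x \<otimes>\<^bsub>M\<^esub> y) \<in> carrier B"
        using ax monomial \<phi> by auto
      have cab: "c x y \<otimes> (a \<otimes> b) = a \<otimes> b \<otimes> c x y"
        using ax monomial by (simp add: R.m_ac)
      have "(\<eta> a \<otimes>\<^bsub>B\<^esub> \<phi> x) \<otimes>\<^bsub>B\<^esub> (\<eta> b \<otimes>\<^bsub>B\<^esub> \<phi> y) = \<eta> a \<otimes>\<^bsub>B\<^esub> ((\<phi> x \<otimes>\<^bsub>B\<^esub> \<eta> b) \<otimes>\<^bsub>B\<^esub> \<phi> y)"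
        using cl by (simp add: B.m_assoc)
      also have "\<dots> = \<eta> a \<otimes>\<^bsub>B\<^esub> ((\<eta> b \<otimes>\<^bsub>B\<^esub> \<phi> x) \<otimes>\<^bsub>B\<^esub> \<phi> y)"
        using central_homD(2)[OF \<eta> monomial(1) cl(3)] by simp
      also have "\<dots> = \<eta> a \<otimes>\<^bsub>B\<^esub> (\<eta> b \<otimes>\<^bsub>B\<^esub> (\<eta> (c x y) \<otimes>\<^bsub>B\<^esub> \<phi> (x \<otimes>\<^bsub>M\<^esub> y)))"
        using cl \<phi>_mult[OF ax(2) monomial(2)] by (simp add: B.m_assoc)
      also have "\<dots> = \<eta> (c x y \<otimes> (a \<otimes> b)) \<otimes>\<^bsub>B\<^esub> \<phi> (x \<otimes>\<^bsub>M\<^esub> y)"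
        unfolding cab using cl ax monomial by (simp add: B.m_assoc)
      finally show ?case using ax monomial by (simp add: monomial_mult h_mono)
    qed
  qed
  have "h \<one>\<^bsub>P\<^esub> = \<one>\<^bsub>B\<^esub>" by (simp add: one_eq h_mono \<phi>_one)
  then have "h \<in> ring_hom P B" by (intro ring_hom_memI) (auto simp: h_add h_mult)
  then show ?thesis using h_mono by blast
qed

lemma twisted_algebra_monoid_algebra:
  assumes "cring R" "monoid M"
  shows "twisted_algebra R M (\<lambda>_ _. \<one>\<^bsub>R\<^esub>) (monoid_algebra R M)"
proof -
  interpret R: cring R by (rule assms)
  interpret M: monoid M by (rule assms)
  let ?P = "monoid_algebra R M"
  have cl: "f x \<in> carrier R" if "f \<in> carrier ?P" for f x
    using that by (cases "x \<in> carrier M") (auto simp: monoid_algebra_def)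
  have mult: "f \<otimes>\<^bsub>?P\<^esub> g = (\<lambda>z. finsum R (\<lambda>(x, y). \<one>\<^bsub>R\<^esub> \<otimes>\<^bsub>R\<^esub> (f x \<otimes>\<^bsub>R\<^esub> g y))
      {(x, y). f x \<noteq> \<zero>\<^bsub>R\<^esub> \<and> g y \<noteq> \<zero>\<^bsub>R\<^esub> \<and> x \<otimes>\<^bsub>M\<^esub> y = z})"
    if "f \<in> carrier ?P" "g \<in> carrier ?P" for f g
    using cl[OF that(1)] cl[OF that(2)] by (simp add: monoid_algebra_def)
  show ?thesis
    by unfold_locales (fact mult | simp add: monoid_algebra_def single_eq_monomial)+
qed

section \<open>Quotients and division rings\<close>

lemma (in ring_hom_ring) factor_through_quotient:
  assumes I: "ideal I R" and zero: "\<And>i. i \<in> I \<Longrightarrow> h i = \<zero>\<^bsub>S\<^esub>"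
  shows "\<exists>k\<in>ring_hom (R Quot I) S. \<forall>x\<in>carrier R. k (I +> x) = h x"
proof -
  interpret I: ideal I R by (rule I)
  \<comment> \<open>\<open>h\<close> is constant on every coset of \<open>I\<close>, so the image of
    a coset is a singleton.\<close>
  define k where "k u = the_elem (h ` u)" for u
  have k: "k (I +> x) = h x" if x: "x \<in> carrier R" for x
  proof -
    have "h ` (I +> x) = {h x}"
    proof
      show "h ` (I +> x) \<subseteq> {h x}"
        using x by (auto simp: a_r_coset_def' zero I.Icarr)
      show "{h x} \<subseteq> h ` (I +> x)"
        using I.a_rcos_self[OF x] by blast
    qed
    then show ?thesis by (simp add: k_def)
  qed
  have "k \<in> ring_hom (R Quot I) S"
  proof (rule ring_hom_memI)
    fix u v assume "u \<in> carrier (R Quot I)" "v \<in> carrier (R Quot I)"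
    then obtain x y where x: "x \<in> carrier R" "u = I +> x" and y: "y \<in> carrier R" "v = I +> y"
      by (auto simp: FactRing_simps)
    show "k u \<in> carrier S" using x by (simp add: k)
    show "k (u \<otimes>\<^bsub>R Quot I\<^esub> v) = k u \<otimes>\<^bsub>S\<^esub> k v"
      using x y by (simp add: FactRing_def I.rcoset_mult_add k)
    show "k (u \<oplus>\<^bsub>R Quot I\<^esub> v) = k u \<oplus>\<^bsub>S\<^esub> k v"
      using x y by (simp add: FactRing_def I.a_rcos_sum k)
  qed (simp add: FactRing_def k)
  then show ?thesis using k by blast
qed

text \<open>\<open>A\<close> and \<open>B\<close> may be records of different types, so the axioms
  cannot be transported by an equation \<open>A = B\<close>. This carries them from
  \<open>P Quot I\<close> to the module record of \<open>quot_algebra\<close>.\<close>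

lemma ring_of_eq_operations:
  assumes A: "ring A" and eq: "carrier B = carrier A" "\<one>\<^bsub>B\<^esub> = \<one>\<^bsub>A\<^esub>" "\<zero>\<^bsub>B\<^esub> = \<zero>\<^bsub>A\<^esub>"
    "\<And>x y. x \<oplus>\<^bsub>B\<^esub> y = x \<oplus>\<^bsub>A\<^esub> y" "\<And>x y. x \<otimes>\<^bsub>B\<^esub> y = x \<otimes>\<^bsub>A\<^esub> y"
  shows "ring B"
proof -
  interpret A: ring A by (rule A)
  show ?thesis
    by (intro ringI abelian_groupI monoidI)
      (auto simp: eq A.a_assoc A.m_assoc A.l_distr A.r_distr intro: A.a_comm A.add.l_inv_ex)
qed

lemma assoc_algebra_quot_algebra:
  assumes R: "cring R" and I: "ideal I P"
    and h: "central_hom R (P Quot I) (\<lambda>c. I +>\<^bsub>P\<^esub> h c)"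
  shows "assoc_algebra R (quot_algebra h P I)"
proof -
  interpret R: cring R by (rule R)
  interpret I: ideal I P by (rule I)
  interpret Q: ring "P Quot I" by (rule I.quotient_is_ring)
  let ?Q = "P Quot I" and ?h = "\<lambda>c. I +>\<^bsub>P\<^esub> h c" and ?A = "quot_algebra h P I"
  have ring: "ring ?A"
    by (rule ring_of_eq_operations[OF Q.ring_axioms]) (simp_all add: quot_algebra_def)
  have hom: "?h \<in> ring_hom R ?Q" and closed: "\<And>c. c \<in> carrier R \<Longrightarrow> ?h c \<in> carrier ?Q"
    and central: "\<And>c b. c \<in> carrier R \<Longrightarrow> b \<in> carrier ?Q \<Longrightarrow> ?h c \<otimes>\<^bsub>?Q\<^esub> b = b \<otimes>\<^bsub>?Q\<^esub> ?h c"
    using central_homD[OF h] by auto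
  have "module R ?A"
    by (intro moduleI R ring.axioms(1)[OF ring])
      (simp_all add: quot_algebra_def closed ring_hom_add[OF hom] ring_hom_mult[OF hom]
        ring_hom_one[OF hom] Q.l_distr Q.r_distr Q.m_assoc)
  moreover have "(c \<odot>\<^bsub>?A\<^esub> x) \<otimes>\<^bsub>?A\<^esub> y = c \<odot>\<^bsub>?A\<^esub> (x \<otimes>\<^bsub>?A\<^esub> y)
      \<and> x \<otimes>\<^bsub>?A\<^esub> (c \<odot>\<^bsub>?A\<^esub> y) = c \<odot>\<^bsub>?A\<^esub> (x \<otimes>\<^bsub>?A\<^esub> y)"
    if "c \<in> carrier R" "x \<in> carrier ?A" "y \<in> carrier ?A" for c x y
  proof -
    have cl: "?h c \<in> carrier ?Q" "x \<in> carrier ?Q" "y \<in> carrier ?Q"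
      using that closed by (simp_all add: quot_algebra_def)
    have "x \<otimes>\<^bsub>?Q\<^esub> (?h c \<otimes>\<^bsub>?Q\<^esub> y) = (x \<otimes>\<^bsub>?Q\<^esub> ?h c) \<otimes>\<^bsub>?Q\<^esub> y"
      using cl by (simp add: Q.m_assoc)
    also have "\<dots> = (?h c \<otimes>\<^bsub>?Q\<^esub> x) \<otimes>\<^bsub>?Q\<^esub> y"
      using central[OF that(1) cl(2)] by simp
    finally have "x \<otimes>\<^bsub>?Q\<^esub> (?h c \<otimes>\<^bsub>?Q\<^esub> y) = (?h c \<otimes>\<^bsub>?Q\<^esub> x) \<otimes>\<^bsub>?Q\<^esub> y" .
    then show ?thesis using cl by (simp add: quot_algebra_def Q.m_assoc)
  qed
  ultimately show ?thesis using ring by (simp add: assoc_algebra_def)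
qed

lemma Units_quot_algebra: "Units (quot_algebra h P I) = Units (P Quot I)"
  by (simp add: Units_def quot_algebra_def)

lemma (in ring) Units_nonzero:
  assumes "\<one> \<noteq> \<zero>" and u: "u \<in> Units R" shows "u \<noteq> \<zero>"
proof
  assume "u = \<zero>"
  then have "\<one> = \<zero>" using Units_l_inv[OF u] Units_inv_closed[OF u] by simp
  then show False using assms(1) by simp
qed

text \<open>A nonzero element of \<open>Q\<close> has a nonzero, hence invertible, preimage, and the
  image of its inverse works. This is how invertibility passes from the coordinate model to the
  presented algebras.\<close>

lemma Units_surjective_image:
  assumes D: "ring D" "Units D = carrier D - {\<zero>\<^bsub>D\<^esub>}" and Q: "ring Q" "\<one>\<^bsub>Q\<^esub> \<noteq> \<zero>\<^bsub>Q\<^esub>"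
    and f: "f \<in> ring_hom D Q" and surj: "carrier Q \<subseteq> f ` carrier D"
  shows "Units Q = carrier Q - {\<zero>\<^bsub>Q\<^esub>}"
proof -
  interpret D: ring D by (rule D)
  interpret Q: ring Q by (rule Q)
  interpret f: ring_hom_ring D Q f by (rule ring_hom_ringI2[OF D(1) Q(1) f])
  show ?thesis
  proof (intro equalityI subsetI)
    fix u assume u: "u \<in> Units Q"
    show "u \<in> carrier Q - {\<zero>\<^bsub>Q\<^esub>}" using u Q.Units_nonzero[OF Q(2) u] by auto
  next
    fix u assume u: "u \<in> carrier Q - {\<zero>\<^bsub>Q\<^esub>}"
    then obtain d where d: "d \<in> carrier D" "u = f d" using surj by auto
    with u have "d \<noteq> \<zero>\<^bsub>D\<^esub>" by auto
    with d D(2) have "d \<in> Units D" by simp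
    then have "f (inv\<^bsub>D\<^esub> d) \<otimes>\<^bsub>Q\<^esub> u = \<one>\<^bsub>Q\<^esub>" "u \<otimes>\<^bsub>Q\<^esub> f (inv\<^bsub>D\<^esub> d) = \<one>\<^bsub>Q\<^esub>" "f (inv\<^bsub>D\<^esub> d) \<in> carrier Q"
      using d D.Units_l_inv[of d] D.Units_r_inv[of d]
      by (simp_all flip: f.hom_mult add: D.Units_inv_closed)
    then show "u \<in> Units Q" using u by (auto simp: Units_def)
  qed
qed

lemma (in ring) combine_mult_right:
  "\<lbrakk>set Ks \<subseteq> carrier R; set Us \<subseteq> carrier R; u \<in> carrier R\<rbrakk>
    \<Longrightarrow> combine Ks (map (\<lambda>v. v \<otimes> u) Us) = combine Ks Us \<otimes> u"
  by (induction Ks Us rule: combine.induct) (auto simp: l_distr m_assoc)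

text \<open>Right multiplication by a nonzero element is injective and linear over the left scalars \<open>K\<close>,
  so it preserves bases; hence \<open>1\<close> is in its image.\<close>

lemma (in ring) finite_dimension_Units:
  assumes K: "subfield K R" and fin: "finite_dimension K (carrier R)" and one: "\<one> \<noteq> \<zero>"
    and integral: "\<And>a b. \<lbrakk>a \<in> carrier R; b \<in> carrier R; a \<otimes> b = \<zero>\<rbrakk> \<Longrightarrow> a = \<zero> \<or> b = \<zero>"
  shows "Units R = carrier R - {\<zero>}"
proof -
  obtain n Vs where n: "dimension n K (carrier R)"
    and Vs: "set Vs \<subseteq> carrier R" "independent K Vs" "length Vs = n" "Span K Vs = carrier R"
    using fin exists_base[OF K] unfolding finite_dimension_def by metis
  have K_sub: "K \<subseteq> carrier R" using subfieldE(3)[OF K] .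
  have left_inv: "\<exists>v\<in>carrier R. v \<otimes> u = \<one>" if u: "u \<in> carrier R" "u \<noteq> \<zero>" for u
  proof -
    let ?Us = "map (\<lambda>v. v \<otimes> u) Vs"
    have Us: "set ?Us \<subseteq> carrier R" using Vs(1) u by auto
    have "independent K ?Us"
    proof (rule trivial_combine_imp_independent[OF K Us])
      fix Ks assume Ks: "set Ks \<subseteq> K" "combine Ks ?Us = \<zero>"
      then have Ks': "set Ks \<subseteq> carrier R" using K_sub by simp
      have "combine Ks Vs \<otimes> u = \<zero>"
        using Ks(2) combine_mult_right[OF Ks' Vs(1) u(1)] by simp
      then have "combine Ks Vs = \<zero>"
        using integral[OF combine_in_carrier[OF Ks' Vs(1)] u(1)] u(2) by simp
      then show "set (take (length ?Us) Ks) \<subseteq> {\<zero>}"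
        using independent_imp_trivial_combine[OF K Vs(2) Ks(1)] by simp
    qed
    then have "Span K ?Us = carrier R"
      using independent_length_eq_dimension[OF K n _ Us] Vs(3) by simp
    then have "\<one> \<in> Span K ?Us" by simp
    then obtain Ks where Ks: "set Ks \<subseteq> K" "\<one> = combine Ks ?Us"
      using Span_mem_iff_length_version[OF K Us] by auto
    then have Ks': "set Ks \<subseteq> carrier R" using K_sub by simp
    then show ?thesis
      using Ks combine_mult_right[OF Ks' Vs(1) u(1)] combine_in_carrier[OF Ks' Vs(1)] by metis
  qed
  show ?thesis
  proof (intro equalityI subsetI)
    fix u assume u: "u \<in> Units R"
    then show "u \<in> carrier R - {\<zero>}" using Units_nonzero[OF one u] by auto
  next
    fix u assume "u \<in> carrier R - {\<zero>}"
    then have u: "u \<in> carrier R" "u \<noteq> \<zero>" by auto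
    \<comment> \<open>The left inverse \<open>v\<close> of \<open>u\<close> has itself a left
      inverse \<open>w\<close>; then \<open>w = u\<close>, so \<open>v\<close> is a two-sided
      inverse.\<close>
    obtain v where v: "v \<in> carrier R" "v \<otimes> u = \<one>" using left_inv[OF u] by auto
    then have "v \<noteq> \<zero>" using one u by auto
    then obtain w where w: "w \<in> carrier R" "w \<otimes> v = \<one>" using left_inv[OF v(1)] by auto
    have "w = w \<otimes> (v \<otimes> u)" using v w by simp
    also have "\<dots> = u" using m_assoc[OF w(1) v(1) u(1)] u v w by simp
    finally show "u \<in> Units R" using u v w by (auto simp: Units_def)
  qed
qed

lemma (in twisted_algebra) central_hom_monomial_one:
  "central_hom R P (\<lambda>r. monomial R r \<one>\<^bsub>M\<^esub>)"
proof -
  have "monomial R r \<one>\<^bsub>M\<^esub> \<otimes>\<^bsub>P\<^esub> f = f \<otimes>\<^bsub>P\<^esub> monomial R r \<one>\<^bsub>M\<^esub>"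
    if r: "r \<in> carrier R" and f: "f \<in> carrier P" for r f
    using f
  proof (induction f rule: twisted_induct)
    case (add f g)
    then show ?case using r by (simp add: P.l_distr P.r_distr)
  qed (use r in \<open>simp_all add: monomial_mult cocycle_one_left cocycle_one_right R.m_comm\<close>)
  then show ?thesis
    by (auto simp: central_hom_def monomial_mult cocycle_one_left monomial_add one_eq intro!: ring_hom_memI)
qed

section \<open>The symbol algebra in coordinates\<close>

text \<open>The structure map \<eta> is a parameter so that one predicate covers the model, the
  presented algebra and, with \<eta> composed with an embedding of fields, algebras over a larger
  field.\<close>

definition symbol_relations ::
    "('f, 'u) ring_scheme \<Rightarrow> ('b, 'v) ring_scheme \<Rightarrow> ('f \<Rightarrow> 'b) \<Rightarrow> nat \<Rightarrow> 'f \<Rightarrow> 'f \<Rightarrow> 'f \<Rightarrow> 'b \<Rightarrow> 'b \<Rightarrow> bool"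
  where "symbol_relations F B \<eta> n \<omega> a b x y \<longleftrightarrow> x \<in> carrier B \<and> y \<in> carrier B \<and>
    x [^]\<^bsub>B\<^esub> n = \<eta> a \<and> y [^]\<^bsub>B\<^esub> n = \<eta> b \<and> y \<otimes>\<^bsub>B\<^esub> x = \<eta> \<omega> \<otimes>\<^bsub>B\<^esub> (x \<otimes>\<^bsub>B\<^esub> y)"

definition residue_square :: "nat \<Rightarrow> (nat \<times> nat) monoid" where
  "residue_square n = \<lparr>carrier = {..<n} \<times> {..<n},
    monoid.mult = (\<lambda>(i, j) (k, l). ((i + k) mod n, (j + l) mod n)), monoid.one = (0, 0)\<rparr>"

text \<open>In x^i y^j x^k y^l, moving y^j past x^k costs \<omega>^(j k); reducing the exponents i +
  k and j + l modulo \<open>n\<close> produces one factor \<open>a\<close> or \<open>b\<close> for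
  each carry.\<close>

definition symbol_cocycle ::
    "('f, 'u) ring_scheme \<Rightarrow> nat \<Rightarrow> 'f \<Rightarrow> 'f \<Rightarrow> 'f \<Rightarrow> nat \<times> nat \<Rightarrow> nat \<times> nat \<Rightarrow> 'f" where
  "symbol_cocycle F n \<omega> a b = (\<lambda>(i, j) (k, l). \<omega> [^]\<^bsub>F\<^esub> (j * k) \<otimes>\<^bsub>F\<^esub>
    (a [^]\<^bsub>F\<^esub> ((i + k) div n) \<otimes>\<^bsub>F\<^esub> b [^]\<^bsub>F\<^esub> ((j + l) div n)))"

text \<open>The coordinate form of the symbol algebra: the index \<open>(i, j)\<close> stands for \<open>x\<^sup>i y\<^sup>j\<close>.\<close>

definition symbol_model ::
    "('f, 'u) ring_scheme \<Rightarrow> nat \<Rightarrow> 'f \<Rightarrow> 'f \<Rightarrow> 'f \<Rightarrow> (nat \<times> nat \<Rightarrow> 'f) ring" where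
  "symbol_model F n \<omega> a b =
    \<lparr>carrier = {f. (\<forall>x\<in>carrier (residue_square n). f x \<in> carrier F) \<and>
       (\<forall>x. x \<notin> carrier (residue_square n) \<longrightarrow> f x = \<zero>\<^bsub>F\<^esub>) \<and> finite {x. f x \<noteq> \<zero>\<^bsub>F\<^esub>}},
     monoid.mult = (\<lambda>f g z. finsum F
       (\<lambda>(x, y). symbol_cocycle F n \<omega> a b x y \<otimes>\<^bsub>F\<^esub> (f x \<otimes>\<^bsub>F\<^esub> g y))
       {(x, y). f x \<noteq> \<zero>\<^bsub>F\<^esub> \<and> g y \<noteq> \<zero>\<^bsub>F\<^esub> \<and> x \<otimes>\<^bsub>residue_square n\<^esub> y = z}),
     monoid.one = monomial F \<one>\<^bsub>F\<^esub> (0, 0),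
     ring.zero = (\<lambda>x. \<zero>\<^bsub>F\<^esub>),
     ring.add = (\<lambda>f g x. f x \<oplus>\<^bsub>F\<^esub> g x)\<rparr>"

lemma residue_square_simps [simp]:
  "carrier (residue_square n) = {..<n} \<times> {..<n}"
  "(i, j) \<otimes>\<^bsub>residue_square n\<^esub> (k, l) = ((i + k) mod n, (j + l) mod n)"
  "\<one>\<^bsub>residue_square n\<^esub> = (0, 0)"
  by (simp_all add: residue_square_def)

lemma monoid_residue_square: "0 < n \<Longrightarrow> monoid (residue_square n)"
  by (rule monoidI) (auto simp: mod_simps add.assoc)

text \<open>The total carry in adding three residues does not depend on the bracketing: this is the
  additive cocycle identity behind the powers of \<open>a\<close> and \<open>b\<close>.\<close>

lemma carry_add: "(i + k) div n + ((i + k) mod n + m) div n = (i + k + m) div (n :: nat)"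
proof (cases "n = 0")
  case False
  have "i + k + m = ((i + k) mod n + m) + n * ((i + k) div n)" by simp
  then have "(i + k + m) div n = (((i + k) mod n + m) + n * ((i + k) div n)) div n" by (rule arg_cong)
  then show ?thesis using False by (simp only: div_mult_self2[OF False])
qed simp

text \<open>\<open>1 < n\<close> makes \<open>Suc 0\<close> a legal index, so that
  \<open>gen_x\<close> and \<open>gen_y\<close> below are basis elements of the model.\<close>

locale symbol_data = R: cring F for F (structure) +
  fixes n :: nat and \<omega> a b
  assumes n: "1 < n"
    and parameters_closed [simp]: "\<omega> \<in> carrier F" "a \<in> carrier F" "b \<in> carrier F"
    and root_of_unity: "\<omega> [^] n = \<one>"
begin

abbreviation "T \<equiv> symbol_model F n \<omega> a b"

lemma root_pow_mod: "\<omega> [^] (k mod n) = \<omega> [^] k"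
proof -
  have "\<omega> [^] k = \<omega> [^] (n * (k div n) + k mod n)" by simp
  also have "\<dots> = (\<omega> [^] n) [^] (k div n) \<otimes> \<omega> [^] (k mod n)"
    by (simp only: R.nat_pow_mult[symmetric] R.nat_pow_pow parameters_closed)
  finally show ?thesis by (simp add: root_of_unity)
qed

lemma symbol_cocycle_closed: "symbol_cocycle F n \<omega> a b x y \<in> carrier F"
  by (cases x; cases y) (simp add: symbol_cocycle_def)

lemma symbol_cocycle_one:
  assumes "x \<in> carrier (residue_square n)"
  shows "symbol_cocycle F n \<omega> a b \<one>\<^bsub>residue_square n\<^esub> x = \<one>"
    and "symbol_cocycle F n \<omega> a b x \<one>\<^bsub>residue_square n\<^esub> = \<one>"
  using assms by (cases x; simp add: symbol_cocycle_def)+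

text \<open>The exponents of \<open>a\<close> and \<open>b\<close> agree exactly, by
  \<open>carry_add\<close>. Those of \<omega> agree only modulo \<open>n\<close>, because sums of
  indices have been reduced; hence they are compared through \<open>root_pow_mod\<close>.\<close>

lemma symbol_cocycle_cocycle:
  "symbol_cocycle F n \<omega> a b x y \<otimes> symbol_cocycle F n \<omega> a b (x \<otimes>\<^bsub>residue_square n\<^esub> y) z
   = symbol_cocycle F n \<omega> a b y z \<otimes> symbol_cocycle F n \<omega> a b x (y \<otimes>\<^bsub>residue_square n\<^esub> z)"
proof -
  obtain i j where x: "x = (i, j)" by (cases x)
  obtain k l where y: "y = (k, l)" by (cases y)
  obtain r s where z: "z = (r, s)" by (cases z)
  have collect: "(\<omega> [^] t \<otimes> (a [^] u \<otimes> b [^] v)) \<otimes> (\<omega> [^] t' \<otimes> (a [^] u' \<otimes> b [^] v'))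
      = \<omega> [^] ((t + t') mod n) \<otimes> (a [^] (u + u') \<otimes> b [^] (v + v'))" for t u v t' u' v' :: nat
    by (simp add: root_pow_mod R.nat_pow_mult[symmetric] R.m_ac)
  have t: "(j * k + ((j + l) mod n) * r) mod n = (l * r + j * ((k + r) mod n)) mod n"
  proof -
    have "(j * k + ((j + l) mod n) * r) mod n = (j * k + (j + l) * r) mod n"
      by (metis mod_add_right_eq mod_mult_left_eq)
    also have "\<dots> = (l * r + j * (k + r)) mod n" by (simp add: algebra_simps)
    also have "\<dots> = (l * r + j * ((k + r) mod n)) mod n"
      by (metis mod_add_right_eq mod_mult_right_eq)
    finally show ?thesis .
  qed
  have u: "(i + k) div n + ((i + k) mod n + r) div n = (k + r) div n + (i + (k + r) mod n) div n" for i k r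
    using carry_add[of i k n r] carry_add[of k r n i] by (simp add: ac_simps)
  show ?thesis
    unfolding x y z symbol_cocycle_def residue_square_simps prod.case collect t u ..
qed

sublocale T: twisted_algebra F "residue_square n" "symbol_cocycle F n \<omega> a b" T
proof -
  interpret M: monoid "residue_square n" by (rule monoid_residue_square) (use n in simp)
  show "twisted_algebra F (residue_square n) (symbol_cocycle F n \<omega> a b) T"
    by unfold_locales (rule symbol_cocycle_closed symbol_cocycle_cocycle | fact symbol_cocycle_one |
      simp add: symbol_model_def)+
qed

abbreviation "scalar \<equiv> (\<lambda>r. monomial F r (0, 0))"
abbreviation "gen_x \<equiv> monomial F \<one> (Suc 0, 0)"
abbreviation "gen_y \<equiv> monomial F \<one> (0, Suc 0)"

lemma central_hom_scalar: "central_hom F T scalar"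
  using T.central_hom_monomial_one by simp

lemma gen_x_pow: "k < n \<Longrightarrow> gen_x [^]\<^bsub>T\<^esub> k = monomial F \<one> (k, 0)"
  using n by (induction k) (auto simp: T.one_eq T.monomial_mult symbol_cocycle_def)

lemma gen_y_pow: "k < n \<Longrightarrow> gen_y [^]\<^bsub>T\<^esub> k = monomial F \<one> (0, k)"
  using n by (induction k) (auto simp: T.one_eq T.monomial_mult symbol_cocycle_def)

lemma symbol_relations_model: "symbol_relations F T scalar n \<omega> a b gen_x gen_y"
proof -
  obtain k where k: "n = Suc k" using n by (cases n) auto
  then have "k < n" by simp
  have pow: "z [^]\<^bsub>T\<^esub> m = z [^]\<^bsub>T\<^esub> k \<otimes>\<^bsub>T\<^esub> z" if "m = Suc k" for z and m :: nat
    using that by simp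
  \<comment> \<open>The last multiplication raises the exponent from \<open>k = n - 1\<close> to
    \<open>n\<close>, which wraps to 0 with carry 1; the cocycle then contributes \<open>a\<close>
    or \<open>b\<close>.\<close>
  have "(k + Suc 0) mod n = 0" "(k + Suc 0) div n = 1" using n k by simp_all
  then have "gen_x [^]\<^bsub>T\<^esub> n = scalar a" "gen_y [^]\<^bsub>T\<^esub> n = scalar b"
    using n \<open>k < n\<close>
    by (simp_all add: pow[OF k] gen_x_pow gen_y_pow T.monomial_mult symbol_cocycle_def del: add_Suc_right)
  moreover have "gen_y \<otimes>\<^bsub>T\<^esub> gen_x = scalar \<omega> \<otimes>\<^bsub>T\<^esub> (gen_x \<otimes>\<^bsub>T\<^esub> gen_y)"
    using n by (simp add: T.monomial_mult symbol_cocycle_def)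
  ultimately show ?thesis using n by (simp add: symbol_relations_def)
qed

lemma monomial_eq:
  assumes "r \<in> carrier F" "i < n" "j < n"
  shows "monomial F r (i, j) = scalar r \<otimes>\<^bsub>T\<^esub> (gen_x [^]\<^bsub>T\<^esub> i \<otimes>\<^bsub>T\<^esub> gen_y [^]\<^bsub>T\<^esub> j)"
  using assms n by (simp add: gen_x_pow gen_y_pow T.monomial_mult symbol_cocycle_def)

text \<open>The relations force y^j x^k = \<omega>^(j k) x^k y^j and allow exponents to be reduced
  modulo \<open>n\<close>. So the elements x^i y^j multiply with the twist
  \<open>symbol_cocycle\<close>, and \<open>twisted_universal\<close> applies.\<close>

lemma symbol_model_universal:
  assumes B: "ring B" and \<eta>: "central_hom F B \<eta>" and rel: "symbol_relations F B \<eta> n \<omega> a b x y"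
  shows "\<exists>h\<in>ring_hom T B. \<forall>r\<in>carrier F. \<forall>i<n. \<forall>j<n.
    h (monomial F r (i, j)) = \<eta> r \<otimes>\<^bsub>B\<^esub> (x [^]\<^bsub>B\<^esub> i \<otimes>\<^bsub>B\<^esub> y [^]\<^bsub>B\<^esub> j)"
proof -
  interpret B: ring B by (rule B)
  interpret \<eta>: ring_hom_ring F B \<eta>
    by (rule ring_hom_ringI2[OF R.ring_axioms B central_homD(1)[OF \<eta>]])
  have x [simp]: "x \<in> carrier B" and y [simp]: "y \<in> carrier B"
    and xn: "x [^]\<^bsub>B\<^esub> n = \<eta> a" and yn: "y [^]\<^bsub>B\<^esub> n = \<eta> b"
    and yx: "y \<otimes>\<^bsub>B\<^esub> x = \<eta> \<omega> \<otimes>\<^bsub>B\<^esub> (x \<otimes>\<^bsub>B\<^esub> y)"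
    using rel by (auto simp: symbol_relations_def)
  have comm: "u \<otimes>\<^bsub>B\<^esub> \<eta> r = \<eta> r \<otimes>\<^bsub>B\<^esub> u" if "r \<in> carrier F" "u \<in> carrier B" for r u
    using central_homD(2)[OF \<eta> that] by simp
  have lcomm: "u \<otimes>\<^bsub>B\<^esub> (\<eta> r \<otimes>\<^bsub>B\<^esub> v) = \<eta> r \<otimes>\<^bsub>B\<^esub> (u \<otimes>\<^bsub>B\<^esub> v)"
    if "r \<in> carrier F" "u \<in> carrier B" "v \<in> carrier B" for r u v
    using that comm[OF that(1,2)] by (simp flip: B.m_assoc)
  have collect: "\<eta> r \<otimes>\<^bsub>B\<^esub> (\<eta> s \<otimes>\<^bsub>B\<^esub> u) = \<eta> (r \<otimes> s) \<otimes>\<^bsub>B\<^esub> u"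
    if "r \<in> carrier F" "s \<in> carrier F" "u \<in> carrier B" for r s u
    using that by (simp add: B.m_assoc)
  have yxk: "y \<otimes>\<^bsub>B\<^esub> x [^]\<^bsub>B\<^esub> k = \<eta> (\<omega> [^] k) \<otimes>\<^bsub>B\<^esub> (x [^]\<^bsub>B\<^esub> k \<otimes>\<^bsub>B\<^esub> y)" for k :: nat
  proof (induction k)
    case (Suc k)
    have "y \<otimes>\<^bsub>B\<^esub> x [^]\<^bsub>B\<^esub> Suc k = (y \<otimes>\<^bsub>B\<^esub> x [^]\<^bsub>B\<^esub> k) \<otimes>\<^bsub>B\<^esub> x" by (simp add: B.m_assoc)
    also have "\<dots> = \<eta> (\<omega> [^] k) \<otimes>\<^bsub>B\<^esub> (x [^]\<^bsub>B\<^esub> k \<otimes>\<^bsub>B\<^esub> (y \<otimes>\<^bsub>B\<^esub> x))" by (simp add: Suc B.m_assoc)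
    also have "\<dots> = \<eta> (\<omega> [^] Suc k) \<otimes>\<^bsub>B\<^esub> (x [^]\<^bsub>B\<^esub> Suc k \<otimes>\<^bsub>B\<^esub> y)"
      unfolding yx by (simp add: lcomm[of \<omega> "x [^]\<^bsub>B\<^esub> k"] collect B.m_assoc del: \<eta>.hom_mult)
    finally show ?case .
  qed simp
  have yjxk: "y [^]\<^bsub>B\<^esub> j \<otimes>\<^bsub>B\<^esub> x [^]\<^bsub>B\<^esub> k = \<eta> (\<omega> [^] (j * k)) \<otimes>\<^bsub>B\<^esub> (x [^]\<^bsub>B\<^esub> k \<otimes>\<^bsub>B\<^esub> y [^]\<^bsub>B\<^esub> j)" for j k :: nat
  proof (induction j)
    case (Suc j)
    have "y [^]\<^bsub>B\<^esub> Suc j \<otimes>\<^bsub>B\<^esub> x [^]\<^bsub>B\<^esub> k = y [^]\<^bsub>B\<^esub> j \<otimes>\<^bsub>B\<^esub> (y \<otimes>\<^bsub>B\<^esub> x [^]\<^bsub>B\<^esub> k)" by (simp add: B.m_assoc)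
    also have "\<dots> = \<eta> (\<omega> [^] k) \<otimes>\<^bsub>B\<^esub> ((y [^]\<^bsub>B\<^esub> j \<otimes>\<^bsub>B\<^esub> x [^]\<^bsub>B\<^esub> k) \<otimes>\<^bsub>B\<^esub> y)"
      unfolding yxk by (simp add: lcomm[of "\<omega> [^] k" "y [^]\<^bsub>B\<^esub> j"] B.m_assoc)
    also have "\<dots> = \<eta> (\<omega> [^] k \<otimes> \<omega> [^] (j * k)) \<otimes>\<^bsub>B\<^esub> (x [^]\<^bsub>B\<^esub> k \<otimes>\<^bsub>B\<^esub> y [^]\<^bsub>B\<^esub> Suc j)"
      by (simp add: Suc collect B.m_assoc del: \<eta>.hom_mult)
    finally show ?case by (simp add: R.nat_pow_mult)
  qed simp
  have reduce: "z [^]\<^bsub>B\<^esub> m = \<eta> (d [^] (m div n)) \<otimes>\<^bsub>B\<^esub> z [^]\<^bsub>B\<^esub> (m mod n)"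
    if "z [^]\<^bsub>B\<^esub> n = \<eta> d" "z \<in> carrier B" "d \<in> carrier F" for z d and m :: nat
  proof -
    have "z [^]\<^bsub>B\<^esub> m = z [^]\<^bsub>B\<^esub> (n * (m div n) + m mod n)" by simp
    also have "\<dots> = (z [^]\<^bsub>B\<^esub> n) [^]\<^bsub>B\<^esub> (m div n) \<otimes>\<^bsub>B\<^esub> z [^]\<^bsub>B\<^esub> (m mod n)"
      by (simp only: B.nat_pow_mult[symmetric] B.nat_pow_pow that(2) B.nat_pow_closed)
    finally show ?thesis using that by (simp add: \<eta>.hom_nat_pow)
  qed
  let ?\<phi> = "\<lambda>(i, j). x [^]\<^bsub>B\<^esub> i \<otimes>\<^bsub>B\<^esub> y [^]\<^bsub>B\<^esub> j"
  have "\<exists>h\<in>ring_hom T B. \<forall>r\<in>carrier F. \<forall>z\<in>carrier (residue_square n).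
      h (monomial F r z) = \<eta> r \<otimes>\<^bsub>B\<^esub> ?\<phi> z"
  proof (rule T.twisted_universal[OF B \<eta>])
    fix u v assume "u \<in> carrier (residue_square n)" "v \<in> carrier (residue_square n)"
    obtain i j where u: "u = (i, j)" by (cases u)
    obtain k l where v: "v = (k, l)" by (cases v)
    have "?\<phi> u \<otimes>\<^bsub>B\<^esub> ?\<phi> v = x [^]\<^bsub>B\<^esub> i \<otimes>\<^bsub>B\<^esub> ((y [^]\<^bsub>B\<^esub> j \<otimes>\<^bsub>B\<^esub> x [^]\<^bsub>B\<^esub> k) \<otimes>\<^bsub>B\<^esub> y [^]\<^bsub>B\<^esub> l)"
      by (simp add: u v B.m_assoc)
    also have "\<dots> = \<eta> (\<omega> [^] (j * k)) \<otimes>\<^bsub>B\<^esub> (x [^]\<^bsub>B\<^esub> (i + k) \<otimes>\<^bsub>B\<^esub> y [^]\<^bsub>B\<^esub> (j + l))"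
      by (simp add: yjxk lcomm[of "\<omega> [^] (j * k)" "x [^]\<^bsub>B\<^esub> i"] B.m_assoc B.nat_pow_mult[symmetric])
    also have "\<dots> = \<eta> (\<omega> [^] (j * k)) \<otimes>\<^bsub>B\<^esub> ((\<eta> (a [^] ((i + k) div n)) \<otimes>\<^bsub>B\<^esub> x [^]\<^bsub>B\<^esub> ((i + k) mod n)) \<otimes>\<^bsub>B\<^esub>
        (\<eta> (b [^] ((j + l) div n)) \<otimes>\<^bsub>B\<^esub> y [^]\<^bsub>B\<^esub> ((j + l) mod n)))"
      using reduce[OF xn, of "i + k"] reduce[OF yn, of "j + l"] by simp
    also have "\<dots> = \<eta> (symbol_cocycle F n \<omega> a b u v) \<otimes>\<^bsub>B\<^esub> ?\<phi> (u \<otimes>\<^bsub>residue_square n\<^esub> v)"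
      by (simp add: u v symbol_cocycle_def lcomm[of "b [^] ((j + l) div n)" "x [^]\<^bsub>B\<^esub> ((i + k) mod n)"]
          collect B.m_assoc R.m_assoc del: \<eta>.hom_mult)
    finally show "?\<phi> u \<otimes>\<^bsub>B\<^esub> ?\<phi> v = \<eta> (symbol_cocycle F n \<omega> a b u v) \<otimes>\<^bsub>B\<^esub> ?\<phi> (u \<otimes>\<^bsub>residue_square n\<^esub> v)" .
  qed (auto split: prod.splits)
  then show ?thesis by (auto simp: Ball_def)
qed

end

section \<open>The symbol algebra given by generators and relations\<close>

lemma central_hom_compose:
  assumes f: "f \<in> ring_hom R S" and g: "central_hom S B g"
  shows "central_hom R B (\<lambda>r. g (f r))"
  using ring_hom_trans[OF f central_homD(1)[OF g]] central_homD(2)[OF g] ring_hom_closed[OF f]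
  by (simp add: central_hom_def comp_def)

lemma monoid_symbol_words: "monoid symbol_words"
  by (rule monoidI) (auto simp: symbol_words_def)

lemma symbol_words_simps [simp]:
  "carrier symbol_words = UNIV" "u \<otimes>\<^bsub>symbol_words\<^esub> v = u @ v" "\<one>\<^bsub>symbol_words\<^esub> = []"
  by (simp_all add: symbol_words_def)

context symbol_data
begin

abbreviation "W \<equiv> free_xy F"

lemma twisted_algebra_W: "twisted_algebra F symbol_words (\<lambda>_ _. \<one>) W"
  unfolding free_xy_def
  by (rule twisted_algebra_monoid_algebra[OF R.cring_axioms monoid_symbol_words])

sublocale W: twisted_algebra F symbol_words "\<lambda>_ _. \<one>" W
  by (rule twisted_algebra_W)

lemma smult_one_W: "r \<in> carrier F \<Longrightarrow> r \<odot>\<^bsub>W\<^esub> \<one>\<^bsub>W\<^esub> = monomial F r []"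
  by (simp add: free_xy_def monoid_algebra_def single_eq_monomial monomial_def fun_eq_iff)

text \<open>The relators are written with the module action, while ring homomorphisms see only sums
  and products. Rewriting the action as multiplication by a constant makes the relators accessible
  to them.\<close>

lemma smult_W:
  assumes "r \<in> carrier F" "f \<in> carrier W"
  shows "r \<odot>\<^bsub>W\<^esub> f = monomial F r [] \<otimes>\<^bsub>W\<^esub> f"
  using assms(2)
proof (induction f rule: W.twisted_induct)
  case zero
  have "r \<odot>\<^bsub>W\<^esub> \<zero>\<^bsub>W\<^esub> = \<zero>\<^bsub>W\<^esub>" using assms(1) by (simp add: free_xy_def monoid_algebra_def)
  then show ?case using assms(1) by simp
next
  case (add f g)
  have "r \<odot>\<^bsub>W\<^esub> (f \<oplus>\<^bsub>W\<^esub> g) = r \<odot>\<^bsub>W\<^esub> f \<oplus>\<^bsub>W\<^esub> r \<odot>\<^bsub>W\<^esub> g"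
    using W.coeff_closed[OF add(1)] W.coeff_closed[OF add(2)] assms(1)
    by (simp add: free_xy_def monoid_algebra_def R.r_distr)
  then show ?case using add assms(1) by (simp add: W.P.r_distr)
next
  case (monomial s w)
  then show ?case using assms(1)
    by (simp add: W.monomial_mult) (simp add: free_xy_def monoid_algebra_def monomial_def fun_eq_iff)
qed

lemma symbol_relators_eq:
  "symbol_relators F n \<omega> a b =
    {monomial F \<one> [Gen_x] [^]\<^bsub>W\<^esub> n \<ominus>\<^bsub>W\<^esub> monomial F a [],
     monomial F \<one> [Gen_y] [^]\<^bsub>W\<^esub> n \<ominus>\<^bsub>W\<^esub> monomial F b [],
     monomial F \<one> [Gen_y] \<otimes>\<^bsub>W\<^esub> monomial F \<one> [Gen_x] \<ominus>\<^bsub>W\<^esub>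
       monomial F \<omega> [] \<otimes>\<^bsub>W\<^esub> (monomial F \<one> [Gen_x] \<otimes>\<^bsub>W\<^esub> monomial F \<one> [Gen_y])}"
proof -
  have "\<omega> \<odot>\<^bsub>W\<^esub> (monomial F \<one> [Gen_x] \<otimes>\<^bsub>W\<^esub> monomial F \<one> [Gen_y]) =
      monomial F \<omega> [] \<otimes>\<^bsub>W\<^esub> (monomial F \<one> [Gen_x] \<otimes>\<^bsub>W\<^esub> monomial F \<one> [Gen_y])"
    by (rule smult_W) simp_all
  then show ?thesis
    by (simp only: symbol_relators_def Let_def single_eq_monomial smult_one_W parameters_closed)
qed

lemma relators_closed: "symbol_relators F n \<omega> a b \<subseteq> carrier W"
  unfolding symbol_relators_eq insert_subset by (intro conjI empty_subsetI W.minus_closed) simp_all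

abbreviation "I \<equiv> Idl\<^bsub>W\<^esub> (symbol_relators F n \<omega> a b)"

sublocale I: ideal I W
  by (rule W.P.genideal_ideal[OF relators_closed])

sublocale Q: ring "W Quot I"
  by (rule I.quotient_is_ring)

abbreviation "A \<equiv> symbol_algebra F n \<omega> a b"

lemma A_simps:
  "carrier A = carrier (W Quot I)" "x \<oplus>\<^bsub>A\<^esub> y = x \<oplus>\<^bsub>W Quot I\<^esub> y" "x \<otimes>\<^bsub>A\<^esub> y = x \<otimes>\<^bsub>W Quot I\<^esub> y"
  "\<one>\<^bsub>A\<^esub> = \<one>\<^bsub>W Quot I\<^esub>" "\<zero>\<^bsub>A\<^esub> = \<zero>\<^bsub>W Quot I\<^esub>"
  by (simp_all add: symbol_algebra_def quot_algebra_def)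

sublocale A: ring A
  by (rule ring_of_eq_operations[OF Q.ring_axioms]) (simp_all add: A_simps)

abbreviation "coset f \<equiv> I +>\<^bsub>W\<^esub> f"
abbreviation "scalar_A r \<equiv> coset (monomial F r [])"
abbreviation "x_A \<equiv> coset (monomial F \<one> [Gen_x])"
abbreviation "y_A \<equiv> coset (monomial F \<one> [Gen_y])"

lemma coset_hom_A: "(\<lambda>f. coset f) \<in> ring_hom W A"
  using I.rcos_ring_hom by (simp add: ring_hom_def A_simps)

lemma ring_hom_ring_coset: "ring_hom_ring W A (\<lambda>f. coset f)"
  by (rule ring_hom_ringI2[OF W.ring A.ring_axioms coset_hom_A])

lemma coset_closed [simp]: "f \<in> carrier W \<Longrightarrow> coset f \<in> carrier A"
  by (rule ring_hom_closed[OF coset_hom_A])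

lemma coset_add: "\<lbrakk>f \<in> carrier W; g \<in> carrier W\<rbrakk> \<Longrightarrow> coset (f \<oplus>\<^bsub>W\<^esub> g) = coset f \<oplus>\<^bsub>A\<^esub> coset g"
  by (rule ring_hom_add[OF coset_hom_A])

lemma coset_mult: "\<lbrakk>f \<in> carrier W; g \<in> carrier W\<rbrakk> \<Longrightarrow> coset (f \<otimes>\<^bsub>W\<^esub> g) = coset f \<otimes>\<^bsub>A\<^esub> coset g"
  by (rule ring_hom_mult[OF coset_hom_A])

lemma coset_pow: "f \<in> carrier W \<Longrightarrow> coset (f [^]\<^bsub>W\<^esub> (k :: nat)) = coset f [^]\<^bsub>A\<^esub> k"
  by (rule ring_hom_ring.hom_nat_pow[OF ring_hom_ring_coset])

lemma A_coset_ex: "u \<in> carrier A \<Longrightarrow> \<exists>f\<in>carrier W. u = coset f"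
  by (auto simp: A_simps FactRing_simps)

lemma central_hom_scalar_A: "central_hom F A (\<lambda>r. scalar_A r)"
proof -
  note c = central_homD[OF W.central_hom_monomial_one, simplified]
  have hom: "(\<lambda>r. scalar_A r) \<in> ring_hom F A"
    using ring_hom_trans[OF c(1) coset_hom_A] by (simp add: comp_def)
  moreover have "scalar_A r \<otimes>\<^bsub>A\<^esub> u = u \<otimes>\<^bsub>A\<^esub> scalar_A r" if r: "r \<in> carrier F" and u: "u \<in> carrier A" for r u
  proof -
    obtain f where f: "f \<in> carrier W" "u = coset f" using A_coset_ex[OF u] by blast
    then show ?thesis using c(2)[OF r f(1)] r by (simp flip: coset_mult)
  qed
  ultimately show ?thesis by (simp add: central_hom_def)
qed

lemma symbol_relations_A: "symbol_relations F A (\<lambda>r. scalar_A r) n \<omega> a b x_A y_A"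
proof -
  let ?x = "monomial F \<one> [Gen_x]" and ?y = "monomial F \<one> [Gen_y]"
  have x: "?x \<in> carrier W" and y: "?y \<in> carrier W" by simp_all
  have rel: "coset f = coset g"
    if "f \<ominus>\<^bsub>W\<^esub> g \<in> symbol_relators F n \<omega> a b" "f \<in> carrier W" "g \<in> carrier W" for f g
  proof -
    have "f \<ominus>\<^bsub>W\<^esub> g \<in> I" using W.P.genideal_self[OF relators_closed] that(1) by blast
    then show ?thesis using W.P.quotient_eq_iff_same_a_r_cos[OF I.is_ideal that(2,3)] by simp
  qed
  have "coset (?x [^]\<^bsub>W\<^esub> n) = scalar_A a"
    by (rule rel) (simp_all only: symbol_relators_eq insertI1, simp_all)
  moreover have "coset (?y [^]\<^bsub>W\<^esub> n) = scalar_A b"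
    by (rule rel) (simp_all only: symbol_relators_eq insertI1 insertI2, simp_all)
  moreover have "coset (?y \<otimes>\<^bsub>W\<^esub> ?x) = coset (monomial F \<omega> [] \<otimes>\<^bsub>W\<^esub> (?x \<otimes>\<^bsub>W\<^esub> ?y))"
    by (rule rel) (simp_all only: symbol_relators_eq insertI1 insertI2, simp_all)
  ultimately show ?thesis
    by (simp add: symbol_relations_def coset_pow coset_mult)
qed

text \<open>A word is the product of its letters, so scalars and the two generators generate the
  quotient as a ring. The rule reduces surjectivity claims to these generators.\<close>

lemma symbol_algebra_induct [consumes 1, case_names scalar x y add mult]:
  assumes u: "u \<in> carrier A"
    and scalar: "\<And>r. r \<in> carrier F \<Longrightarrow> Q (scalar_A r)" and x: "Q x_A" and y: "Q y_A"
    and add: "\<And>u v. \<lbrakk>u \<in> carrier A; v \<in> carrier A; Q u; Q v\<rbrakk> \<Longrightarrow> Q (u \<oplus>\<^bsub>A\<^esub> v)"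
    and mult: "\<And>u v. \<lbrakk>u \<in> carrier A; v \<in> carrier A; Q u; Q v\<rbrakk> \<Longrightarrow> Q (u \<otimes>\<^bsub>A\<^esub> v)"
  shows "Q u"
proof -
  obtain f where f: "f \<in> carrier W" "u = coset f" using A_coset_ex[OF u] by blast
  have "Q (coset f)" using f(1)
  proof (induction f rule: W.twisted_induct)
    case zero
    then show ?case using scalar[of \<zero>] by simp
  next
    case (add f g)
    then show ?case using assms(5)[of "coset f" "coset g"] by (simp add: coset_add)
  next
    case (monomial r w)
    have "Q (coset (monomial F \<one> w))"
    proof (induction w)
      case Nil
      then show ?case using scalar[of \<one>] by simp
    next
      case (Cons g w)
      have eq: "monomial F \<one> (g # w) = monomial F \<one> [g] \<otimes>\<^bsub>W\<^esub> monomial F \<one> w"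
        by (simp add: W.monomial_mult)
      have "Q (coset (monomial F \<one> [g]))" using x y by (cases g) auto
      then show ?case unfolding eq using mult[OF _ _ _ Cons] by (simp add: coset_mult)
    qed
    then have "Q (scalar_A r \<otimes>\<^bsub>A\<^esub> coset (monomial F \<one> w))"
      using monomial by (intro mult scalar) simp_all
    then show ?case using monomial by (simp flip: coset_mult add: W.monomial_mult)
  qed
  then show ?thesis using f by simp
qed

text \<open>Words are sent to products of \<open>x\<close> and \<open>y\<close>, and the relations
  put the relators into the kernel. The conclusion records the values on scalars, which are what
  compatibility with a later base change asks for.\<close>

lemma symbol_algebra_universal:
  assumes B: "ring B" and \<eta>: "central_hom F B \<eta>" and rel: "symbol_relations F B \<eta> n \<omega> a b x y"
  shows "\<exists>k\<in>ring_hom A B. \<forall>r\<in>carrier F. k (scalar_A r) = \<eta> r"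
proof -
  interpret B: ring B by (rule B)
  interpret \<eta>: ring_hom_ring F B \<eta>
    by (rule ring_hom_ringI2[OF R.ring_axioms B central_homD(1)[OF \<eta>]])
  have x [simp]: "x \<in> carrier B" and y [simp]: "y \<in> carrier B"
    and xn: "x [^]\<^bsub>B\<^esub> n = \<eta> a" and yn: "y [^]\<^bsub>B\<^esub> n = \<eta> b"
    and yx: "y \<otimes>\<^bsub>B\<^esub> x = \<eta> \<omega> \<otimes>\<^bsub>B\<^esub> (x \<otimes>\<^bsub>B\<^esub> y)"
    using rel by (auto simp: symbol_relations_def)
  define \<phi> where "\<phi> w = foldr (\<lambda>g u. (case g of Gen_x \<Rightarrow> x | Gen_y \<Rightarrow> y) \<otimes>\<^bsub>B\<^esub> u) w \<one>\<^bsub>B\<^esub>" for w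
  have \<phi>_closed: "\<phi> w \<in> carrier B" for w
    by (induction w) (auto simp: \<phi>_def split: symbol_gen.split)
  have \<phi>_append: "\<phi> (u @ v) = \<phi> u \<otimes>\<^bsub>B\<^esub> \<phi> v" for u v
  proof (induction u)
    case Nil
    then show ?case using \<phi>_closed[of v] by (simp add: \<phi>_def)
  next
    case (Cons g u)
    then show ?case using \<phi>_closed[of u] \<phi>_closed[of v]
      by (auto simp: \<phi>_def B.m_assoc split: symbol_gen.split)
  qed
  have "\<exists>h\<in>ring_hom W B. \<forall>r\<in>carrier F. \<forall>w\<in>carrier symbol_words.
      h (monomial F r w) = \<eta> r \<otimes>\<^bsub>B\<^esub> \<phi> w"
  proof (rule W.twisted_universal[OF B \<eta>])
    show "\<phi> \<one>\<^bsub>symbol_words\<^esub> = \<one>\<^bsub>B\<^esub>" by (simp add: \<phi>_def)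
    show "\<phi> u \<otimes>\<^bsub>B\<^esub> \<phi> v = \<eta> \<one> \<otimes>\<^bsub>B\<^esub> \<phi> (u \<otimes>\<^bsub>symbol_words\<^esub> v)" for u v
      by (simp add: \<phi>_append \<phi>_closed)
  qed (rule \<phi>_closed)
  then obtain h where h1: "h \<in> ring_hom W B"
    and h2: "\<forall>r\<in>carrier F. \<forall>w\<in>carrier symbol_words. h (monomial F r w) = \<eta> r \<otimes>\<^bsub>B\<^esub> \<phi> w"
    by (rule bexE)
  have h3: "h (monomial F r w) = \<eta> r \<otimes>\<^bsub>B\<^esub> \<phi> w" if "r \<in> carrier F" for r w
    by (rule h2[rule_format, OF that]) simp
  note h = h1 h3
  interpret h: ring_hom_ring W B h by (rule ring_hom_ringI2[OF W.ring B h(1)])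
  have gens: "h (monomial F \<one> [Gen_x]) = x" "h (monomial F \<one> [Gen_y]) = y"
    unfolding h(2)[OF R.one_closed] by (simp_all add: \<phi>_def)
  have scalars: "h (monomial F r []) = \<eta> r" if "r \<in> carrier F" for r
    unfolding h(2)[OF that] using that by (simp add: \<phi>_def)
  let ?x = "monomial F \<one> [Gen_x]" and ?y = "monomial F \<one> [Gen_y]"
  have W: "?x \<in> carrier W" "?y \<in> carrier W" "\<And>r. r \<in> carrier F \<Longrightarrow> monomial F r [] \<in> carrier W"
    by simp_all
  have kerI: "f \<ominus>\<^bsub>W\<^esub> g \<in> a_kernel W B h"
    if f: "f \<in> carrier W" and g: "g \<in> carrier W" and eq: "h f = h g" for f g
  proof -
    have "h (f \<ominus>\<^bsub>W\<^esub> g) = h f \<oplus>\<^bsub>B\<^esub> h (\<ominus>\<^bsub>W\<^esub> g)"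
      unfolding a_minus_def by (rule h.hom_add[OF f W.a_inv_closed[OF g]])
    also have "\<dots> = \<zero>\<^bsub>B\<^esub>"
      unfolding h.hom_a_inv[OF g] eq by (rule B.r_neg[OF h.hom_closed[OF g]])
    finally show ?thesis using W.minus_closed[OF f g] unfolding a_kernel_def' by blast
  qed
  have "h (?x [^]\<^bsub>W\<^esub> n) = h (monomial F a [])"
    unfolding h.hom_nat_pow[OF W(1)] gens scalars[OF parameters_closed(2)] by (rule xn)
  moreover have "h (?y [^]\<^bsub>W\<^esub> n) = h (monomial F b [])"
    unfolding h.hom_nat_pow[OF W(2)] gens scalars[OF parameters_closed(3)] by (rule yn)
  moreover have "h (?y \<otimes>\<^bsub>W\<^esub> ?x) = h (monomial F \<omega> [] \<otimes>\<^bsub>W\<^esub> (?x \<otimes>\<^bsub>W\<^esub> ?y))"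
    by (simp only: h.hom_mult W W.P.m_closed R.one_closed parameters_closed gens scalars yx)
  ultimately have "symbol_relators F n \<omega> a b \<subseteq> a_kernel W B h"
    unfolding symbol_relators_eq insert_subset
    by (intro conjI empty_subsetI kerI W.P.nat_pow_closed W.P.m_closed W R.one_closed parameters_closed)
  then have ker: "I \<subseteq> a_kernel W B h"
    by (rule W.P.genideal_minimal[OF h.kernel_is_ideal])
  obtain k where k: "k \<in> ring_hom (W Quot I) B" "\<And>f. f \<in> carrier W \<Longrightarrow> k (coset f) = h f"
    using h.factor_through_quotient[OF I.is_ideal h.kernel_zero[OF subsetD[OF ker]]] by blast
  have "k \<in> ring_hom A B" using k(1) by (simp add: ring_hom_def A_simps)
  moreover have "k (scalar_A r) = \<eta> r" if "r \<in> carrier F" for r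
    using that by (simp add: k(2) scalars)
  ultimately show ?thesis by blast
qed

text \<open>The image contains the scalars, \<open>x\<close> and \<open>y\<close>, so the map is
  onto whenever these generate \<open>B\<close>; each application establishes that by induction over
  \<open>B\<close>.\<close>

lemma model_onto_algebra:
  assumes B: "ring B" and \<eta>: "central_hom F B \<eta>" and rel: "symbol_relations F B \<eta> n \<omega> a b x y"
  shows "\<exists>h\<in>ring_hom T B. (\<forall>r\<in>carrier F. h (scalar r) = \<eta> r) \<and> h gen_x = x \<and> h gen_y = y"
proof -
  interpret B: ring B by (rule B)
  interpret \<eta>: ring_hom_ring F B \<eta>
    by (rule ring_hom_ringI2[OF R.ring_axioms B central_homD(1)[OF \<eta>]])
  have x: "x \<in> carrier B" and y: "y \<in> carrier B" using rel by (auto simp: symbol_relations_def)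
  obtain h where h: "h \<in> ring_hom T B" "\<And>r i j. \<lbrakk>r \<in> carrier F; i < n; j < n\<rbrakk>
      \<Longrightarrow> h (monomial F r (i, j)) = \<eta> r \<otimes>\<^bsub>B\<^esub> (x [^]\<^bsub>B\<^esub> i \<otimes>\<^bsub>B\<^esub> y [^]\<^bsub>B\<^esub> j)"
    using symbol_model_universal[OF assms] by blast
  then show ?thesis using n x y by (intro bexI[OF _ h(1)]) (auto simp: h(2))
qed

text \<open>The map from \<open>A\<close> to \<open>T\<close> shows that \<open>A\<close> is not the
  zero ring, since \<open>T\<close> is not. The map from \<open>T\<close> to \<open>A\<close> hits
  the scalars and both generators, so it is onto and carries inverses along.\<close>

theorem division_symbol_algebra:
  assumes F: "field F" and T: "Units T = carrier T - {\<zero>\<^bsub>T\<^esub>}"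
  shows "division_algebra F A"
proof -
  have one_T: "\<one>\<^bsub>T\<^esub> \<noteq> \<zero>\<^bsub>T\<^esub>" using T T.P.Units_one_closed by auto
  obtain k where k: "k \<in> ring_hom A T"
    using symbol_algebra_universal[OF T.ring central_hom_scalar symbol_relations_model] by blast
  interpret k: ring_hom_ring A T k by (rule ring_hom_ringI2[OF A.ring_axioms T.ring k])
  have one_A: "\<one>\<^bsub>A\<^esub> \<noteq> \<zero>\<^bsub>A\<^esub>" using one_T k.hom_one k.hom_zero by metis
  obtain h where h: "h \<in> ring_hom T A" "\<And>r. r \<in> carrier F \<Longrightarrow> h (scalar r) = scalar_A r"
      "h gen_x = x_A" "h gen_y = y_A"
    using model_onto_algebra[OF A.ring_axioms central_hom_scalar_A symbol_relations_A] by blast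
  interpret h: ring_hom_ring T A h by (rule ring_hom_ringI2[OF T.ring A.ring_axioms h(1)])
  have "u \<in> h ` carrier T" if "u \<in> carrier A" for u
    using that
  proof (induction u rule: symbol_algebra_induct)
    case (scalar r)
    then show ?case using n by (intro image_eqI[of _ _ "scalar r"]) (auto simp: h(2))
  next
    case x
    then show ?case using n by (intro image_eqI[of _ _ gen_x]) (auto simp: h(3))
  next
    case y
    then show ?case using n by (intro image_eqI[of _ _ gen_y]) (auto simp: h(4))
  next
    case (add u v)
    then show ?case by (auto simp flip: h.hom_add intro!: imageI)
  next
    case (mult u v)
    then show ?case by (auto simp flip: h.hom_mult intro!: imageI)
  qed
  then have "Units A = carrier A - {\<zero>\<^bsub>A\<^esub>}"
    by (intro Units_surjective_image[OF T.ring T A.ring_axioms one_A h(1)]) blast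
  moreover have "central_hom F (W Quot I) (\<lambda>c. coset (c \<odot>\<^bsub>W\<^esub> \<one>\<^bsub>W\<^esub>))"
    using central_hom_scalar_A
    by (auto simp: central_hom_def ring_hom_def A_simps smult_one_W)
  then have "assoc_algebra F A"
    unfolding symbol_algebra_def by (rule assoc_algebra_quot_algebra[OF R.cring_axioms I.is_ideal])
  ultimately show ?thesis using F by (simp add: division_algebra_def)
qed

end

section \<open>Extension of scalars\<close>

text \<open>The tensor product is a quotient of an integral monoid ring, so mapping out of it starts
  from the canonical map of the integers to an arbitrary ring.\<close>

lemma central_hom_int:
  assumes B: "ring B" shows "central_hom \<Z> B (\<lambda>n. add_pow B n \<one>\<^bsub>B\<^esub>)"
proof -
  interpret B: ring B by (rule B)
  have closed: "add_pow B n \<one>\<^bsub>B\<^esub> \<in> carrier B" for n :: int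
    by (rule B.add.int_pow_closed) simp
  have mult: "add_pow B n \<one>\<^bsub>B\<^esub> \<otimes>\<^bsub>B\<^esub> add_pow B m \<one>\<^bsub>B\<^esub> = add_pow B (n * m) \<one>\<^bsub>B\<^esub>" for n m :: int
    using B.add_pow_ldistr_int[of "\<one>\<^bsub>B\<^esub>" "add_pow B m \<one>\<^bsub>B\<^esub>" n] B.add.int_pow_pow[of "\<one>\<^bsub>B\<^esub>" n m]
    by (simp add: closed mult.commute[of m n])
  have add: "add_pow B (n + m) \<one>\<^bsub>B\<^esub> = add_pow B n \<one>\<^bsub>B\<^esub> \<oplus>\<^bsub>B\<^esub> add_pow B m \<one>\<^bsub>B\<^esub>" for n m :: int
    by (rule B.add.int_pow_mult) simp
  have one: "add_pow B (1 :: int) \<one>\<^bsub>B\<^esub> = \<one>\<^bsub>B\<^esub>"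
    by (rule B.add.int_pow_1) simp
  have central: "add_pow B n \<one>\<^bsub>B\<^esub> \<otimes>\<^bsub>B\<^esub> b = b \<otimes>\<^bsub>B\<^esub> add_pow B n \<one>\<^bsub>B\<^esub>" if "b \<in> carrier B" for n :: int and b
    using B.add_pow_ldistr_int[of "\<one>\<^bsub>B\<^esub>" b n] B.add_pow_rdistr_int[of b "\<one>\<^bsub>B\<^esub>" n] that by simp
  have "(\<lambda>n. add_pow B n \<one>\<^bsub>B\<^esub>) \<in> ring_hom \<Z> B"
  proof (rule ring_hom_memI)
    show "add_pow B \<one>\<^bsub>\<Z>\<^esub> \<one>\<^bsub>B\<^esub> = \<one>\<^bsub>B\<^esub>" using one by simp
    show "add_pow B (n \<otimes>\<^bsub>\<Z>\<^esub> m) \<one>\<^bsub>B\<^esub> = add_pow B n \<one>\<^bsub>B\<^esub> \<otimes>\<^bsub>B\<^esub> add_pow B m \<one>\<^bsub>B\<^esub>" for n m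
      unfolding mult by simp
    show "add_pow B (n \<oplus>\<^bsub>\<Z>\<^esub> m) \<one>\<^bsub>B\<^esub> = add_pow B n \<one>\<^bsub>B\<^esub> \<oplus>\<^bsub>B\<^esub> add_pow B m \<one>\<^bsub>B\<^esub>" for n m
      unfolding add[symmetric] by simp
  qed (rule closed)
  then show ?thesis
    unfolding central_hom_def using central by blast
qed

text \<open>The two closure conditions are what places the third kind of relator, the one moving
  scalars across the tensor sign, inside the carrier of \<open>Z\<close>.\<close>

locale base_change = A: ring A + L: cring L
  for K :: "('k, 'u) ring_scheme" and A :: "('k, 'a, 'v) module_scheme" and L :: "('l, 'w) ring_scheme" +
  fixes \<iota> :: "'k \<Rightarrow> 'l"
  assumes smult_closed: "\<lbrakk>k \<in> carrier K; a \<in> carrier A\<rbrakk> \<Longrightarrow> k \<odot>\<^bsub>A\<^esub> a \<in> carrier A"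
    and \<iota>_closed: "k \<in> carrier K \<Longrightarrow> \<iota> k \<in> carrier L"
begin

abbreviation "Z \<equiv> monoid_algebra \<Z> (A \<times>\<times> L)"
abbreviation "e \<equiv> monomial \<Z> (1 :: int) :: 'a \<times> 'l \<Rightarrow> 'a \<times> 'l \<Rightarrow> int"

lemma twisted_algebra_Z: "twisted_algebra \<Z> (A \<times>\<times> L) (\<lambda>_ _. \<one>\<^bsub>\<Z>\<^esub>) Z"
  by (rule twisted_algebra_monoid_algebra[OF int_is_cring DirProd_monoid])
    (rule A.monoid_axioms L.monoid_axioms)+

sublocale Z: twisted_algebra \<Z> "A \<times>\<times> L" "\<lambda>_ _. \<one>\<^bsub>\<Z>\<^esub>" Z
  by (rule twisted_algebra_Z)

lemma e_closed: "\<lbrakk>a \<in> carrier A; l \<in> carrier L\<rbrakk> \<Longrightarrow> e (a, l) \<in> carrier Z"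
  by (rule Z.monomial_closed) simp_all

lemma e_mult:
  assumes "a \<in> carrier A" "l \<in> carrier L" "a' \<in> carrier A" "l' \<in> carrier L"
  shows "e (a, l) \<otimes>\<^bsub>Z\<^esub> e (a', l') = e (a \<otimes>\<^bsub>A\<^esub> a', l \<otimes>\<^bsub>L\<^esub> l')"
  using Z.monomial_mult[of 1 1 "(a, l)" "(a', l')"] assms by simp

lemma single_int: "single \<Z> z = monomial \<Z> 1 z"
  by (simp add: single_eq_monomial)

lemma tensor_relators_cases:
  assumes "r \<in> tensor_relators K A L \<iota>"
  obtains (add_left) a a' l where "r = e (a \<oplus>\<^bsub>A\<^esub> a', l) \<ominus>\<^bsub>Z\<^esub> (e (a, l) \<oplus>\<^bsub>Z\<^esub> e (a', l))"
      "a \<in> carrier A" "a' \<in> carrier A" "l \<in> carrier L"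
    | (add_right) a l l' where "r = e (a, l \<oplus>\<^bsub>L\<^esub> l') \<ominus>\<^bsub>Z\<^esub> (e (a, l) \<oplus>\<^bsub>Z\<^esub> e (a, l'))"
      "a \<in> carrier A" "l \<in> carrier L" "l' \<in> carrier L"
    | (smult) k a l where "r = e (k \<odot>\<^bsub>A\<^esub> a, l) \<ominus>\<^bsub>Z\<^esub> e (a, \<iota> k \<otimes>\<^bsub>L\<^esub> l)"
      "k \<in> carrier K" "a \<in> carrier A" "l \<in> carrier L"
  using assms unfolding tensor_relators_def Let_def single_int by blast

lemma relators_closed: "tensor_relators K A L \<iota> \<subseteq> carrier Z"
proof
  fix r assume "r \<in> tensor_relators K A L \<iota>"
  then show "r \<in> carrier Z"
    by (cases rule: tensor_relators_cases)
      (simp_all only: Z.minus_closed Z.add.m_closed e_closed A.add.m_closed L.add.m_closed L.m_closed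
        smult_closed \<iota>_closed)
qed

abbreviation "J \<equiv> Idl\<^bsub>Z\<^esub> (tensor_relators K A L \<iota>)"
abbreviation "E \<equiv> Z Quot J"

sublocale J: ideal J Z
  by (rule Z.P.genideal_ideal[OF relators_closed])

sublocale E: ring E
  by (rule J.quotient_is_ring)

abbreviation "t a l \<equiv> J +>\<^bsub>Z\<^esub> e (a, l)"

lemma E_coset_ex: "u \<in> carrier E \<Longrightarrow> \<exists>f\<in>carrier Z. u = J +>\<^bsub>Z\<^esub> f"
  by (auto simp: FactRing_simps)

lemmas coset_hom = J.rcos_ring_hom

lemma t_closed: "\<lbrakk>a \<in> carrier A; l \<in> carrier L\<rbrakk> \<Longrightarrow> t a l \<in> carrier E"
  by (rule ring_hom_closed[OF coset_hom e_closed])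

lemma coset_eqI:
  assumes "f \<ominus>\<^bsub>Z\<^esub> g \<in> tensor_relators K A L \<iota>" "f \<in> carrier Z" "g \<in> carrier Z"
  shows "J +>\<^bsub>Z\<^esub> f = J +>\<^bsub>Z\<^esub> g"
proof -
  have "f \<ominus>\<^bsub>Z\<^esub> g \<in> J" using Z.P.genideal_self[OF relators_closed] assms(1) by (rule subsetD)
  then show ?thesis using Z.P.quotient_eq_iff_same_a_r_cos[OF J.is_ideal assms(2,3)] by simp
qed

lemma t_add_left:
  assumes "a \<in> carrier A" "a' \<in> carrier A" "l \<in> carrier L"
  shows "t (a \<oplus>\<^bsub>A\<^esub> a') l = t a l \<oplus>\<^bsub>E\<^esub> t a' l"
proof -
  have "t (a \<oplus>\<^bsub>A\<^esub> a') l = J +>\<^bsub>Z\<^esub> (e (a, l) \<oplus>\<^bsub>Z\<^esub> e (a', l))"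
  proof (rule coset_eqI)
    show "e (a \<oplus>\<^bsub>A\<^esub> a', l) \<ominus>\<^bsub>Z\<^esub> (e (a, l) \<oplus>\<^bsub>Z\<^esub> e (a', l)) \<in> tensor_relators K A L \<iota>"
      unfolding tensor_relators_def Let_def single_int using assms by blast
  qed (simp_all only: Z.add.m_closed e_closed assms A.add.m_closed)
  then show ?thesis by (simp only: ring_hom_add[OF coset_hom] e_closed assms)
qed

lemma t_add_right:
  assumes "a \<in> carrier A" "l \<in> carrier L" "l' \<in> carrier L"
  shows "t a (l \<oplus>\<^bsub>L\<^esub> l') = t a l \<oplus>\<^bsub>E\<^esub> t a l'"
proof -
  have "t a (l \<oplus>\<^bsub>L\<^esub> l') = J +>\<^bsub>Z\<^esub> (e (a, l) \<oplus>\<^bsub>Z\<^esub> e (a, l'))"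
  proof (rule coset_eqI)
    show "e (a, l \<oplus>\<^bsub>L\<^esub> l') \<ominus>\<^bsub>Z\<^esub> (e (a, l) \<oplus>\<^bsub>Z\<^esub> e (a, l')) \<in> tensor_relators K A L \<iota>"
      unfolding tensor_relators_def Let_def single_int using assms by blast
  qed (simp_all only: Z.add.m_closed e_closed assms L.add.m_closed)
  then show ?thesis by (simp only: ring_hom_add[OF coset_hom] e_closed assms)
qed

lemma t_smult:
  assumes "k \<in> carrier K" "a \<in> carrier A" "l \<in> carrier L"
  shows "t (k \<odot>\<^bsub>A\<^esub> a) l = t a (\<iota> k \<otimes>\<^bsub>L\<^esub> l)"
proof (rule coset_eqI)
  show "e (k \<odot>\<^bsub>A\<^esub> a, l) \<ominus>\<^bsub>Z\<^esub> e (a, \<iota> k \<otimes>\<^bsub>L\<^esub> l) \<in> tensor_relators K A L \<iota>"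
    unfolding tensor_relators_def Let_def single_int using assms by blast
qed (simp_all only: e_closed assms L.m_closed smult_closed \<iota>_closed)

lemma t_mult:
  assumes "a \<in> carrier A" "l \<in> carrier L" "a' \<in> carrier A" "l' \<in> carrier L"
  shows "t a l \<otimes>\<^bsub>E\<^esub> t a' l' = t (a \<otimes>\<^bsub>A\<^esub> a') (l \<otimes>\<^bsub>L\<^esub> l')"
  using ring_hom_mult[OF coset_hom e_closed e_closed, OF assms] by (simp only: e_mult[OF assms])

lemma t_one: "t \<one>\<^bsub>A\<^esub> \<one>\<^bsub>L\<^esub> = \<one>\<^bsub>E\<^esub>"
  using ring_hom_one[OF coset_hom] Z.one_eq by simp

text \<open>An element is an integral combination of pure tensors. Nonnegative multiples come from
  repeated addition, the others from negation, and zero is a tensor plus its negative.\<close>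

lemma base_change_induct [consumes 1, case_names tensor add uminus]:
  assumes u: "u \<in> carrier E"
    and tensor: "\<And>a l. \<lbrakk>a \<in> carrier A; l \<in> carrier L\<rbrakk> \<Longrightarrow> Q (t a l)"
    and add: "\<And>u v. \<lbrakk>u \<in> carrier E; v \<in> carrier E; Q u; Q v\<rbrakk> \<Longrightarrow> Q (u \<oplus>\<^bsub>E\<^esub> v)"
    and uminus: "\<And>u. \<lbrakk>u \<in> carrier E; Q u\<rbrakk> \<Longrightarrow> Q (\<ominus>\<^bsub>E\<^esub> u)"
  shows "Q u"
proof -
  obtain f where f: "f \<in> carrier Z" "u = J +>\<^bsub>Z\<^esub> f" using E_coset_ex[OF u] by blast
  interpret c: ring_hom_ring Z E "\<lambda>f. J +>\<^bsub>Z\<^esub> f" by (rule J.rcos_ring_hom_ring)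
  have zero: "Q (J +>\<^bsub>Z\<^esub> \<zero>\<^bsub>Z\<^esub>)"
  proof -
    have cl: "t \<one>\<^bsub>A\<^esub> \<one>\<^bsub>L\<^esub> \<in> carrier E" by (rule t_closed) simp_all
    have "Q (t \<one>\<^bsub>A\<^esub> \<one>\<^bsub>L\<^esub>)" by (rule tensor) simp_all
    then have "Q (t \<one>\<^bsub>A\<^esub> \<one>\<^bsub>L\<^esub> \<oplus>\<^bsub>E\<^esub> \<ominus>\<^bsub>E\<^esub> t \<one>\<^bsub>A\<^esub> \<one>\<^bsub>L\<^esub>)"
      using cl by (intro add uminus E.a_inv_closed)
    then show ?thesis unfolding E.r_neg[OF cl] c.hom_zero .
  qed
  have "Q (J +>\<^bsub>Z\<^esub> f)" using f(1)
  proof (induction f rule: Z.twisted_induct)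
    case zero
    show ?case by (rule \<open>Q (J +>\<^bsub>Z\<^esub> \<zero>\<^bsub>Z\<^esub>)\<close>)
  next
    case (add f g)
    then show ?case unfolding c.hom_add[OF add(1,2)] by (intro assms(3) c.hom_closed)
  next
    case (monomial n z)
    obtain a l where z: "z = (a, l)" "a \<in> carrier A" "l \<in> carrier L" using monomial(2) by (cases z) auto
    have cl: "monomial \<Z> m z \<in> carrier Z" for m by (rule Z.monomial_closed) (use monomial(2) in simp_all)
    have nonneg: "Q (J +>\<^bsub>Z\<^esub> monomial \<Z> (int m) z)" for m
    proof (induction m)
      case 0
      then show ?case using zero Z.monomial_zero[of z] by simp
    next
      case (Suc m)
      have eq: "monomial \<Z> (int (Suc m)) z = e z \<oplus>\<^bsub>Z\<^esub> monomial \<Z> (int m) z"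
        using Z.monomial_add[of 1 "int m" z] by simp
      show ?case unfolding eq c.hom_add[OF cl cl]
        by (intro assms(3) c.hom_closed cl Suc) (use tensor[OF z(2,3)] z(1) in simp)
    qed
    show ?case
    proof (cases "n \<ge> 0")
      case True
      then show ?thesis using nonneg[of "nat n"] by simp
    next
      case False
      have "monomial \<Z> n z \<oplus>\<^bsub>Z\<^esub> monomial \<Z> (int (nat (- n))) z = \<zero>\<^bsub>Z\<^esub>"
        using Z.monomial_add[of n "int (nat (- n))" z] Z.monomial_zero[of z] False by simp
      then have eq: "monomial \<Z> n z = \<ominus>\<^bsub>Z\<^esub> monomial \<Z> (int (nat (- n))) z"
        by (rule Z.minus_equality[symmetric, OF _ cl cl])
      show ?thesis unfolding eq c.hom_a_inv[OF cl] by (intro uminus c.hom_closed cl nonneg)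
    qed
  qed
  then show ?thesis using f by simp
qed

text \<open>Multiplicativity of a \<otimes> l \<mapsto> \<open>\<eta> l \<otimes> \<kappa> a\<close>
  uses that \<eta> is central. The additive relators die by distributivity, the scalar relators by
  compatibility of \<kappa> with scalars and centrality.\<close>

lemma base_change_universal:
  assumes B: "ring B" and \<eta>: "central_hom L B \<eta>" and \<kappa>: "\<kappa> \<in> ring_hom A B"
    and smult: "\<And>k a. \<lbrakk>k \<in> carrier K; a \<in> carrier A\<rbrakk> \<Longrightarrow> \<kappa> (k \<odot>\<^bsub>A\<^esub> a) = \<eta> (\<iota> k) \<otimes>\<^bsub>B\<^esub> \<kappa> a"
  shows "\<exists>h\<in>ring_hom E B. \<forall>a\<in>carrier A. \<forall>l\<in>carrier L. h (t a l) = \<eta> l \<otimes>\<^bsub>B\<^esub> \<kappa> a"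
proof -
  interpret B: ring B by (rule B)
  note \<eta>_hom = central_homD(1)[OF \<eta>] and \<eta>_closed = central_homD(3)[OF \<eta>]
  note \<kappa>_closed = ring_hom_closed[OF \<kappa>]
  let ?\<phi> = "\<lambda>(a, l). \<eta> l \<otimes>\<^bsub>B\<^esub> \<kappa> a"
  have "\<exists>h\<in>ring_hom Z B. \<forall>n\<in>UNIV. \<forall>z\<in>carrier (A \<times>\<times> L).
      h (monomial \<Z> n z) = add_pow B n \<one>\<^bsub>B\<^esub> \<otimes>\<^bsub>B\<^esub> ?\<phi> z"
  proof (rule Z.twisted_universal[OF B central_hom_int[OF B], where \<phi> = ?\<phi>])
    show "?\<phi> z \<in> carrier B" if "z \<in> carrier (A \<times>\<times> L)" for z
      using that by (auto intro: B.m_closed \<eta>_closed \<kappa>_closed)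
    show "?\<phi> \<one>\<^bsub>A \<times>\<times> L\<^esub> = \<one>\<^bsub>B\<^esub>"
      by (simp add: ring_hom_one[OF \<eta>_hom] ring_hom_one[OF \<kappa>])
    fix y z assume "y \<in> carrier (A \<times>\<times> L)" "z \<in> carrier (A \<times>\<times> L)"
    then obtain a l a' l' where yz: "y = (a, l)" "z = (a', l')"
      and cl: "a \<in> carrier A" "l \<in> carrier L" "a' \<in> carrier A" "l' \<in> carrier L" by auto
    note clB = \<eta>_closed[OF cl(2)] \<eta>_closed[OF cl(4)] \<kappa>_closed[OF cl(1)] \<kappa>_closed[OF cl(3)]
    have "?\<phi> y \<otimes>\<^bsub>B\<^esub> ?\<phi> z = \<eta> l \<otimes>\<^bsub>B\<^esub> ((\<kappa> a \<otimes>\<^bsub>B\<^esub> \<eta> l') \<otimes>\<^bsub>B\<^esub> \<kappa> a')"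
      using clB by (simp add: yz B.m_assoc)
    also have "\<kappa> a \<otimes>\<^bsub>B\<^esub> \<eta> l' = \<eta> l' \<otimes>\<^bsub>B\<^esub> \<kappa> a"
      by (rule central_homD(2)[OF \<eta> cl(4) clB(3), symmetric])
    also have "\<eta> l \<otimes>\<^bsub>B\<^esub> ((\<eta> l' \<otimes>\<^bsub>B\<^esub> \<kappa> a) \<otimes>\<^bsub>B\<^esub> \<kappa> a') = ?\<phi> (y \<otimes>\<^bsub>A \<times>\<times> L\<^esub> z)"
      using clB cl by (simp add: yz B.m_assoc ring_hom_mult[OF \<eta>_hom] ring_hom_mult[OF \<kappa>])
    finally have *: "?\<phi> y \<otimes>\<^bsub>B\<^esub> ?\<phi> z = ?\<phi> (y \<otimes>\<^bsub>A \<times>\<times> L\<^esub> z)" .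
    have "?\<phi> (y \<otimes>\<^bsub>A \<times>\<times> L\<^esub> z) \<in> carrier B" using cl by (simp add: yz \<eta>_closed \<kappa>_closed)
    then show "?\<phi> y \<otimes>\<^bsub>B\<^esub> ?\<phi> z = add_pow B (1 :: int) \<one>\<^bsub>B\<^esub> \<otimes>\<^bsub>B\<^esub> ?\<phi> (y \<otimes>\<^bsub>A \<times>\<times> L\<^esub> z)"
      using * ring_hom_one[OF central_homD(1)[OF central_hom_int[OF B]]] by simp
  qed
  then obtain h where h: "h \<in> ring_hom Z B"
    and h_mono: "\<forall>n\<in>UNIV. \<forall>z\<in>carrier (A \<times>\<times> L). h (monomial \<Z> n z) = add_pow B n \<one>\<^bsub>B\<^esub> \<otimes>\<^bsub>B\<^esub> ?\<phi> z"
    by (rule bexE)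
  have h_e: "h (e (a, l)) = \<eta> l \<otimes>\<^bsub>B\<^esub> \<kappa> a" if "a \<in> carrier A" "l \<in> carrier L" for a l
    using h_mono[rule_format, of 1 "(a, l)"] that ring_hom_one[OF central_homD(1)[OF central_hom_int[OF B]]]
      \<eta>_closed[OF that(2)] \<kappa>_closed[OF that(1)] by simp
  interpret h: ring_hom_ring Z B h by (rule ring_hom_ringI2[OF Z.ring B h])
  have kerI: "f \<ominus>\<^bsub>Z\<^esub> g \<in> a_kernel Z B h"
    if f: "f \<in> carrier Z" and g: "g \<in> carrier Z" and eq: "h f = h g" for f g
  proof -
    have "h (f \<ominus>\<^bsub>Z\<^esub> g) = h f \<oplus>\<^bsub>B\<^esub> h (\<ominus>\<^bsub>Z\<^esub> g)"
      unfolding a_minus_def by (rule h.hom_add[OF f Z.a_inv_closed[OF g]])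
    also have "\<dots> = \<zero>\<^bsub>B\<^esub>"
      unfolding h.hom_a_inv[OF g] eq by (rule B.r_neg[OF h.hom_closed[OF g]])
    finally show ?thesis using Z.minus_closed[OF f g] unfolding a_kernel_def' by blast
  qed
  have "r \<in> a_kernel Z B h" if "r \<in> tensor_relators K A L \<iota>" for r
    using that
  proof (cases rule: tensor_relators_cases)
    case (add_left a a' l)
    then show ?thesis unfolding add_left(1)
      by (intro kerI) (simp_all only: Z.add.m_closed e_closed A.add.m_closed h.hom_add h_e
          ring_hom_add[OF \<kappa>] B.r_distr \<eta>_closed \<kappa>_closed)
  next
    case (add_right a l l')
    then show ?thesis unfolding add_right(1)
      by (intro kerI) (simp_all only: Z.add.m_closed e_closed L.add.m_closed h.hom_add h_e
          ring_hom_add[OF \<eta>_hom] B.l_distr \<eta>_closed \<kappa>_closed)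
  next
    case (smult k a l)
    note cl = smult(3,4) \<iota>_closed[OF smult(2)] \<kappa>_closed[OF smult(3)] \<eta>_closed[OF smult(4)]
      \<eta>_closed[OF \<iota>_closed[OF smult(2)]]
    have "\<eta> l \<otimes>\<^bsub>B\<^esub> (\<eta> (\<iota> k) \<otimes>\<^bsub>B\<^esub> \<kappa> a) = (\<eta> (\<iota> k) \<otimes>\<^bsub>B\<^esub> \<eta> l) \<otimes>\<^bsub>B\<^esub> \<kappa> a"
      using cl central_homD(2)[OF \<eta> cl(3) cl(5)] by (simp add: B.m_assoc)
    then have "h (e (k \<odot>\<^bsub>A\<^esub> a, l)) = h (e (a, \<iota> k \<otimes>\<^bsub>L\<^esub> l))"
      using cl by (simp only: h_e smult_closed[OF smult(2,3)] assms(4)[OF smult(2,3)] L.m_closed ring_hom_mult[OF \<eta>_hom])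
    then show ?thesis unfolding smult(1)
      by (intro kerI e_closed smult_closed L.m_closed \<iota>_closed smult(2-4))
  qed
  then have ker: "J \<subseteq> a_kernel Z B h"
    by (intro Z.P.genideal_minimal[OF h.kernel_is_ideal] subsetI)
  obtain k where k: "k \<in> ring_hom E B" "\<And>f. f \<in> carrier Z \<Longrightarrow> k (J +>\<^bsub>Z\<^esub> f) = h f"
    using h.factor_through_quotient[OF J.is_ideal h.kernel_zero[OF subsetD[OF ker]]] by blast
  have "k (t a l) = \<eta> l \<otimes>\<^bsub>B\<^esub> \<kappa> a" if "a \<in> carrier A" "l \<in> carrier L" for a l
    unfolding k(2)[OF e_closed[OF that]] by (rule h_e[OF that])
  then show ?thesis using k(1) by blast
qed

end

text \<open>1 \<otimes> l commutes with a \<otimes> l' because \<open>L\<close> is commutative, and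
  pure tensors suffice by \<open>base_change_induct\<close>. The long form is that of the structure
  map in \<open>scalar_extension\<close>, so that \<open>assoc_algebra_quot_algebra\<close> applies
  literally.\<close>

lemma central_hom_base_change:
  assumes "base_change K A L \<iota>"
  shows "central_hom L (monoid_algebra \<Z> (A \<times>\<times> L) Quot Idl\<^bsub>monoid_algebra \<Z> (A \<times>\<times> L)\<^esub> tensor_relators K A L \<iota>)
    (\<lambda>c. Idl\<^bsub>monoid_algebra \<Z> (A \<times>\<times> L)\<^esub> tensor_relators K A L \<iota> +>\<^bsub>monoid_algebra \<Z> (A \<times>\<times> L)\<^esub> single \<Z> (\<one>\<^bsub>A\<^esub>, c))"
proof -
  interpret base_change K A L \<iota> by (rule assms)
  have hom: "t \<one>\<^bsub>A\<^esub> \<in> ring_hom L E"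
    by (rule ring_hom_memI) (simp_all add: t_closed t_mult t_one t_add_right)
  have "t \<one>\<^bsub>A\<^esub> l \<otimes>\<^bsub>E\<^esub> u = u \<otimes>\<^bsub>E\<^esub> t \<one>\<^bsub>A\<^esub> l" if l: "l \<in> carrier L" and u: "u \<in> carrier E" for l u
    using u
  proof (induction u rule: base_change_induct)
    case (tensor a l')
    then show ?case using l by (simp add: t_mult L.m_comm)
  next
    case (add u v)
    have cl: "t \<one>\<^bsub>A\<^esub> l \<in> carrier E" by (rule t_closed) (use l in simp_all)
    show ?case unfolding E.l_distr[OF add(1,2) cl] E.r_distr[OF add(1,2) cl] add(3,4) ..
  next
    case (uminus u)
    have cl: "t \<one>\<^bsub>A\<^esub> l \<in> carrier E" by (rule t_closed) (use l in simp_all)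
    show ?case unfolding E.l_minus[OF uminus(1) cl] E.r_minus[OF cl uminus(1)] uminus(2) ..
  qed
  with hom show ?thesis unfolding central_hom_def single_int by blast
qed

section \<open>The residue field of the symbol algebra\<close>

text \<open>
  The residue ring \<open>\<int>[X] / (p, X\<^sup>q - \<alpha>)\<close>.  Here \<open>\<zeta> = \<alpha>\<^bsup>(p-1)/q\<^esup>\<close> is a primitive \<open>q\<close>-th root of unity
  modulo \<open>p\<close>, and the Frobenius map is \<open>F(X) \<mapsto> F(\<zeta> X)\<close>; it has order \<open>q\<close> and its only fixed
  elements are the constants.  So \<open>F\<close> to the power \<open>1 + p + \<dots> + p\<^bsup>q-1\<^esup>\<close> is a constant,
  which makes \<open>F\<close> zero or invertible.
\<close>

locale kummer_residue =
  fixes p q :: nat and \<alpha> :: int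
  assumes p: "Factorial_Ring.prime p" and q: "Factorial_Ring.prime q" and pq: "[p = 1] (mod q)"
    and nonresidue: "\<not> [\<alpha> ^ ((p - 1) div q) = 1] (mod int p)"
    and \<alpha>: "\<not> int p dvd \<alpha>"
begin

definition modulus :: "int poly" where
  "modulus = monom 1 q - [:\<alpha>:]"

text \<open>Working with congruences between integer polynomials keeps coefficients, degrees and
  composition at hand, which a quotient type would hide.\<close>

definition ker :: "int poly set" where
  "ker = {F. \<exists>U V. F = smult (int p) U + modulus * V}"

abbreviation eqv (infix "\<doteq>" 50) where "F \<doteq> G \<equiv> F - G \<in> ker"

abbreviation "\<zeta> \<equiv> \<alpha> ^ ((p - 1) div q)"

lemma ker_zero [simp]: "0 \<in> ker"
  unfolding ker_def by (intro CollectI exI[of _ 0]) simp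

lemma ker_add: "F \<in> ker \<Longrightarrow> G \<in> ker \<Longrightarrow> F + G \<in> ker"
  unfolding ker_def
proof (clarify)
  fix U V U' V'
  show "\<exists>U'' V''. smult (int p) U + modulus * V + (smult (int p) U' + modulus * V') =
    smult (int p) U'' + modulus * V''"
    by (intro exI[of _ "U + U'"] exI[of _ "V + V'"]) (simp add: smult_add_right algebra_simps)
qed

lemma ker_mult: "F \<in> ker \<Longrightarrow> F * G \<in> ker"
  unfolding ker_def
proof (clarify)
  fix U V
  show "\<exists>U' V'. (smult (int p) U + modulus * V) * G = smult (int p) U' + modulus * V'"
    by (intro exI[of _ "U * G"] exI[of _ "V * G"]) (simp add: algebra_simps)
qed

lemma ker_mult': "F \<in> ker \<Longrightarrow> G * F \<in> ker"
  using ker_mult[of F G] by (simp add: mult.commute)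

lemma ker_uminus: "F \<in> ker \<Longrightarrow> - F \<in> ker"
  using ker_mult[of F "-1"] by simp

lemma ker_smult_p: "smult (int p) U \<in> ker"
  unfolding ker_def by (intro CollectI exI[of _ U] exI[of _ 0]) simp

lemma ker_modulus: "modulus \<in> ker"
  unfolding ker_def by (intro CollectI exI[of _ 0] exI[of _ 1]) simp

lemma ker_dvd_coeff:
  assumes "\<And>i. int p dvd coeff F i" shows "F \<in> ker"
proof -
  have "[:int p:] dvd F" using assms by (simp add: const_poly_dvd_iff)
  then obtain U where "F = [:int p:] * U" by (elim dvdE)
  then show ?thesis using ker_smult_p[of U] by simp
qed

lemma eqv_trans: "F \<doteq> G \<Longrightarrow> G \<doteq> H \<Longrightarrow> F \<doteq> H"
  using ker_add[of "F - G" "G - H"] by simp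

lemma eqv_sym: "F \<doteq> G \<Longrightarrow> G \<doteq> F"
  using ker_uminus[of "F - G"] by simp

lemma eqv_add: "F \<doteq> G \<Longrightarrow> F' \<doteq> G' \<Longrightarrow> F + F' \<doteq> G + G'"
  using ker_add[of "F - G" "F' - G'"] by (simp add: algebra_simps)

lemma eqv_mult:
  assumes "F \<doteq> G" "F' \<doteq> G'" shows "F * F' \<doteq> G * G'"
proof -
  have "F * F' - G * G' = (F - G) * F' + G * (F' - G')" by (simp add: algebra_simps)
  then show ?thesis using ker_add[OF ker_mult[OF assms(1)] ker_mult'[OF assms(2)]] by simp
qed

lemma eqv_power: "F \<doteq> G \<Longrightarrow> F ^ m \<doteq> G ^ m"
  by (induction m) (auto intro: eqv_mult)

lemma eqv_sum: "(\<And>x. x \<in> A \<Longrightarrow> F x \<doteq> G x) \<Longrightarrow> sum F A \<doteq> sum G A"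
  by (induction A rule: infinite_finite_induct) (auto intro: eqv_add)

lemma eqv_ker: "F \<doteq> G \<Longrightarrow> G \<in> ker \<Longrightarrow> F \<in> ker"
  using ker_add[of "F - G" G] by simp

lemma p_eq: "p = 1 + q * ((p - 1) div q)"
proof -
  have "q dvd p - 1" using pq cong_to_1_nat by simp
  then show ?thesis using prime_gt_0_nat[OF p] by simp
qed

lemma const_eqv: "[a = b] (mod int p) \<Longrightarrow> [:a:] \<doteq> [:b:]"
  by (rule ker_dvd_coeff) (auto simp: cong_iff_dvd_diff coeff_pCons split: nat.splits)

lemma monom_eqv: "monom 1 m \<doteq> monom (\<alpha> ^ (m div q)) (m mod q)"
proof -
  have "monom 1 q \<doteq> [:\<alpha>:]" using ker_modulus by (simp add: modulus_def)
  then have "monom 1 q ^ (m div q) \<doteq> [:\<alpha>:] ^ (m div q)" by (rule eqv_power)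
  then have "monom 1 q ^ (m div q) * monom 1 (m mod q) \<doteq> [:\<alpha>:] ^ (m div q) * monom 1 (m mod q)"
    by (rule eqv_mult) simp
  then show ?thesis
    by (simp add: monom_power mult_monom poly_const_pow smult_monom)
qed

lemma fermat_int:
  assumes "\<not> int p dvd a" shows "[a ^ (p - 1) = 1] (mod int p)"
proof -
  have "Factorial_Ring.prime (int p)" using p by simp
  then have "coprime a (int p)" using assms by (metis coprime_commute prime_imp_coprime)
  then have "[a ^ totient p = 1] (mod int p)"
    using residues.euler_theorem[of "int p" a] prime_gt_1_nat[OF p] by (simp add: residues_def)
  then show ?thesis using totient_prime[OF p] by simp
qed

lemma freshman: "(F + G) ^ p \<doteq> F ^ p + G ^ p"
proof -
  have "(F + G) ^ p = (\<Sum>k\<le>p. of_nat (p choose k) * F ^ k * G ^ (p - k))"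
    by (rule binomial_ring)
  also have "\<dots> \<doteq> (\<Sum>k\<le>p. (if k = 0 then G ^ p else 0) + (if k = p then F ^ p else 0))"
  proof (rule eqv_sum)
    fix k assume "k \<in> {..p}"
    show "of_nat (p choose k) * F ^ k * G ^ (p - k) \<doteq> (if k = 0 then G ^ p else 0) + (if k = p then F ^ p else 0)"
    proof (cases "k = 0 \<or> k = p")
      case True
      then show ?thesis using prime_gt_0_nat[OF p] by auto
    next
      case False
      then have "p dvd p choose k" using \<open>k \<in> {..p}\<close> p by (intro dvd_choose_prime) auto
      then obtain c where "p choose k = p * c" by (elim dvdE)
      then have "of_nat (p choose k) * F ^ k * G ^ (p - k) = smult (int p) (of_nat c * F ^ k * G ^ (p - k))"
        by (simp add: of_nat_poly algebra_simps)
      then show ?thesis using False ker_smult_p by simp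
    qed
  qed
  finally show ?thesis by (simp add: sum.distrib algebra_simps)
qed

text \<open>Constants are fixed by Fermat, and X^p = X (X^q)^((p-1)/q) becomes \<zeta> X because X^q
  is \<alpha>. Additivity of the p-th power combines the two in the induction over
  coefficients.\<close>

lemma frobenius: "F ^ p \<doteq> F \<circ>\<^sub>p [:0, \<zeta>:]"
proof (induction F)
  case 0
  then show ?case using prime_gt_0_nat[OF p] by (simp add: zero_power)
next
  case (pCons a F)
  have "[a ^ p = a] (mod int p)"
  proof (cases "int p dvd a")
    case True
    then have "int p dvd a ^ p" using dvd_trans[OF True dvd_power] prime_gt_0_nat[OF p] by blast
    then have "int p dvd a ^ p - a" using True by (rule dvd_diff)
    then show ?thesis by (simp add: cong_iff_dvd_diff)
  next
    case False
    have "[a ^ (p - 1) * a = 1 * a] (mod int p)"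
      by (rule cong_mult[OF fermat_int]) (use False in auto)
    then show ?thesis using power_minus_mult[of p a] prime_gt_0_nat[OF p] by (simp only: mult_1)
  qed
  then have a: "[:a:] ^ p \<doteq> [:a:]" using const_eqv by (simp add: poly_const_pow)
  have "q \<noteq> 0" "1 < q" using prime_gt_1_nat[OF q] by auto
  have "p mod q = 1" using pq \<open>1 < q\<close> by (simp add: cong_def)
  moreover have "(1 + q * ((p - 1) div q)) div q = (p - 1) div q"
    using \<open>1 < q\<close> by (simp only: div_mult_self2[OF \<open>q \<noteq> 0\<close>]) simp
  then have "p div q = (p - 1) div q" using p_eq by simp
  ultimately have "[:0, 1:] ^ p \<doteq> [:0, \<zeta>:]"
    using monom_eqv[of p] by (simp add: monom_altdef)
  then have "([:0, 1:] * F) ^ p \<doteq> [:0, \<zeta>:] * (F \<circ>\<^sub>p [:0, \<zeta>:])"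
    unfolding power_mult_distrib by (rule eqv_mult[OF _ pCons(2)])
  then have "[:a:] ^ p + ([:0, 1:] * F) ^ p \<doteq> [:a:] + [:0, \<zeta>:] * (F \<circ>\<^sub>p [:0, \<zeta>:])"
    by (rule eqv_add[OF a])
  then have "([:a:] + [:0, 1:] * F) ^ p \<doteq> [:a:] + [:0, \<zeta>:] * (F \<circ>\<^sub>p [:0, \<zeta>:])"
    by (rule eqv_trans[OF freshman])
  then show ?case by (simp add: pcompose_pCons)
qed

lemma coeff_scale: "coeff (F \<circ>\<^sub>p [:0, c:]) i = c ^ i * coeff F i" for c :: int
proof (induction F arbitrary: i)
  case (pCons a F)
  then show ?case by (cases i) (simp_all add: pcompose_pCons)
qed simp

lemma frobenius_iterate: "F ^ (p ^ m) \<doteq> F \<circ>\<^sub>p [:0, \<zeta> ^ m:]"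
proof (induction m)
  case 0
  then show ?case by (simp add: pcompose_idR)
next
  case (Suc m)
  have "F ^ (p ^ Suc m) = (F ^ (p ^ m)) ^ p" by (simp flip: power_mult add: mult.commute)
  also have "\<dots> \<doteq> (F \<circ>\<^sub>p [:0, \<zeta> ^ m:]) ^ p" by (rule eqv_power[OF Suc])
  finally have "F ^ (p ^ Suc m) \<doteq> (F \<circ>\<^sub>p [:0, \<zeta> ^ m:]) \<circ>\<^sub>p [:0, \<zeta>:]"
    using eqv_trans[OF _ frobenius] by blast
  moreover have "(F \<circ>\<^sub>p [:0, \<zeta> ^ m:]) \<circ>\<^sub>p [:0, \<zeta>:] = F \<circ>\<^sub>p [:0, \<zeta> ^ Suc m:]"
    by (rule poly_eqI) (simp add: coeff_scale power_mult_distrib)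
  ultimately show ?case by simp
qed

lemma zeta_pow_q: "[\<zeta> ^ q = 1] (mod int p)"
proof -
  have "\<zeta> ^ q = \<alpha> ^ (p - 1)" using p_eq by (metis add_diff_cancel_left' mult.commute power_mult)
  then show ?thesis
    using fermat_int[OF \<alpha>] by simp
qed

text \<open>As \<open>q\<close> is prime, \<open>i\<close> has an inverse \<open>u\<close> modulo
  \<open>q\<close>; raising \<zeta>^i = 1 to the power \<open>u\<close> would give \<zeta> = 1,
  against \<open>nonresidue\<close>.\<close>

lemma zeta_pow:
  assumes i: "0 < i" "i < q" shows "\<not> [\<zeta> ^ i = 1] (mod int p)"
proof
  assume *: "[\<zeta> ^ i = 1] (mod int p)"
  have "coprime i q" using i q by (metis coprime_commute dvd_imp_le leD prime_imp_coprime)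
  then obtain u where u: "[i * u = 1] (mod q)" using cong_solve_coprime_nat by auto
  have mod: "[\<zeta> ^ m = \<zeta> ^ (m mod q)] (mod int p)" for m
  proof -
    have "\<zeta> ^ m = \<zeta> ^ (q * (m div q) + m mod q)" by simp
    then have "\<zeta> ^ m = (\<zeta> ^ q) ^ (m div q) * \<zeta> ^ (m mod q)" by (simp only: power_add power_mult)
    moreover have "[(\<zeta> ^ q) ^ (m div q) * \<zeta> ^ (m mod q) = 1 ^ (m div q) * \<zeta> ^ (m mod q)] (mod int p)"
      by (intro cong_mult cong_pow zeta_pow_q) simp
    ultimately show ?thesis by simp
  qed
  have "[1 ^ u = (\<zeta> ^ i) ^ u] (mod int p)" using * by (intro cong_pow) (rule cong_sym)
  also have "(\<zeta> ^ i) ^ u = \<zeta> ^ (i * u)" by (simp add: power_mult)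
  also have "[\<zeta> ^ (i * u) = \<zeta> ^ ((i * u) mod q)] (mod int p)" by (rule mod)
  also have "(i * u) mod q = 1" using u prime_gt_1_nat[OF q] by (simp add: cong_def)
  finally have "[\<zeta> = 1] (mod int p)" by (simp add: cong_sym)
  then show False using nonresidue by simp
qed

lemma frobenius_order: "F ^ (p ^ q) \<doteq> F"
proof (rule eqv_trans[OF frobenius_iterate])
  have "[(\<zeta> ^ q) ^ i = 1] (mod int p)" for i
    using cong_pow[OF zeta_pow_q, of i] by simp
  then have "int p dvd (\<zeta> ^ q) ^ i * c - c" for i c
    by (metis cong_iff_dvd_diff dvd_mult2 left_diff_distrib' mult_1)
  then show "F \<circ>\<^sub>p [:0, \<zeta> ^ q:] \<doteq> F"
    by (intro ker_dvd_coeff) (simp add: coeff_scale)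
qed

text \<open>The modulus is monic, so representatives of degree below \<open>q\<close> are unique
  modulo p. In F = p U + modulus V, the vanishing coefficient of F in degree q + deg V makes the
  leading coefficient of V divisible by p; that term moves into the part p U, and V loses
  degree.\<close>

lemma ker_small_degree:
  assumes "F \<in> ker" "degree F < q" shows "int p dvd coeff F i"
proof -
  have coeff_modulus: "coeff (modulus * V) (q + m) = coeff V m - \<alpha> * coeff V (q + m)" for V m
    by (simp add: modulus_def left_diff_distrib coeff_monom_mult)
  have "\<exists>U. F = smult (int p) U" if "F = smult (int p) U + modulus * V" "degree F < q" for U V
    using that
  proof (induction "degree V" arbitrary: U V rule: less_induct)
    case less
    show ?case
    proof (cases "V = 0")
      case True
      then show ?thesis using less.prems by auto
    next
      case False
      let ?d = "degree V"
      have "coeff F (q + ?d) = 0" using less.prems(2) by (simp add: coeff_eq_0)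
      moreover have "coeff V (q + ?d) = 0" using prime_gt_0_nat[OF q] by (simp add: coeff_eq_0)
      ultimately have "0 = int p * coeff U (q + ?d) + coeff V ?d"
        using coeff_modulus[of V ?d] less.prems(1) by simp
      then have c: "coeff V ?d = int p * - coeff U (q + ?d)" (is "_ = _ * ?c") by simp
      let ?V = "V - monom (int p * ?c) ?d" and ?U = "U + modulus * monom ?c ?d"
      have F: "F = smult (int p) ?U + modulus * ?V"
        using less.prems(1) by (simp add: smult_add_right right_diff_distrib smult_monom flip: mult_smult_right)
      have V: "coeff ?V m = 0" if "m \<ge> ?d" for m
        using that c by (cases "m = ?d") (auto simp: coeff_eq_0)
      show ?thesis
      proof (cases "?V = 0")
        case True
        then show ?thesis using F by auto
      next
        case nz: False
        then have "degree ?V < ?d" using V by (metis leading_coeff_0_iff not_le)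
        then show ?thesis by (rule less.hyps[OF _ F less.prems(2)])
      qed
    qed
  qed
  then obtain U where "F = smult (int p) U" using assms by (auto simp: ker_def)
  then show ?thesis by simp
qed

lemma ex_reduced: "\<exists>G. F \<doteq> G \<and> degree G < q"
proof (induction F)
  case 0
  then show ?case using prime_gt_0_nat[OF q] by (intro exI[of _ 0]) simp
next
  case (pCons a F)
  then obtain G where G: "F \<doteq> G" "degree G < q" by blast
  \<comment> \<open>Multiplying \<open>G\<close> by X raises the degree to at most \<open>q\<close>,
    and \<open>coeff G (q - 1)\<close> becomes the coefficient of X^q; the monic modulus removes
    it.\<close>
  define H where "H = pCons a G - smult (coeff G (q - 1)) modulus"
  have "pCons a F \<doteq> H"
  proof -
    have "pCons a F - H = [:0, 1:] * (F - G) + [:coeff G (q - 1):] * modulus"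
      by (simp add: H_def)
    then show ?thesis by (simp only: ker_add[OF ker_mult'[OF G(1)] ker_mult'[OF ker_modulus]])
  qed
  moreover have "coeff H m = 0" if "m \<ge> q" for m
  proof (cases m)
    case 0
    then show ?thesis using that prime_gt_0_nat[OF q] by simp
  next
    case (Suc k)
    show ?thesis
    proof (cases "q = Suc k")
      case True
      then show ?thesis unfolding H_def modulus_def Suc by (simp add: coeff_pCons)
    next
      case False
      then show ?thesis using that G(2) Suc by (simp add: H_def modulus_def coeff_eq_0 coeff_pCons)
    qed
  qed
  then have "degree H < q" using prime_gt_0_nat[OF q] by (metis degree_0 leading_coeff_0_iff not_le)
  ultimately show ?case by blast
qed

text \<open>The coefficients g_i of the reduced representative satisfy (\<zeta>^i - 1) g_i = 0
  modulo p, and \<zeta>^i \<noteq> 1 for 0 < i < q, so only the constant term survives. Reduction to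
  degree below \<open>q\<close> is what allows coefficients to be compared.\<close>

lemma norm_constant:
  assumes "N ^ p \<doteq> N" shows "\<exists>c. N \<doteq> [:c:]"
proof -
  obtain G where G: "N \<doteq> G" "degree G < q" using ex_reduced by blast
  have "G \<circ>\<^sub>p [:0, \<zeta>:] \<doteq> G"
    using eqv_trans[OF eqv_sym[OF frobenius] eqv_trans[OF eqv_power[OF eqv_sym[OF G(1)]] eqv_trans[OF assms G(1)]]] .
  moreover have "degree (G \<circ>\<^sub>p [:0, \<zeta>:] - G) < q"
    using G(2) by (intro degree_diff_less) (auto simp: degree_pcompose)
  ultimately have dvd: "int p dvd (\<zeta> ^ i - 1) * coeff G i" for i
    using ker_small_degree[of "G \<circ>\<^sub>p [:0, \<zeta>:] - G" i] by (simp add: coeff_scale left_diff_distrib)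
  have "int p dvd coeff G i" if "0 < i" for i
  proof (cases "i < q")
    case True
    then have "\<not> int p dvd \<zeta> ^ i - 1" using zeta_pow[OF that] by (simp add: cong_iff_dvd_diff)
    then show ?thesis using dvd[of i] p by (simp add: prime_dvd_mult_iff)
  next
    case False
    then show ?thesis using G(2) by (simp add: coeff_eq_0)
  qed
  then have "G \<doteq> [:coeff G 0:]"
    by (intro ker_dvd_coeff) (auto simp: coeff_pCons split: nat.splits)
  then show ?thesis using eqv_trans[OF G(1)] by blast
qed

theorem ker_prime:
  assumes FG: "F * G \<in> ker" shows "F \<in> ker \<or> G \<in> ker"
proof -
  define s where "s = (\<Sum>i<q. p ^ i)"
  \<comment> \<open>This is s (p - 1) = p^q - 1, stated without subtraction.\<close>
  have s_eq: "s * p + 1 = s + p ^ q"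
    unfolding s_def by (induction q) (auto simp: algebra_simps)
  have s_pos: "s \<ge> 1"
  proof -
    have "s \<ge> p ^ 0" unfolding s_def by (rule member_le_sum) (use prime_gt_0_nat[OF q] in auto)
    then show ?thesis by simp
  qed
  have s_le: "s \<le> p ^ q"
    using s_eq s_pos prime_ge_2_nat[OF p] mult_le_mono2[of 2 p s] by linarith
  have "s * p = (s - 1) + p ^ q" using s_eq s_pos by linarith
  then have "(F ^ s) ^ p = F ^ (s - 1) * F ^ (p ^ q)" by (simp flip: power_mult power_add)
  also have "\<dots> \<doteq> F ^ (s - 1) * F" by (rule eqv_mult[OF _ frobenius_order]) simp
  also have "F ^ (s - 1) * F = F ^ s" using power_minus_mult[of s F] s_pos by simp
  finally obtain c where c: "F ^ s \<doteq> [:c:]" using norm_constant by blast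
  \<comment> \<open>If the constant is zero, then F^s = 0, and F = F^(p^q) vanishes because s \<le>
    p^q. Otherwise F^(s-1) is an inverse of F up to a scalar, and F G = 0 gives G = 0.\<close>
  show ?thesis
  proof (cases "int p dvd c")
    case True
    then have "[:c:] \<in> ker" by (intro ker_dvd_coeff) (auto simp: coeff_pCons split: nat.splits)
    then have "F ^ s \<in> ker" using eqv_ker[OF c] by simp
    moreover have "F ^ (p ^ q) = F ^ s * F ^ (p ^ q - s)" using s_le by (simp flip: power_add)
    ultimately have "F ^ (p ^ q) \<in> ker" using ker_mult by simp
    then show ?thesis using eqv_ker[OF eqv_sym[OF frobenius_order]] by blast
  next
    case False
    then have "coprime c (int p)" using p by (metis coprime_commute prime_imp_coprime prime_int_nat_transfer nat_int prime_nat_int_transfer)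
    then obtain d where d: "[c * d = 1] (mod int p)" using cong_solve_coprime_int by blast
    have "F ^ s = F ^ (s - 1) * F" using power_minus_mult[of s F] s_pos by simp
    then have FsG: "F ^ s * G = (F * G) * F ^ (s - 1)" by (simp only: mult_ac)
    have "F ^ s * G \<in> ker" unfolding FsG by (rule ker_mult[OF FG])
    moreover have "[:c:] * G \<doteq> F ^ s * G" by (rule eqv_mult[OF eqv_sym[OF c]]) simp
    ultimately have cG: "[:c:] * G \<in> ker" by (rule eqv_ker[rotated])
    have "[:d:] * ([:c:] * G) \<in> ker" by (rule ker_mult'[OF cG])
    then have "[:c * d:] * G \<in> ker" by (simp add: mult.commute)
    moreover have "1 * G \<doteq> [:c * d:] * G"
      using eqv_mult[OF eqv_sym[OF const_eqv[OF d]], of G G] by (simp add: one_pCons)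
    ultimately show ?thesis using eqv_ker by fastforce
  qed
qed

text \<open>\<open>ker_prime\<close> in coordinates: cyclic convolution with a factor \<alpha> for
  each carry is multiplication of polynomials reduced by X^q = \<alpha>. Leading terms appear in
  this form.\<close>

corollary no_zero_divisors:
  assumes "\<And>k. k < q \<Longrightarrow> int p dvd (\<Sum>(i, j)\<in>{(i, j). i < q \<and> j < q \<and> (i + j) mod q = k}.
      \<alpha> ^ ((i + j) div q) * (f i * g j))"
  shows "(\<forall>i<q. int p dvd f i) \<or> (\<forall>i<q. int p dvd g i)"
proof -
  define P where "P h = (\<Sum>i<q. monom (h i :: int) i)" for h
  have coeff_P: "coeff (P h) i = h i" if "i < q" for h i
    using that by (simp add: P_def coeff_sum coeff_monom)
  have degree_P: "degree (P h) < q" for h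
    unfolding P_def using prime_gt_0_nat[OF q]
    by (intro degree_sum_less) (auto simp: degree_monom_eq intro: le_less_trans[OF degree_monom_le])
  let ?S = "{..<q} \<times> {..<q}"
  let ?R = "\<Sum>(i, j)\<in>?S. monom (\<alpha> ^ ((i + j) div q) * (f i * g j)) ((i + j) mod q)"
  have "P f * P g = (\<Sum>(i, j)\<in>?S. monom (f i * g j) (i + j))"
    by (simp add: P_def sum_product sum.cartesian_product mult_monom)
  also have "\<dots> \<doteq> ?R"
  proof (rule eqv_sum, clarify)
    fix i j
    have "[:f i * g j:] * monom 1 (i + j) \<doteq> [:f i * g j:] * monom (\<alpha> ^ ((i + j) div q)) ((i + j) mod q)"
      by (rule eqv_mult[OF _ monom_eqv]) simp
    then show "monom (f i * g j) (i + j) \<doteq> monom (\<alpha> ^ ((i + j) div q) * (f i * g j)) ((i + j) mod q)"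
      by (simp add: smult_monom mult_ac)
  qed
  finally have "P f * P g \<doteq> ?R" .
  moreover have "?R \<in> ker"
  proof (rule ker_dvd_coeff)
    fix k
    have "coeff ?R k = (\<Sum>(i, j)\<in>?S. if (i + j) mod q = k then \<alpha> ^ ((i + j) div q) * (f i * g j) else 0)"
      by (simp add: coeff_sum coeff_monom case_prod_unfold)
    also have "\<dots> = (\<Sum>(i, j)\<in>{(i, j). i < q \<and> j < q \<and> (i + j) mod q = k}. \<alpha> ^ ((i + j) div q) * (f i * g j))"
      by (rule sum.mono_neutral_cong_right) auto
    finally have eq: "coeff ?R k = \<dots>" .
    show "int p dvd coeff ?R k"
    proof (cases "k < q")
      case True
      then show ?thesis unfolding eq by (rule assms)
    next
      case False
      then have "{(i, j). i < q \<and> j < q \<and> (i + j) mod q = k} = {}"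
        using mod_less_divisor[OF prime_gt_0_nat[OF q]] by blast
      then show ?thesis unfolding eq by (simp only: sum.empty dvd_0_right)
    qed
  qed
  ultimately have "P f * P g \<in> ker" by (rule eqv_ker)
  then have "P f \<in> ker \<or> P g \<in> ker" by (rule ker_prime)
  then show ?thesis
    using ker_small_degree[OF _ degree_P] coeff_P by metis
qed

end

section \<open>The p-adic absolute value\<close>

locale padic =
  fixes p :: nat
  assumes p: "Factorial_Ring.prime p"
begin

abbreviation "N \<equiv> padic_abs p"

lemma p_gt_1: "1 < p"
  using prime_gt_1_nat[OF p] .

lemma prime_int_p: "Factorial_Ring.prime (int p)"
  using p by simp

lemma ex_fraction: "x \<noteq> (0 :: rat) \<Longrightarrow> \<exists>a d :: int. a \<noteq> 0 \<and> d \<noteq> 0 \<and> x = of_int a / of_int d"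
proof -
  assume x: "x \<noteq> (0 :: rat)"
  obtain a d where "quotient_of x = (a, d)" by (cases "quotient_of x")
  then have "x = of_int a / of_int d" "d > 0" by (simp_all add: quotient_of_div quotient_of_denom_pos)
  then show ?thesis using x by (intro exI[of _ a] exI[of _ d]) auto
qed

text \<open>\<open>padic_val\<close> refers to the reduced fraction, which is awkward for products
  and sums. Cross-multiplication a e = b d shows that the difference of multiplicities is the same
  for every fraction representing the number.\<close>

lemma abs_fraction:
  assumes "a \<noteq> 0" "d \<noteq> 0"
  shows "N (of_int a / of_int d) =
    real p powi (int (multiplicity (int p) d) - int (multiplicity (int p) a))"
proof -
  let ?x = "of_int a / of_int d :: rat"
  obtain b e where be: "quotient_of ?x = (b, e)" by (cases "quotient_of ?x")
  then have x: "?x = of_int b / of_int e" and e: "e > 0"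
    by (rule quotient_of_div, rule quotient_of_denom_pos)
  from x have "of_int (a * e) = (of_int (b * d) :: rat)" using assms(2) e by (simp add: field_simps)
  then have eq: "a * e = b * d" by (simp only: of_int_eq_iff)
  moreover have b: "b \<noteq> 0" using eq assms e by auto
  ultimately have "multiplicity (int p) a + multiplicity (int p) e = multiplicity (int p) b + multiplicity (int p) d"
    using assms e prime_elem_multiplicity_mult_distrib[of "int p" a e]
      prime_elem_multiplicity_mult_distrib[of "int p" b d] prime_int_p by auto
  then have "- padic_val p ?x = int (multiplicity (int p) d) - int (multiplicity (int p) a)"
    by (simp add: padic_val_def be)
  moreover have "?x \<noteq> 0" using assms by simp
  ultimately show ?thesis by (simp add: padic_abs_def)
qed

lemma abs_0 [simp]: "N 0 = 0"
  by (simp add: padic_abs_def)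

lemma abs_pos: "x \<noteq> 0 \<Longrightarrow> 0 < N x"
  using p_gt_1 by (simp add: padic_abs_def)

lemma abs_nonneg [simp]: "0 \<le> N x"
  using abs_pos[of x] by (cases "x = 0") auto

lemma abs_eq_0_iff [simp]: "N x = 0 \<longleftrightarrow> x = 0"
  using abs_pos[of x] by (cases "x = 0") simp_all

lemma abs_1 [simp]: "N 1 = 1"
  using abs_fraction[of 1 1] by simp

lemma abs_mult: "N (x * y) = N x * N y"
proof (cases "x = 0 \<or> y = 0")
  case False
  then obtain a d b e where x: "a \<noteq> 0" "d \<noteq> 0" "x = of_int a / of_int d"
    and y: "b \<noteq> 0" "e \<noteq> 0" "y = of_int b / of_int e" using ex_fraction by metis
  have xy: "x * y = of_int (a * b) / of_int (d * e)" by (simp add: x(3) y(3))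
  show ?thesis
    unfolding xy unfolding x(3) y(3)
    using x y p_gt_1 prime_elem_multiplicity_mult_distrib[of "int p" a b]
      prime_elem_multiplicity_mult_distrib[of "int p" d e] prime_int_p
    by (simp add: abs_fraction power_int_add[symmetric] algebra_simps del: of_int_mult)
qed auto

lemma abs_power: "N (x ^ k) = N x ^ k"
  by (induction k) (simp_all add: abs_mult)

lemma abs_inverse: "N (inverse x) = inverse (N x)"
proof (cases "x = 0")
  case False
  then have "N x * N (inverse x) = 1" by (simp flip: abs_mult)
  then show ?thesis by (metis inverse_unique)
qed simp

lemma abs_divide: "N (x / y) = N x / N y"
  by (simp add: divide_inverse abs_mult abs_inverse)

lemma abs_int_eq: "m \<noteq> 0 \<Longrightarrow> N (of_int m) = real p powi - int (multiplicity (int p) m)"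
  using abs_fraction[of m 1] by simp

lemma abs_int_le_1: "N (of_int m) \<le> 1"
proof (cases "m = 0")
  case False
  have "real p powi - int (multiplicity (int p) m) \<le> real p powi 0"
    using p_gt_1 by (intro power_int_increasing) auto
  then show ?thesis using False by (simp add: abs_int_eq)
qed simp

lemma abs_int_dvd:
  assumes "int p dvd m" shows "N (of_int m) \<le> 1 / p"
proof -
  obtain k where "m = int p * k" using assms by (elim dvdE)
  then have "N (of_int m) = N (of_nat p) * N (of_int k)" by (simp add: abs_mult)
  also have "N (of_nat p) = 1 / p"
    using abs_int_eq[of "int p"] p_gt_1 prime_int_p by (simp add: power_int_minus divide_inverse)
  finally show ?thesis using abs_int_le_1[of k] by (simp add: divide_right_mono)
qed

lemma abs_p: "N (of_nat p) = 1 / p"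
  using abs_int_eq[of "int p"] p_gt_1 prime_int_p by (simp add: power_int_minus divide_inverse)

lemma abs_int_unit: "\<not> int p dvd m \<Longrightarrow> N (of_int m) = 1"
  by (subst abs_int_eq) (auto simp: not_dvd_imp_multiplicity_0)

lemma abs_int_less_1_iff: "N (of_int m) < 1 \<longleftrightarrow> int p dvd m"
proof
  show "int p dvd m" if "N (of_int m) < 1" using abs_int_unit[of m] that by auto
  show "N (of_int m) < 1" if "int p dvd m"
    using abs_int_dvd[OF that] p_gt_1 by (auto elim: le_less_trans)
qed

lemma abs_minus [simp]: "N (- x) = N x"
  using abs_mult[of "-1" x] abs_int_unit[of "-1"] p_gt_1 by auto

lemma abs_minus_commute: "N (x - y) = N (y - x)"
  using abs_minus[of "x - y"] by simp

text \<open>Nonzero absolute values are integral powers of p, so nothing lies strictly between 1/p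
  and 1. This turns strict inequalities into a definite gap.\<close>

lemma abs_less_1: "N x < 1 \<Longrightarrow> N x \<le> 1 / p"
proof (cases "x = 0")
  case False
  then obtain k where k: "N x = real p powi k" by (simp add: padic_abs_def)
  assume "N x < 1"
  have "k \<le> -1"
  proof (rule ccontr)
    assume "\<not> k \<le> -1"
    then have "real p powi 0 \<le> real p powi k" using p_gt_1 by (intro power_int_increasing) auto
    then show False using \<open>N x < 1\<close> k by simp
  qed
  then have "real p powi k \<le> real p powi -1" using p_gt_1 by (intro power_int_increasing) auto
  then show ?thesis using k by (simp add: power_int_minus divide_inverse)
qed simp

text \<open>Over a common denominator, a power of p dividing both numerators divides their
  sum.\<close>

lemma abs_add_le: "N (x + y) \<le> max (N x) (N y)"
proof (cases "x = 0 \<or> y = 0 \<or> x + y = 0")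
  case False
  then obtain a d b e where x: "a \<noteq> 0" "d \<noteq> 0" "x = of_int a / of_int d"
    and y: "b \<noteq> 0" "e \<noteq> 0" "y = of_int b / of_int e" using ex_fraction by metis
  let ?a = "a * e" and ?b = "b * d" and ?d = "d * e"
  let ?m = "multiplicity (int p)"
  have nz: "?a \<noteq> 0" "?b \<noteq> 0" "?d \<noteq> 0" using x y by auto
  have xy: "x = of_int ?a / of_int ?d" "y = of_int ?b / of_int ?d" using x y by (simp_all add: field_simps)
  have sum: "x + y = of_int (?a + ?b) / of_int ?d"
    by (subst xy(1), subst xy(2)) (simp add: add_divide_distrib)
  have nz': "?a + ?b \<noteq> 0"
  proof
    assume "?a + ?b = 0"
    then have "x + y = 0" unfolding sum by (simp only: of_int_0 div_0)
    then show False using False by simp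
  qed
  have "(int p) ^ min (?m ?a) (?m ?b) dvd ?a + ?b"
    by (rule dvd_add) (simp_all add: multiplicity_dvd')
  then have "min (?m ?a) (?m ?b) \<le> ?m (?a + ?b)"
    using nz' prime_int_p by (intro multiplicity_geI) (auto simp: prime_elem_def)
  then have "int (?m ?d) - int (?m (?a + ?b)) \<le> max (int (?m ?d) - int (?m ?a)) (int (?m ?d) - int (?m ?b))"
    by (simp add: min_def max_def split: if_splits)
  then have "real p powi (int (?m ?d) - int (?m (?a + ?b)))
      \<le> real p powi max (int (?m ?d) - int (?m ?a)) (int (?m ?d) - int (?m ?b))"
    using p_gt_1 by (intro power_int_increasing) auto
  also have "\<dots> \<le> max (real p powi (int (?m ?d) - int (?m ?a))) (real p powi (int (?m ?d) - int (?m ?b)))"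
    by (simp add: max_def)
  finally show ?thesis unfolding sum unfolding xy abs_fraction[OF nz(1,3)] abs_fraction[OF nz(2,3)] abs_fraction[OF nz' nz(3)] .
qed (auto simp: le_max_iff_disj)

lemma abs_diff_le: "N (x - y) \<le> max (N x) (N y)"
  using abs_add_le[of x "- y"] by simp

lemma abs_add_bound: "N x \<le> c \<Longrightarrow> N y \<le> c \<Longrightarrow> N (x + y) \<le> c"
  using abs_add_le[of x y] by simp

lemma abs_diff_bound: "N x \<le> c \<Longrightarrow> N y \<le> c \<Longrightarrow> N (x - y) \<le> c"
  using abs_diff_le[of x y] by simp

lemma abs_sum_bound: "0 \<le> c \<Longrightarrow> (\<And>i. i \<in> I \<Longrightarrow> N (f i) \<le> c) \<Longrightarrow> N (sum f I) \<le> c"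
  by (induction I rule: infinite_finite_induct) (auto intro: abs_add_bound)

text \<open>In an ultrametric, a strictly largest term determines the size of a sum; the comparison
  with leading terms rests on this.\<close>

lemma abs_eq_of_close: "N (x - y) < N x \<Longrightarrow> N y = N x"
  using abs_diff_le[of x "x - y"] abs_add_le[of y "x - y"] by auto

lemma abs_mult_diff_bound:
  assumes "N x \<le> 1" "N y' \<le> 1" "N (x - x') \<le> c" "N (y - y') \<le> c"
  shows "N (x * y - x' * y') \<le> c"
proof -
  have eq: "x * y - x' * y' = x * (y - y') + (x - x') * y'" by (simp add: algebra_simps)
  have c: "0 \<le> c" using assms(3) abs_nonneg order_trans by blast
  have "N (x * (y - y')) \<le> 1 * c" "N ((x - x') * y') \<le> c * 1"
    unfolding abs_mult using assms c by (intro mult_mono; simp)+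
  then show ?thesis unfolding eq by (intro abs_add_bound) simp_all
qed

text \<open>The reduced denominator of \<open>x\<close> is prime to p, so it has an inverse
  \<open>e\<close> modulo p, and the numerator times \<open>e\<close> approximates \<open>x\<close>.
  This plays the part of reduction to the residue field.\<close>

lemma ex_int_approx:
  assumes "N x \<le> 1" shows "\<exists>m :: int. N (x - of_int m) \<le> 1 / p"
proof (cases "x = 0")
  case True
  then show ?thesis by (intro exI[of _ 0]) simp
next
  case False
  obtain a d where "quotient_of x = (a, d)" by (cases "quotient_of x")
  then have x: "x = of_int a / of_int d" "d > 0" "coprime a d"
    by (simp_all add: quotient_of_div quotient_of_denom_pos quotient_of_coprime)
  have d: "\<not> int p dvd d"
  proof
    assume dvd: "int p dvd d"
    then have "\<not> int p dvd a"
      using x(3) prime_int_p by (metis coprime_common_divisor not_prime_unit)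
    then have "N (of_int a) = 1" "N (of_int d) < 1" "0 < N (of_int d)"
      using abs_int_unit abs_int_less_1_iff dvd abs_pos[of "of_int d"] x(2) by auto
    then have "1 < N x" by (simp add: x(1) abs_divide)
    then show False using assms by simp
  qed
  then have "coprime d (int p)" using prime_int_p by (metis coprime_commute prime_imp_coprime)
  then obtain e where e: "[d * e = 1] (mod int p)" using cong_solve_coprime_int by blast
  have "x - of_int (a * e) = of_int (a * (1 - d * e)) / of_int d"
    using x by (simp add: field_simps)
  moreover have "int p dvd a * (1 - d * e)" using e by (simp add: cong_iff_dvd_diff dvd_diff_commute)
  ultimately have "N (x - of_int (a * e)) \<le> 1 / p"
    using abs_int_unit[OF d] abs_int_dvd[of "a * (1 - d * e)"] by (simp add: abs_divide)
  then show ?thesis by blast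
qed

end

section \<open>Leading terms\<close>

locale padic_symbol = kummer_residue p q \<alpha> + padic p for p q :: nat and \<alpha> :: int
begin

abbreviation "square \<equiv> {..<q} \<times> {..<q}"

text \<open>The coordinates of a product in the symbol algebra with parameters \<open>w\<close>, \<open>\<alpha>\<close>, \<open>p\<close>.\<close>

definition prod_coeff :: "rat \<Rightarrow> (nat \<times> nat \<Rightarrow> rat) \<Rightarrow> (nat \<times> nat \<Rightarrow> rat) \<Rightarrow> nat \<times> nat \<Rightarrow> rat" where
  "prod_coeff w s t z = (\<Sum>((i, j), (k, l))\<in>{((i, j), (k, l)). (i, j) \<in> square \<and> (k, l) \<in> square \<and>
      ((i + k) mod q, (j + l) mod q) = z}.
    w ^ (j * k) * (of_int \<alpha> ^ ((i + k) div q) * of_nat p ^ ((j + l) div q)) * (s (i, j) * t (k, l)))"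

lemma q_pos: "0 < q"
  using prime_gt_0_nat[OF q] .

text \<open>Replace all entries by integers modulo p. If every coordinate of the convolution had
  absolute value below 1, the integral convolution would vanish modulo p, and
  \<open>no_zero_divisors\<close> would leave no unit among the \<open>s i\<close> or none among the
  \<open>t i\<close>.\<close>

lemma leading_part:
  fixes s t :: "nat \<Rightarrow> rat"
  assumes s: "\<And>i. i < q \<Longrightarrow> N (s i) \<le> 1" and t: "\<And>i. i < q \<Longrightarrow> N (t i) \<le> 1"
    and s1: "\<exists>i<q. N (s i) = 1" and t1: "\<exists>i<q. N (t i) = 1"
  shows "\<exists>k<q. N (\<Sum>(i, j)\<in>{(i, j). i < q \<and> j < q \<and> (i + j) mod q = k}.
    of_int \<alpha> ^ ((i + j) div q) * (s i * t j)) = 1"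
proof (rule ccontr)
  assume none: "\<not> ?thesis"
  have "\<exists>f :: nat \<Rightarrow> int. \<forall>i<q. N (s i - of_int (f i)) \<le> 1 / p"
    using ex_int_approx[OF s] by metis
  then obtain f :: "nat \<Rightarrow> int" where f: "\<And>i. i < q \<Longrightarrow> N (s i - of_int (f i)) \<le> 1 / p" by blast
  have "\<exists>g :: nat \<Rightarrow> int. \<forall>i<q. N (t i - of_int (g i)) \<le> 1 / p"
    using ex_int_approx[OF t] by metis
  then obtain g :: "nat \<Rightarrow> int" where g: "\<And>i. i < q \<Longrightarrow> N (t i - of_int (g i)) \<le> 1 / p" by blast
  have p1: "1 / real p < 1" using p_gt_1 by simp
  let ?I = "\<lambda>k. {(i, j). i < q \<and> j < q \<and> (i + j) mod q = k}"
  have "int p dvd (\<Sum>(i, j)\<in>?I k. \<alpha> ^ ((i + j) div q) * (f i * g j))" if k: "k < q" for k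
  proof -
    let ?M = "\<Sum>(i, j)\<in>?I k. of_int \<alpha> ^ ((i + j) div q) * (s i * t j) :: rat"
    let ?M' = "\<Sum>(i, j)\<in>?I k. of_int \<alpha> ^ ((i + j) div q) * (of_int (f i) * of_int (g j)) :: rat"
    have int: "N (of_int \<alpha> ^ m) \<le> 1" for m using abs_int_le_1[of "\<alpha> ^ m"] by simp
    have "N ?M \<le> 1"
    proof (rule abs_sum_bound, simp, clarify)
      fix i j assume "i < q" "j < q"
      then have "N (s i) * N (t j) \<le> 1" using s t by (intro mult_le_one) auto
      then have "N (of_int \<alpha> ^ ((i + j) div q)) * (N (s i) * N (t j)) \<le> 1"
        by (intro mult_le_one[OF int]) simp_all
      then show "N (of_int \<alpha> ^ ((i + j) div q) * (s i * t j)) \<le> 1"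
        by (simp only: abs_mult)
    qed
    then have "N ?M < 1" using none k by (auto simp: order_le_less)
    then have M: "N ?M \<le> 1 / p" by (rule abs_less_1)
    have "?M - ?M' = (\<Sum>(i, j)\<in>?I k. of_int \<alpha> ^ ((i + j) div q) * (s i * t j - of_int (f i) * of_int (g j)))"
      by (simp add: case_prod_unfold right_diff_distrib sum_subtractf)
    also have "N \<dots> \<le> 1 / p"
    proof (rule abs_sum_bound, simp, clarify)
      fix i j assume ij: "i < q" "j < q"
      have "N (s i * t j - of_int (f i) * of_int (g j)) \<le> 1 / p"
        using ij s f g abs_int_le_1 by (intro abs_mult_diff_bound) auto
      then have "N (of_int \<alpha> ^ ((i + j) div q)) * N (s i * t j - of_int (f i) * of_int (g j)) \<le> 1 * (1 / p)"
        using int by (intro mult_mono) auto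
      then show "N (of_int \<alpha> ^ ((i + j) div q) * (s i * t j - of_int (f i) * of_int (g j))) \<le> 1 / p"
        by (simp add: abs_mult)
    qed
    finally have diff: "N (?M - ?M') \<le> 1 / p" .
    have "N (?M - (?M - ?M')) \<le> 1 / p" by (rule abs_diff_bound[OF M diff])
    then have less: "N ?M' < 1" using p1 by simp
    have eq: "?M' = of_int (\<Sum>(i, j)\<in>?I k. \<alpha> ^ ((i + j) div q) * (f i * g j))"
      by (simp add: case_prod_unfold)
    show ?thesis using less unfolding eq abs_int_less_1_iff .
  qed
  then have "(\<forall>i<q. int p dvd f i) \<or> (\<forall>i<q. int p dvd g i)" by (rule no_zero_divisors)
  moreover have small: "N x < 1" if "int p dvd m" "N (x - of_int m) \<le> 1 / p" for x m
    using abs_add_bound[OF that(2) abs_int_dvd[OF that(1)]] p1 by simp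
  moreover have False if "\<forall>i<q. int p dvd f i"
  proof -
    obtain i where "i < q" "N (s i) = 1" using s1 by blast
    then show False using small[of "f i" "s i"] f[of i] that by simp
  qed
  moreover have False if "\<forall>i<q. int p dvd g i"
  proof -
    obtain i where "i < q" "N (t i) = 1" using t1 by blast
    then show False using small[of "g i" "t i"] g[of i] that by simp
  qed
  ultimately show False by blast
qed

text \<open>
  On the order \<open>\<Lambda>\<close> of integral coordinate arrays the powers of \<open>y\<close> define a filtration
  \<open>\<Lambda> \<supset> y \<Lambda> \<supset> y\<^sup>2 \<Lambda> \<supset> \<dots>\<close> with \<open>y\<^sup>q = p\<close>.  The lowest rows \<open>j\<^sub>0\<close> and \<open>l\<^sub>0\<close> that contain a unit
  determine the leading term of a product, in filtration degree \<open>j\<^sub>0 + l\<^sub>0\<close>.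
\<close>

lemma prod_coeff_normalized:
  assumes w: "N w = 1"
    and s: "\<And>x. x \<in> square \<Longrightarrow> N (s x) \<le> 1" and t: "\<And>x. x \<in> square \<Longrightarrow> N (t x) \<le> 1"
    and s1: "\<exists>x\<in>square. N (s x) = 1" and t1: "\<exists>x\<in>square. N (t x) = 1"
  shows "\<exists>z\<in>square. 1 / p \<le> N (prod_coeff w s t z)"
proof -
  have p1: "1 / real p < 1" "0 < 1 / real p" using p_gt_1 by simp_all
  define j0 where "j0 = (LEAST j. j < q \<and> (\<exists>i<q. N (s (i, j)) = 1))"
  define l0 where "l0 = (LEAST j. j < q \<and> (\<exists>i<q. N (t (i, j)) = 1))"
  have exj: "\<exists>j. j < q \<and> (\<exists>i<q. N (s (i, j)) = 1)" and exl: "\<exists>j. j < q \<and> (\<exists>i<q. N (t (i, j)) = 1)"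
    using s1 t1 by auto
  have j0: "j0 < q" "\<exists>i<q. N (s (i, j0)) = 1" using LeastI_ex[OF exj] unfolding j0_def by auto
  have l0: "l0 < q" "\<exists>i<q. N (t (i, l0)) = 1" using LeastI_ex[OF exl] unfolding l0_def by auto
  have s_low: "N (s (i, j)) \<le> 1 / p" if "i < q" "j < j0" for i j
  proof (rule abs_less_1)
    have "j < q" using that j0 by simp
    then have "N (s (i, j)) \<noteq> 1" using that not_less_Least[of j, folded j0_def] unfolding j0_def by blast
    then show "N (s (i, j)) < 1" using s[of "(i, j)"] that \<open>j < q\<close> by simp
  qed
  have t_low: "N (t (i, j)) \<le> 1 / p" if "i < q" "j < l0" for i j
  proof (rule abs_less_1)
    have "j < q" using that l0 by simp
    then have "N (t (i, j)) \<noteq> 1" using that not_less_Least[of j, folded l0_def] unfolding l0_def by blast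
    then show "N (t (i, j)) < 1" using t[of "(i, j)"] that \<open>j < q\<close> by simp
  qed
  \<comment> \<open>The leading term has filtration degree j0 + l0 = q D + L: it sits in row
    \<open>L\<close> with a factor p^D.\<close>
  define D where "D = (j0 + l0) div q"
  define L where "L = (j0 + l0) mod q"
  have DL: "j0 + l0 = q * D + L" by (simp add: D_def L_def)
  \<comment> \<open>Both rows are below \<open>q\<close>, so at most one factor p splits off; this
    is the origin of the constant 1/p.\<close>
  have D_le: "D \<le> 1" using j0 l0 q_pos by (simp add: D_def less_mult_imp_div_less flip: less_Suc_eq_le)
  have L: "L < q" using q_pos by (simp add: L_def)
  \<comment> \<open>Moving y^j0 past x^i' costs w^(j0 i'), a unit that is absorbed into the entries
    of \<open>t\<close>; what is left is the convolution of \<open>leading_part\<close>.\<close>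
  define M where "M k = (\<Sum>(i, i')\<in>{(i, i'). i < q \<and> i' < q \<and> (i + i') mod q = k}.
    of_int \<alpha> ^ ((i + i') div q) * (s (i, j0) * (w ^ (j0 * i') * t (i', l0))))" for k
  have w_pow: "N (w ^ m) = 1" for m using w by (simp add: abs_power)
  have "\<exists>k<q. N (M k) = 1"
    unfolding M_def using s t j0 l0 by (intro leading_part) (auto simp: abs_mult w_pow)
  then obtain k where k: "k < q" "N (M k) = 1" by blast
  let ?I = "{((i, j), (i', l)). (i, j) \<in> square \<and> (i', l) \<in> square \<and> ((i + i') mod q, (j + l) mod q) = (k, L)}"
  let ?Main = "{((i, j), (i', l)). (i, j) \<in> square \<and> (i', l) \<in> square \<and> (i + i') mod q = k \<and> j = j0 \<and> l = l0}"
  define summand where "summand = (\<lambda>((i, j), (i', l)). w ^ (j * i') * (of_int \<alpha> ^ ((i + i') div q) *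
    of_nat p ^ ((j + l) div q)) * (s (i, j) * t (i', l)))"
  have fin: "finite ?I" by (rule finite_subset[of _ "square \<times> square"]) auto
  have sub: "?Main \<subseteq> ?I" by (auto simp: L_def)
  have "sum summand ?Main = (\<Sum>(i, i')\<in>{(i, i'). i < q \<and> i' < q \<and> (i + i') mod q = k}. summand ((i, j0), (i', l0)))"
    by (rule sum.reindex_bij_witness[of _ "\<lambda>(i, i'). ((i, j0), (i', l0))" "\<lambda>((i, j), (i', l)). (i, i')"])
      (use j0 l0 in auto)
  also have "\<dots> = of_nat p ^ D * M k"
    unfolding M_def sum_distrib_left by (rule sum.cong) (auto simp: summand_def D_def)
  finally have main: "sum summand ?Main = of_nat p ^ D * M k" .
  have rest: "N (sum summand (?I - ?Main)) \<le> (1 / p) ^ Suc D"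
  proof (rule abs_sum_bound)
    fix u assume u_mem: "u \<in> ?I - ?Main"
    obtain i j i' l where u: "u = ((i, j), (i', l))" by (metis surj_pair)
    have mem: "(i, j) \<in> square" "(i', l) \<in> square" "L = (j + l) mod q" and ne: "j \<noteq> j0 \<or> l \<noteq> l0"
      using u_mem unfolding u by auto
    define d where "d = (j + l) div q"
    have dL: "j + l = q * d + L" using mem(3) by (simp add: d_def)
    have \<alpha>1: "N (of_int \<alpha> ^ m) \<le> 1" for m using abs_int_le_1[of "\<alpha> ^ m"] by simp
    have Ns: "N (s (i, j)) \<le> 1" and Nt: "N (t (i', l)) \<le> 1" using s t mem by auto
    have bound: "(1 / p) ^ d * (N (s (i, j)) * N (t (i', l))) \<le> (1 / p) ^ Suc D"
    proof -
      \<comment> \<open>Here j + l = q d + L. For d > D the power of p suffices. For d = D one has j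
        + l = j0 + l0, so one of the rows lies below its minimal unit row and its entry is a
        nonunit. For d < D one has j + l = j0 + l0 - q, so both rows lie below and two factors 1/p
        arise.\<close>
      consider "d > D" | "d = D" | "d < D" by linarith
      then show ?thesis
      proof cases
        case 1
        then have "(1 / real p) ^ d \<le> (1 / p) ^ Suc D" using p1 by (intro power_decreasing) auto
        moreover have "N (s (i, j)) * N (t (i', l)) \<le> 1" using Ns Nt by (intro mult_le_one) auto
        ultimately have "(1 / p) ^ d * (N (s (i, j)) * N (t (i', l))) \<le> (1 / p) ^ Suc D * 1"
          by (intro mult_mono) auto
        then show ?thesis by simp
      next
        case 2
        then have "j + l = j0 + l0" using DL dL by simp
        then have "j < j0 \<or> l < l0" using ne by linarith
        then have "N (s (i, j)) * N (t (i', l)) \<le> 1 / p"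
        proof
          assume "j < j0"
          then have "N (s (i, j)) * N (t (i', l)) \<le> 1 / p * 1"
            using mem s_low Nt by (intro mult_mono) auto
          then show ?thesis by simp
        next
          assume "l < l0"
          then have "N (s (i, j)) * N (t (i', l)) \<le> 1 * (1 / p)"
            using mem t_low Ns by (intro mult_mono) auto
          then show ?thesis by simp
        qed
        then have "(1 / p) ^ d * (N (s (i, j)) * N (t (i', l))) \<le> (1 / p) ^ d * (1 / p)"
          by (intro mult_left_mono) auto
        then show ?thesis using 2 by (simp add: mult.commute)
      next
        case 3
        then have "D = 1" "d = 0" using D_le by auto
        then have "j < j0" "l < l0" using DL dL j0 l0 by auto
        then have "N (s (i, j)) * N (t (i', l)) \<le> 1 / p * (1 / p)"
          using mem s_low t_low by (intro mult_mono) auto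
        then show ?thesis using \<open>D = 1\<close> \<open>d = 0\<close> by simp
      qed
    qed
    have "N (summand ((i, j), (i', l))) = N (of_int \<alpha> ^ ((i + i') div q)) * ((1 / p) ^ d * (N (s (i, j)) * N (t (i', l))))"
      by (simp add: summand_def abs_mult abs_power w abs_p d_def)
    also have "\<dots> \<le> 1 * (1 / p) ^ Suc D"
      using \<alpha>1 bound by (intro mult_mono) auto
    finally show "N (summand u) \<le> (1 / p) ^ Suc D" by (simp add: u)
  qed simp
  have "prod_coeff w s t (k, L) = sum summand ?I"
    by (simp only: prod_coeff_def summand_def)
  also have "\<dots> = sum summand (?I - ?Main) + sum summand ?Main" by (rule sum.subset_diff[OF sub fin])
  finally have eq: "prod_coeff w s t (k, L) = of_nat p ^ D * M k + sum summand (?I - ?Main)"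
    using main by simp
  have lead: "N (of_nat p ^ D * M k) = (1 / p) ^ D" by (simp add: abs_mult abs_power abs_p k)
  have "(1 / real p) ^ Suc D < (1 / p) ^ D" using p1 by (intro power_strict_decreasing) auto
  then have "N (of_nat p ^ D * M k - prod_coeff w s t (k, L)) < N (of_nat p ^ D * M k)"
    using rest unfolding eq lead by simp
  then have "N (prod_coeff w s t (k, L)) = (1 / p) ^ D" using abs_eq_of_close lead by metis
  moreover have "(1 / real p) ^ 1 \<le> (1 / p) ^ D" using p1 D_le by (intro power_decreasing) auto
  ultimately show ?thesis using k L by (intro bexI[of _ "(k, L)"]) auto
qed

text \<open>Dividing each array by an entry of maximal absolute value reduces to the normalized
  case. The factor 1/p is uniform in \<open>w\<close>, \<open>s\<close> and \<open>t\<close>, so the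
  bound can be used along Cauchy sequences.\<close>

lemma prod_coeff_lower_bound:
  assumes w: "N w = 1" and x: "x \<in> square" and y: "y \<in> square"
  shows "\<exists>z\<in>square. N (s x) * N (t y) / p \<le> N (prod_coeff w s t z)"
proof (cases "s x = 0 \<or> t y = 0")
  case True
  then show ?thesis using x by (intro bexI[OF _ x]) auto
next
  case False
  have ex_max: "\<exists>x'\<in>square. \<forall>x\<in>square. N (f x) \<le> N (f x')" for f
  proof -
    have "finite ((\<lambda>x. N (f x)) ` square)" "(\<lambda>x. N (f x)) ` square \<noteq> {}" using x by auto
    then have mem: "Max ((\<lambda>x. N (f x)) ` square) \<in> (\<lambda>x. N (f x)) ` square"
      and le: "\<forall>x\<in>square. N (f x) \<le> Max ((\<lambda>x. N (f x)) ` square)"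
      by (auto intro: Max_in)
    from mem obtain x' where "Max ((\<lambda>x. N (f x)) ` square) = N (f x')" "x' \<in> square" by (rule imageE)
    then show ?thesis using le by (intro bexI[of _ x']) simp_all
  qed
  obtain x' where x': "x' \<in> square" "\<And>x. x \<in> square \<Longrightarrow> N (s x) \<le> N (s x')" using ex_max by blast
  obtain y' where y': "y' \<in> square" "\<And>x. x \<in> square \<Longrightarrow> N (t x) \<le> N (t y')" using ex_max by blast
  have nz: "N (s x') > 0" "N (t y') > 0"
    using x'(2)[OF x] y'(2)[OF y] abs_pos[of "s x"] abs_pos[of "t y"] False by auto
  have "\<exists>z\<in>square. 1 / p \<le> N (prod_coeff w (\<lambda>x. s x / s x') (\<lambda>y. t y / t y') z)"
    using x' y' nz by (intro prod_coeff_normalized[OF w]) (auto simp: abs_divide intro!: bexI[of _ x'] bexI[of _ y'])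
  then obtain z where z: "z \<in> square" "1 / p \<le> N (prod_coeff w (\<lambda>x. s x / s x') (\<lambda>y. t y / t y') z)" by blast
  have "prod_coeff w (\<lambda>x. s x / s x') (\<lambda>y. t y / t y') z = prod_coeff w s t z / (s x' * t y')"
    unfolding prod_coeff_def sum_divide_distrib by (rule sum.cong) auto
  then have "N (s x') * N (t y') / p \<le> N (prod_coeff w s t z)"
    using z(2) nz by (simp add: abs_divide abs_mult field_simps)
  moreover have "N (s x) * N (t y) / p \<le> N (s x') * N (t y') / p"
    using x'(2)[OF x] y'(2)[OF y] by (intro divide_right_mono mult_mono) auto
  ultimately show ?thesis using z(1) by (meson order_trans)
qed

end

lemma (in ideal) ex_coset: "u \<in> carrier (R Quot I) \<Longrightarrow> \<exists>x\<in>carrier R. u = I +> x"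
  by (auto simp: FactRing_simps)

section \<open>Inverses in the coordinate model, and descent of integrality along an
  embedding\<close>

context symbol_data
begin

text \<open>The monomials span the model over the image of the field, so its dimension is finite and
  \<open>finite_dimension_Units\<close> applies.\<close>

lemma Units_model:
  assumes F: "field F"
    and integral: "\<And>f g. \<lbrakk>f \<in> carrier T; g \<in> carrier T; f \<otimes>\<^bsub>T\<^esub> g = \<zero>\<^bsub>T\<^esub>\<rbrakk> \<Longrightarrow> f = \<zero>\<^bsub>T\<^esub> \<or> g = \<zero>\<^bsub>T\<^esub>"
  shows "Units T = carrier T - {\<zero>\<^bsub>T\<^esub>}"
proof -
  interpret F: field F by (rule F)
  have one: "\<one>\<^bsub>T\<^esub> \<noteq> \<zero>\<^bsub>T\<^esub>"
  proof
    assume "\<one>\<^bsub>T\<^esub> = \<zero>\<^bsub>T\<^esub>"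
    then have "monomial F \<one> (0 :: nat, 0 :: nat) = (\<lambda>_. \<zero>)" using T.one_eq T.zero_eq by simp
    then have "monomial F \<one> (0 :: nat, 0 :: nat) (0, 0) = \<zero>" by (rule fun_cong)
    then show False by (simp add: monomial_def)
  qed
  interpret s: ring_hom_ring F T scalar
    by (rule ring_hom_ringI2[OF R.ring_axioms T.ring central_homD(1)[OF central_hom_scalar]])
  let ?K = "scalar ` carrier F"
  have K: "subfield ?K T" by (rule s.img_is_subfield(2)[OF F.carrier_is_subfield one])
  obtain xs where xs: "set xs = {..<n} \<times> {..<n}" using finite_list[of "{..<n} \<times> {..<n}"] by auto
  let ?Us = "map (monomial F \<one>) xs"
  have Us: "set ?Us \<subseteq> carrier T"
    unfolding set_map xs
    by (rule image_subsetI, rule T.monomial_closed[OF R.one_closed]) (simp only: residue_square_simps)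
  have "f \<in> T.P.Span ?K ?Us" if "f \<in> carrier T" for f
    using that
  proof (induction f rule: T.twisted_induct)
    case zero
    show ?case by (rule T.P.Span_subgroup_props(2)[OF K Us])
  next
    case (add f g)
    show ?case by (rule T.P.Span_subgroup_props(3)[OF K Us add(3,4)])
  next
    case (monomial r x)
    have "monomial F r x = scalar r \<otimes>\<^bsub>T\<^esub> monomial F \<one> x"
      using monomial n T.monomial_mult[of r \<one> "(0, 0)" x] symbol_cocycle_one(1)[of x]
      by (cases x) (auto simp: mod_less)
    moreover have "monomial F \<one> x \<in> T.P.Span ?K ?Us"
      by (rule subsetD[OF T.P.Span_base_incl[OF K Us]])
        (use monomial(2) in \<open>simp only: set_map xs residue_square_simps imageI\<close>)
    ultimately show ?case using T.P.Span_smult_closed[OF K Us, of "scalar r"] monomial(1) by simp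
  qed
  then have "T.P.Span ?K ?Us = carrier T"
    using T.P.Span_subgroup_props(1)[OF K Us] by blast
  then have "T.P.finite_dimension ?K (carrier T)"
    using T.P.Span_finite_dimension[OF K Us] by simp
  then show ?thesis by (rule T.P.finite_dimension_Units[OF K _ one integral])
qed

end

text \<open>The homomorphism from the universal property turns out to be \<iota> applied to each
  coordinate, hence injective; zero divisors over \<open>K\<close> would become zero divisors over
  \<open>L\<close>.\<close>

lemma symbol_model_integral_hom:
  assumes K: "symbol_data K n \<omega> a b" and L: "symbol_data L n (\<iota> \<omega>) (\<iota> a) (\<iota> b)"
    and \<iota>: "\<iota> \<in> ring_hom K L" and inj: "\<And>k. \<lbrakk>k \<in> carrier K; \<iota> k = \<zero>\<^bsub>L\<^esub>\<rbrakk> \<Longrightarrow> k = \<zero>\<^bsub>K\<^esub>"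
    and integral: "\<And>f g. \<lbrakk>f \<in> carrier (symbol_model L n (\<iota> \<omega>) (\<iota> a) (\<iota> b));
        g \<in> carrier (symbol_model L n (\<iota> \<omega>) (\<iota> a) (\<iota> b));
        f \<otimes>\<^bsub>symbol_model L n (\<iota> \<omega>) (\<iota> a) (\<iota> b)\<^esub> g = \<zero>\<^bsub>symbol_model L n (\<iota> \<omega>) (\<iota> a) (\<iota> b)\<^esub>\<rbrakk>
      \<Longrightarrow> f = \<zero>\<^bsub>symbol_model L n (\<iota> \<omega>) (\<iota> a) (\<iota> b)\<^esub> \<or> g = \<zero>\<^bsub>symbol_model L n (\<iota> \<omega>) (\<iota> a) (\<iota> b)\<^esub>"
    and f: "f \<in> carrier (symbol_model K n \<omega> a b)" and g: "g \<in> carrier (symbol_model K n \<omega> a b)"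
    and fg: "f \<otimes>\<^bsub>symbol_model K n \<omega> a b\<^esub> g = \<zero>\<^bsub>symbol_model K n \<omega> a b\<^esub>"
  shows "f = \<zero>\<^bsub>symbol_model K n \<omega> a b\<^esub> \<or> g = \<zero>\<^bsub>symbol_model K n \<omega> a b\<^esub>"
proof -
  interpret K: symbol_data K n \<omega> a b by (rule K)
  interpret L: symbol_data L n "\<iota> \<omega>" "\<iota> a" "\<iota> b" by (rule L)
  interpret \<iota>: ring_hom_ring K L \<iota> by (rule ring_hom_ringI2[OF K.R.ring_axioms L.R.ring_axioms \<iota>])
  have central: "central_hom K L.T (\<lambda>r. L.scalar (\<iota> r))"
    by (rule central_hom_compose[OF \<iota> L.central_hom_scalar])
  have "symbol_relations K L.T (\<lambda>r. L.scalar (\<iota> r)) n \<omega> a b L.gen_x L.gen_y"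
    using L.symbol_relations_model unfolding symbol_relations_def .
  from K.symbol_model_universal[OF L.T.ring central this]
  obtain h where h: "h \<in> ring_hom K.T L.T"
    and h_mono: "\<And>r i j. \<lbrakk>r \<in> carrier K; i < n; j < n\<rbrakk> \<Longrightarrow> h (monomial K r (i, j)) =
      L.scalar (\<iota> r) \<otimes>\<^bsub>L.T\<^esub> (L.gen_x [^]\<^bsub>L.T\<^esub> i \<otimes>\<^bsub>L.T\<^esub> L.gen_y [^]\<^bsub>L.T\<^esub> j)" by blast
  have h_eq: "h f = (\<lambda>z. \<iota> (f z))" if "f \<in> carrier K.T" for f
    using that
  proof (induction f rule: K.T.twisted_induct)
    case zero
    have "h \<zero>\<^bsub>K.T\<^esub> = \<zero>\<^bsub>L.T\<^esub>"
      by (rule ring_hom_zero[OF h K.T.ring L.T.ring])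
    then show ?case by (simp add: K.T.zero_eq L.T.zero_eq)
  next
    case (add f g)
    have "h (f \<oplus>\<^bsub>K.T\<^esub> g) = (\<lambda>z. \<iota> (f z) \<oplus>\<^bsub>L\<^esub> \<iota> (g z))"
      unfolding ring_hom_add[OF h add(1,2)] add(3,4) L.T.add_eq ..
    also have "\<dots> = (\<lambda>z. \<iota> ((f \<oplus>\<^bsub>K.T\<^esub> g) z))"
      using K.T.coeff_closed[OF add(1)] K.T.coeff_closed[OF add(2)] by (simp add: K.T.add_eq)
    finally show ?case .
  next
    case (monomial r x)
    then obtain i j where x: "x = (i, j)" "i < n" "j < n" by auto
    have "h (monomial K r x) = monomial L (\<iota> r) (i, j)"
      unfolding x(1) h_mono[OF monomial(1) x(2,3)]
      by (rule L.monomial_eq[symmetric, OF \<iota>.hom_closed[OF monomial(1)] x(2,3)])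
    then show ?case by (auto simp: monomial_def x(1))
  qed
  have h_zero: "f = \<zero>\<^bsub>K.T\<^esub>" if "f \<in> carrier K.T" "h f = \<zero>\<^bsub>L.T\<^esub>" for f
  proof
    fix z
    have "h f z = \<zero>\<^bsub>L.T\<^esub> z" using that(2) by simp
    then have "\<iota> (f z) = \<zero>\<^bsub>L\<^esub>" unfolding h_eq[OF that(1)] L.T.zero_eq .
    then show "f z = \<zero>\<^bsub>K.T\<^esub> z" using inj K.T.coeff_closed[OF that(1)] by (simp add: K.T.zero_eq)
  qed
  have "h f \<otimes>\<^bsub>L.T\<^esub> h g = \<zero>\<^bsub>L.T\<^esub>"
    using ring_hom_mult[OF h f g] ring_hom_zero[OF h K.T.ring L.T.ring] fg by simp
  then have "h f = \<zero>\<^bsub>L.T\<^esub> \<or> h g = \<zero>\<^bsub>L.T\<^esub>"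
    by (intro integral ring_hom_closed[OF h] f g)
  then show ?thesis using h_zero f g by blast
qed

section \<open>The field of p-adic numbers\<close>

context padic
begin

abbreviation "C \<equiv> padic_Cauchy_ring p"
abbreviation "Qp \<equiv> padic_field p"

lemma Cauchy_bounded: "padic_Cauchy p s \<Longrightarrow> \<exists>c>0. \<forall>n. N (s n) \<le> c"
proof -
  assume "padic_Cauchy p s"
  then obtain M where M: "\<And>m n. m \<ge> M \<Longrightarrow> n \<ge> M \<Longrightarrow> N (s m - s n) < 1"
    unfolding padic_Cauchy_def using zero_less_one by metis
  let ?c = "1 + (\<Sum>n\<le>M. N (s n))"
  have le: "N (s n) \<le> ?c" if "n \<le> M" for n
    using member_le_sum[of n "{..M}" "\<lambda>n. N (s n)"] that by simp
  have "N (s n) \<le> ?c" for n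
  proof (cases "n \<le> M")
    case False
    have "N (s n - s M) \<le> ?c"
      using M[of n M] False sum_nonneg[of "{..M}" "\<lambda>n. N (s n)"] by simp
    then have "N ((s n - s M) + s M) \<le> ?c" using le[of M] by (rule abs_add_bound) simp
    then show ?thesis by simp
  qed (rule le)
  moreover have "?c > 0" using sum_nonneg[of "{..M}" "\<lambda>n. N (s n)"] by (simp add: add_pos_nonneg)
  ultimately show ?thesis by blast
qed

lemma Cauchy_const: "padic_Cauchy p (\<lambda>_. c)"
  by (simp add: padic_Cauchy_def)

lemma Cauchy_add:
  assumes "padic_Cauchy p s" "padic_Cauchy p t" shows "padic_Cauchy p (\<lambda>n. s n + t n)"
  unfolding padic_Cauchy_def
proof (intro allI impI)
  fix e :: real assume "e > 0"
  then obtain M M' where M: "\<And>m n. m \<ge> M \<Longrightarrow> n \<ge> M \<Longrightarrow> N (s m - s n) < e"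
    and M': "\<And>m n. m \<ge> M' \<Longrightarrow> n \<ge> M' \<Longrightarrow> N (t m - t n) < e"
    using assms unfolding padic_Cauchy_def by metis
  have "N (s m + t m - (s n + t n)) < e" if "m \<ge> max M M'" "n \<ge> max M M'" for m n
  proof -
    have "N (s m + t m - (s n + t n)) \<le> max (N (s m - s n)) (N (t m - t n))"
      using abs_add_le[of "s m - s n" "t m - t n"] by (simp add: algebra_simps)
    then show ?thesis using M[of m n] M'[of m n] that by simp
  qed
  then show "\<exists>M. \<forall>m\<ge>M. \<forall>n\<ge>M. N (s m + t m - (s n + t n)) < e" by blast
qed

lemma Cauchy_mult:
  assumes s: "padic_Cauchy p s" and t: "padic_Cauchy p t" shows "padic_Cauchy p (\<lambda>n. s n * t n)"
  unfolding padic_Cauchy_def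
proof (intro allI impI)
  fix e :: real assume e: "e > 0"
  obtain c where c: "c > 0" "\<And>n. N (s n) \<le> c" using Cauchy_bounded[OF s] by blast
  obtain d where d: "d > 0" "\<And>n. N (t n) \<le> d" using Cauchy_bounded[OF t] by blast
  have "e / d > 0" "e / c > 0" using e c d by auto
  then obtain M M' where M: "\<And>m n. m \<ge> M \<Longrightarrow> n \<ge> M \<Longrightarrow> N (s m - s n) < e / d"
    and M': "\<And>m n. m \<ge> M' \<Longrightarrow> n \<ge> M' \<Longrightarrow> N (t m - t n) < e / c"
    using s t unfolding padic_Cauchy_def by metis
  have "N (s m * t m - s n * t n) < e" if "m \<ge> max M M'" "n \<ge> max M M'" for m n
  proof -
    have "N (s m * t m - s n * t n) \<le> max (N (s m * (t m - t n))) (N ((s m - s n) * t n))"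
      using abs_add_le[of "s m * (t m - t n)" "(s m - s n) * t n"]
      by (simp add: left_diff_distrib right_diff_distrib)
    moreover have "N (s m) * N (t m - t n) \<le> c * N (t m - t n)"
      using c by (intro mult_right_mono) auto
    moreover have "c * N (t m - t n) < e"
      using M'[of m n] that c(1) by (simp add: field_simps)
    moreover have "N (s m - s n) * N (t n) \<le> N (s m - s n) * d"
      using d by (intro mult_left_mono) auto
    moreover have "N (s m - s n) * d < e"
      using M[of m n] that d(1) by (simp add: field_simps)
    ultimately show ?thesis unfolding abs_mult by linarith
  qed
  then show "\<exists>M. \<forall>m\<ge>M. \<forall>n\<ge>M. N (s m * t m - s n * t n) < e" by blast
qed

lemma Cauchy_uminus: "padic_Cauchy p s \<Longrightarrow> padic_Cauchy p (\<lambda>n. - s n)"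
  using Cauchy_mult[OF Cauchy_const[of "-1"]] by simp

lemma Cauchy_power: "padic_Cauchy p s \<Longrightarrow> padic_Cauchy p (\<lambda>n. s n ^ k)"
  by (induction k) (auto intro: Cauchy_const Cauchy_mult)

lemma Cauchy_sum: "(\<And>i. i \<in> I \<Longrightarrow> padic_Cauchy p (f i)) \<Longrightarrow> padic_Cauchy p (\<lambda>n. \<Sum>i\<in>I. f i n)"
  by (induction I rule: infinite_finite_induct) (auto intro: Cauchy_const Cauchy_add)

lemma null_iff: "s \<in> padic_null p \<longleftrightarrow> (\<forall>e>0. \<exists>M. \<forall>n\<ge>M. N (s n) < e)"
  by (simp add: padic_null_def LIMSEQ_iff)

lemma null_Cauchy:
  assumes "s \<in> padic_null p" shows "padic_Cauchy p s"
  unfolding padic_Cauchy_def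
proof (intro allI impI)
  fix e :: real assume "e > 0"
  then obtain M where M: "\<And>n. n \<ge> M \<Longrightarrow> N (s n) < e" using assms null_iff by blast
  have "N (s m - s n) < e" if "m \<ge> M" "n \<ge> M" for m n
    using abs_diff_le[of "s m" "s n"] M[OF that(1)] M[OF that(2)] by linarith
  then show "\<exists>M. \<forall>m\<ge>M. \<forall>n\<ge>M. N (s m - s n) < e" by blast
qed

text \<open>Once the differences are smaller than a bound that terms keep reaching, the ultrametric
  freezes the absolute value. This stands in for an absolute value on Q_p itself.\<close>

lemma nonnull_eventually_const:
  assumes s: "padic_Cauchy p s" and nn: "s \<notin> padic_null p"
  shows "\<exists>c>0. \<exists>M. \<forall>n\<ge>M. N (s n) = c"
proof -
  obtain e where e: "e > 0" "\<And>M. \<exists>n\<ge>M. e \<le> N (s n)"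
    using nn by (auto simp: null_iff not_less)
  obtain M where M: "\<And>m n. m \<ge> M \<Longrightarrow> n \<ge> M \<Longrightarrow> N (s m - s n) < e"
    using s e(1) unfolding padic_Cauchy_def by blast
  obtain k where k: "k \<ge> M" "e \<le> N (s k)" using e(2) by blast
  have "N (s n) = N (s k)" if "n \<ge> M" for n
    using abs_eq_of_close[of "s k" "s n"] M[OF k(1) that] k(2) by simp
  moreover have "0 < N (s k)" using k(2) e(1) by linarith
  ultimately show ?thesis by blast
qed

lemma carrier_C [simp]: "s \<in> carrier C \<longleftrightarrow> padic_Cauchy p s"
  and add_C: "s \<oplus>\<^bsub>C\<^esub> t = (\<lambda>n. s n + t n)" and mult_C: "s \<otimes>\<^bsub>C\<^esub> t = (\<lambda>n. s n * t n)"
  and one_C: "\<one>\<^bsub>C\<^esub> = (\<lambda>n. 1)" and zero_C: "\<zero>\<^bsub>C\<^esub> = (\<lambda>n. 0)"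
  by (simp_all add: padic_Cauchy_ring_def)

lemma cring_C: "cring C"
proof (intro cringI abelian_groupI comm_monoidI)
  show "\<exists>t\<in>carrier C. t \<oplus>\<^bsub>C\<^esub> s = \<zero>\<^bsub>C\<^esub>" if "s \<in> carrier C" for s
    using that by (intro bexI[of _ "\<lambda>n. - s n"]) (simp_all add: add_C zero_C Cauchy_uminus)
qed (simp_all add: add_C mult_C one_C zero_C Cauchy_add Cauchy_mult Cauchy_const algebra_simps)

sublocale C: cring C
  by (rule cring_C)

lemma uminus_C: "padic_Cauchy p s \<Longrightarrow> \<ominus>\<^bsub>C\<^esub> s = (\<lambda>n. - s n)"
  by (rule C.minus_equality) (simp_all add: add_C zero_C Cauchy_uminus)

lemma minus_C: "padic_Cauchy p s \<Longrightarrow> padic_Cauchy p t \<Longrightarrow> s \<ominus>\<^bsub>C\<^esub> t = (\<lambda>n. s n - t n)"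
  by (simp add: a_minus_def uminus_C add_C)

lemma null_add:
  assumes "s \<in> padic_null p" "t \<in> padic_null p" shows "(\<lambda>n. s n + t n) \<in> padic_null p"
  unfolding null_iff
proof (intro allI impI)
  fix e :: real assume "e > 0"
  then obtain M M' where M: "\<And>n. n \<ge> M \<Longrightarrow> N (s n) < e" "\<And>n. n \<ge> M' \<Longrightarrow> N (t n) < e"
    using assms null_iff by metis
  have "N (s n + t n) < e" if "n \<ge> max M M'" for n
    using abs_add_le[of "s n" "t n"] M(1)[of n] M(2)[of n] that by auto
  then show "\<exists>M. \<forall>n\<ge>M. N (s n + t n) < e" by blast
qed

lemma null_mult:
  assumes s: "s \<in> padic_null p" and t: "padic_Cauchy p t" shows "(\<lambda>n. t n * s n) \<in> padic_null p"
  unfolding null_iff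
proof (intro allI impI)
  fix e :: real assume e: "e > 0"
  obtain c where c: "c > 0" "\<And>n. N (t n) \<le> c" using Cauchy_bounded[OF t] by blast
  then have "e / c > 0" using e by simp
  then obtain M where M: "\<And>n. n \<ge> M \<Longrightarrow> N (s n) < e / c" using s null_iff by metis
  have "N (t n * s n) < e" if "n \<ge> M" for n
  proof -
    have "N (t n) * N (s n) \<le> c * N (s n)" using c by (intro mult_right_mono) auto
    then show ?thesis using M[OF that] c(1) by (simp add: abs_mult field_simps)
  qed
  then show "\<exists>M. \<forall>n\<ge>M. N (t n * s n) < e" by blast
qed

lemma null_ideal: "ideal (padic_null p) C"
proof (rule idealI)
  show "subgroup (padic_null p) (add_monoid C)"
  proof (rule C.add.subgroupI)
    show "padic_null p \<subseteq> carrier C" using null_Cauchy by auto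
    have "(\<lambda>n. 0) \<in> padic_null p" by (simp add: null_iff)
    then show "padic_null p \<noteq> {}" by blast
  next
    fix s assume s: "s \<in> padic_null p"
    then have "\<ominus>\<^bsub>C\<^esub> s = (\<lambda>n. - s n)" by (intro uminus_C null_Cauchy)
    then show "\<ominus>\<^bsub>C\<^esub> s \<in> padic_null p" using s by (simp add: null_iff)
  next
    fix s t assume "s \<in> padic_null p" "t \<in> padic_null p"
    then show "s \<oplus>\<^bsub>C\<^esub> t \<in> padic_null p" by (simp add: add_C null_add)
  qed
qed (use null_mult in \<open>auto simp: mult_C mult.commute C.ring_axioms\<close>)

sublocale null: ideal "padic_null p" C
  by (rule null_ideal)

abbreviation "\<pi> s \<equiv> padic_null p +>\<^bsub>C\<^esub> s"

lemma cring_Qp: "cring Qp"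
  unfolding padic_field_def by (rule null.quotient_is_cring[OF cring_C])

sublocale Qp: cring Qp
  by (rule cring_Qp)

lemma pi_hom: "(\<lambda>s. \<pi> s) \<in> ring_hom C Qp"
  unfolding padic_field_def by (rule null.rcos_ring_hom)

lemma pi_closed [simp]: "padic_Cauchy p s \<Longrightarrow> \<pi> s \<in> carrier Qp"
  by (rule ring_hom_closed[OF pi_hom]) simp

lemma pi_add: "\<lbrakk>padic_Cauchy p s; padic_Cauchy p t\<rbrakk> \<Longrightarrow> \<pi> s \<oplus>\<^bsub>Qp\<^esub> \<pi> t = \<pi> (\<lambda>n. s n + t n)"
  using ring_hom_add[OF pi_hom, of s t] by (simp add: add_C)

lemma pi_mult: "\<lbrakk>padic_Cauchy p s; padic_Cauchy p t\<rbrakk> \<Longrightarrow> \<pi> s \<otimes>\<^bsub>Qp\<^esub> \<pi> t = \<pi> (\<lambda>n. s n * t n)"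
  using ring_hom_mult[OF pi_hom, of s t] by (simp add: mult_C)

lemma pi_one: "\<one>\<^bsub>Qp\<^esub> = \<pi> (\<lambda>n. 1)"
  using ring_hom_one[OF pi_hom] by (simp add: one_C)

lemma pi_pow: "padic_Cauchy p s \<Longrightarrow> \<pi> s [^]\<^bsub>Qp\<^esub> (k :: nat) = \<pi> (\<lambda>n. s n ^ k)"
  by (induction k) (simp_all add: pi_one pi_mult Cauchy_power mult.commute)

lemma pi_surj: "x \<in> carrier Qp \<Longrightarrow> \<exists>s. padic_Cauchy p s \<and> x = \<pi> s"
  using null.ex_coset[of x] by (auto simp: padic_field_def)

lemma zero_Qp: "\<zero>\<^bsub>Qp\<^esub> = padic_null p"
  by (simp add: padic_field_def FactRing_def)

lemma pi_eq_zero_iff: "padic_Cauchy p s \<Longrightarrow> \<pi> s = \<zero>\<^bsub>Qp\<^esub> \<longleftrightarrow> s \<in> padic_null p"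
  using null.rcos_const_imp_mem[of s] C.a_rcos_zero[OF null_ideal, of s] by (auto simp: zero_Qp)

lemma pi_eq_iff: "\<lbrakk>padic_Cauchy p s; padic_Cauchy p t\<rbrakk> \<Longrightarrow> \<pi> s = \<pi> t \<longleftrightarrow> (\<lambda>n. s n - t n) \<in> padic_null p"
  using C.quotient_eq_iff_same_a_r_cos[OF null_ideal, of s t] by (simp add: minus_C)

lemma pi_sum:
  assumes "finite I" "\<And>i. i \<in> I \<Longrightarrow> padic_Cauchy p (F i)"
  shows "finsum Qp (\<lambda>i. \<pi> (F i)) I = \<pi> (\<lambda>n. \<Sum>i\<in>I. F i n)"
  using assms
proof (induction I rule: finite_induct)
  case empty
  have "(\<lambda>n. 0) \<in> padic_null p" by (simp add: null_iff)
  then show ?case using pi_eq_zero_iff[OF Cauchy_const[of 0]] by simp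
next
  case (insert i I)
  then show ?case by (simp add: Pi_def pi_add Cauchy_sum)
qed

lemma field_Qp: "field Qp"
proof (rule Qp.cring_fieldI2)
  have "(\<lambda>n. 1) \<notin> padic_null p"
  proof
    assume "(\<lambda>n. 1) \<in> padic_null p"
    then obtain M :: nat where "\<forall>n\<ge>M. N 1 < 1"
      using null_iff[of "\<lambda>n. 1"] zero_less_one[where ?'a = real] by blast
    then have "N 1 < 1" by blast
    then show False by simp
  qed
  then show "\<zero>\<^bsub>Qp\<^esub> \<noteq> \<one>\<^bsub>Qp\<^esub>" using pi_eq_zero_iff[OF Cauchy_const[of 1]] pi_one by metis
next
  fix x assume x: "x \<in> carrier Qp" "x \<noteq> \<zero>\<^bsub>Qp\<^esub>"
  then obtain s where s: "padic_Cauchy p s" "x = \<pi> s" using pi_surj by blast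
  with x(2) have "s \<notin> padic_null p" using pi_eq_zero_iff by blast
  then obtain c M where c: "c > 0" "\<And>n. n \<ge> M \<Longrightarrow> N (s n) = c"
    using nonnull_eventually_const[OF s(1)] by blast
  have nz: "s n \<noteq> 0" if "n \<ge> M" for n using c(1) c(2)[OF that] by auto
  \<comment> \<open>Inverses are taken termwise, with \<open>inverse 0 = 0\<close> at possible early
    zeros; the estimates use only indices from \<open>M\<close> on.\<close>
  let ?t = "\<lambda>n. inverse (s n)"
  have t: "padic_Cauchy p ?t"
    unfolding padic_Cauchy_def
  proof (intro allI impI)
    fix e :: real assume "e > 0"
    then have "e * c * c > 0" using c(1) by simp
    then obtain M' where M': "\<And>m n. m \<ge> M' \<Longrightarrow> n \<ge> M' \<Longrightarrow> N (s m - s n) < e * c * c"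
      using s(1) unfolding padic_Cauchy_def by metis
    have "N (?t m - ?t n) < e" if mn: "m \<ge> max M M'" "n \<ge> max M M'" for m n
    proof -
      have eq: "?t m - ?t n = (s n - s m) * ?t m * ?t n"
        using nz[of m] nz[of n] mn by (simp add: field_simps)
      have "N (?t m - ?t n) = N (s n - s m) / (c * c)"
        unfolding eq abs_mult abs_inverse using c(2)[of m] c(2)[of n] mn by (simp add: divide_inverse)
      also have "\<dots> < e"
        using M'[of n m] mn c(1) by (simp add: pos_divide_less_eq mult.assoc)
      finally show ?thesis .
    qed
    then show "\<exists>M. \<forall>m\<ge>M. \<forall>n\<ge>M. N (?t m - ?t n) < e" by blast
  qed
  have "(\<lambda>n. s n * ?t n - 1) \<in> padic_null p"
    unfolding null_iff using nz by (auto intro!: exI[of _ M])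
  then have "x \<otimes>\<^bsub>Qp\<^esub> \<pi> ?t = \<one>\<^bsub>Qp\<^esub>"
    using s t by (simp add: pi_mult pi_one pi_eq_iff Cauchy_mult Cauchy_const)
  then show "\<exists>y\<in>carrier Qp. x \<otimes>\<^bsub>Qp\<^esub> y = \<one>\<^bsub>Qp\<^esub>"
    by (rule bexI[OF _ pi_closed[OF t]])
qed

end

section \<open>The symbol algebra over the p-adic numbers\<close>

context padic_symbol
begin

text \<open>Nonzero entries of \<open>f\<close> and \<open>g\<close> have representatives of
  eventually constant sizes \<open>c1\<close> and \<open>c2\<close>. At one large index the lower
  bound for rational products yields a coordinate of size at least \<open>c1 * c2 / p\<close>,
  although all coordinates of the product are null sequences.\<close>

lemma symbol_model_integral:
  assumes sd: "symbol_data Qp q \<omega> a b" and a: "a = \<pi> (\<lambda>_. of_int \<alpha>)" and b: "b = \<pi> (\<lambda>_. of_nat p)"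
    and f: "f \<in> carrier (symbol_model Qp q \<omega> a b)" and g: "g \<in> carrier (symbol_model Qp q \<omega> a b)"
    and fg: "f \<otimes>\<^bsub>symbol_model Qp q \<omega> a b\<^esub> g = \<zero>\<^bsub>symbol_model Qp q \<omega> a b\<^esub>"
  shows "f = \<zero>\<^bsub>symbol_model Qp q \<omega> a b\<^esub> \<or> g = \<zero>\<^bsub>symbol_model Qp q \<omega> a b\<^esub>"
proof (rule ccontr)
  interpret S: symbol_data Qp q \<omega> a b by (rule sd)
  assume "\<not> ?thesis"
  then obtain x0 y0 where x0: "f x0 \<noteq> \<zero>\<^bsub>Qp\<^esub>" and y0: "g y0 \<noteq> \<zero>\<^bsub>Qp\<^esub>"
    unfolding S.T.zero_eq fun_eq_iff by blast
  have sq: "x0 \<in> square" "y0 \<in> square"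
    using S.T.support_subset[OF f x0] S.T.support_subset[OF g y0] by simp_all
  obtain w where w: "padic_Cauchy p w" "\<omega> = \<pi> w" using pi_surj[OF S.parameters_closed(1)] by blast
  \<comment> \<open>For the rational terms \<open>w n\<close> the equation \<omega>^q = 1 holds only
    up to a null sequence, which still forces them to have absolute value 1 eventually.\<close>
  have "\<pi> (\<lambda>n. w n ^ q) = \<pi> (\<lambda>n. 1)"
    using S.root_of_unity w by (simp add: pi_pow pi_one)
  then have "(\<lambda>n. w n ^ q - 1) \<in> padic_null p"
    using pi_eq_iff[OF Cauchy_power[OF w(1)] Cauchy_const] by blast
  then obtain M0 where M0: "\<And>n. n \<ge> M0 \<Longrightarrow> N (w n ^ q - 1) < 1" unfolding null_iff by (metis zero_less_one)
  have w1: "N (w n) = 1" if "n \<ge> M0" for n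
  proof -
    have "N (1 - w n ^ q) < N 1" using M0[OF that] by (simp add: abs_minus_commute)
    then have "N (w n) ^ q = 1" using abs_eq_of_close[of 1 "w n ^ q"] by (simp add: abs_power)
    then show ?thesis using q_pos power_eq_imp_eq_base[of "N (w n)" q 1] by simp
  qed
  have "\<exists>s. \<forall>x. padic_Cauchy p (s x) \<and> f x = \<pi> (s x)"
    using pi_surj[OF S.T.coeff_closed[OF f]] by metis
  then obtain s where s: "\<And>x. padic_Cauchy p (s x)" "\<And>x. f x = \<pi> (s x)" by blast
  have "\<exists>t. \<forall>x. padic_Cauchy p (t x) \<and> g x = \<pi> (t x)"
    using pi_surj[OF S.T.coeff_closed[OF g]] by metis
  then obtain t where t: "\<And>x. padic_Cauchy p (t x)" "\<And>x. g x = \<pi> (t x)" by blast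
  obtain c1 M1 where c1: "c1 > 0" "\<And>n. n \<ge> M1 \<Longrightarrow> N (s x0 n) = c1"
    using nonnull_eventually_const[OF s(1)[of x0]] x0 s pi_eq_zero_iff by metis
  obtain c2 M2 where c2: "c2 > 0" "\<And>n. n \<ge> M2 \<Longrightarrow> N (t y0 n) = c2"
    using nonnull_eventually_const[OF t(1)[of y0]] y0 t pi_eq_zero_iff by metis
  define e where "e = c1 * c2 / p"
  have e: "e > 0" using c1 c2 p_gt_1 by (simp add: e_def)
  have supp: "{x. f x \<noteq> \<zero>\<^bsub>Qp\<^esub>} \<subseteq> square" "{x. g x \<noteq> \<zero>\<^bsub>Qp\<^esub>} \<subseteq> square"
    using S.T.support_subset[OF f] S.T.support_subset[OF g] unfolding residue_square_simps by blast+
  have null: "(\<lambda>n. prod_coeff (w n) (\<lambda>x. s x n) (\<lambda>y. t y n) z) \<in> padic_null p" for z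
  proof -
    let ?I = "{((i, j), (k, l)). (i, j) \<in> square \<and> (k, l) \<in> square \<and> ((i + k) mod q, (j + l) mod q) = z}"
    let ?F = "\<lambda>((i, j), (k, l)) n. w n ^ (j * k) * (of_int \<alpha> ^ ((i + k) div q) * of_nat p ^ ((j + l) div q)) *
      (s (i, j) n * t (k, l) n)"
    have F: "padic_Cauchy p (?F i)" for i
      by (auto simp: case_prod_unfold intro!: Cauchy_mult Cauchy_power Cauchy_const w s t)
    have fin: "finite ?I" by (rule finite_subset[of _ "square \<times> square"]) auto
    have I: "{(x, y) \<in> square \<times> square. x \<otimes>\<^bsub>residue_square q\<^esub> y = z} = ?I" by auto
    have "\<zero>\<^bsub>Qp\<^esub> = (f \<otimes>\<^bsub>S.T\<^esub> g) z" using fg by (simp add: S.T.zero_eq)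
    also have "\<dots> = finsum Qp (\<lambda>(x, y). symbol_cocycle Qp q \<omega> a b x y \<otimes>\<^bsub>Qp\<^esub> (f x \<otimes>\<^bsub>Qp\<^esub> g y))
        {(x, y) \<in> square \<times> square. x \<otimes>\<^bsub>residue_square q\<^esub> y = z}"
      by (rule S.T.mult_coeff[OF f g _ _ supp(1) _ _ supp(2)]) simp_all
    also have "\<dots> = finsum Qp (\<lambda>i. \<pi> (?F i)) ?I"
      unfolding I
    proof (rule Qp.finsum_cong')
      show "(\<lambda>i. \<pi> (?F i)) \<in> ?I \<rightarrow> carrier Qp" using F by auto
      fix u assume "u \<in> ?I"
      obtain i j k l where u: "u = ((i, j), (k, l))" by (cases u) auto
      show "(case u of (x, y) \<Rightarrow> symbol_cocycle Qp q \<omega> a b x y \<otimes>\<^bsub>Qp\<^esub> (f x \<otimes>\<^bsub>Qp\<^esub> g y)) = \<pi> (?F u)"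
        unfolding u prod.case symbol_cocycle_def a b w(2) s(2) t(2)
        by (simp add: pi_pow pi_mult w(1) s(1) t(1) Cauchy_const Cauchy_power Cauchy_mult)
    qed simp
    also have "\<dots> = \<pi> (\<lambda>n. \<Sum>i\<in>?I. ?F i n)" by (rule pi_sum[OF fin F])
    finally have "(\<lambda>n. \<Sum>i\<in>?I. ?F i n) \<in> padic_null p"
      using pi_eq_zero_iff[OF Cauchy_sum[of ?I ?F]] F by metis
    moreover have "(\<lambda>n. \<Sum>i\<in>?I. ?F i n) = (\<lambda>n. prod_coeff (w n) (\<lambda>x. s x n) (\<lambda>y. t y n) z)"
      unfolding prod_coeff_def by (intro ext sum.cong) auto
    ultimately show ?thesis by simp
  qed
  \<comment> \<open>The coordinate that the lower bound makes large may vary with the index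
    \<open>n\<close>, so one threshold has to serve all \<open>z\<close>; finiteness of the square
    provides it.\<close>
  have "\<forall>z\<in>square. eventually (\<lambda>n. N (prod_coeff (w n) (\<lambda>x. s x n) (\<lambda>y. t y n) z) < e) sequentially"
    using null e unfolding null_iff eventually_sequentially by blast
  then have "eventually (\<lambda>n. \<forall>z\<in>square. N (prod_coeff (w n) (\<lambda>x. s x n) (\<lambda>y. t y n) z) < e) sequentially"
    by (intro eventually_ball_finite) auto
  then obtain M3 where M3: "\<And>n z. n \<ge> M3 \<Longrightarrow> z \<in> square \<Longrightarrow> N (prod_coeff (w n) (\<lambda>x. s x n) (\<lambda>y. t y n) z) < e"
    unfolding eventually_sequentially by blast
  define n where "n = max (max M0 M1) (max M2 M3)"
  have n: "n \<ge> M0" "n \<ge> M1" "n \<ge> M2" "n \<ge> M3" by (simp_all add: n_def)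
  obtain z where "z \<in> square" "N (s x0 n) * N (t y0 n) / p \<le> N (prod_coeff (w n) (\<lambda>x. s x n) (\<lambda>y. t y n) z)"
    using prod_coeff_lower_bound[OF w1[OF n(1)] sq, of "\<lambda>x. s x n" "\<lambda>y. t y n"] by blast
  then show False using M3[OF n(4)] c1(2)[OF n(2)] c2(2)[OF n(3)] unfolding e_def by fastforce
qed

end

section \<open>Power residues\<close>

lemma mem_residue_powers:
  assumes p: "Factorial_Ring.prime (p :: nat)" and x: "\<not> int p dvd x"
  shows "x ^ q mod int p \<in> residue_powers p q"
proof -
  interpret residues_prime p "residue_ring (int p)"
    by unfold_locales (use p in auto)
  have "x mod int p \<in> Units (residue_ring (int p))"
    using x prime_gt_0_nat[OF p] pos_mod_bound[of "int p" x] pos_mod_sign[of "int p" x]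
    by (auto simp: res_prime_units_eq dvd_eq_mod_eq_0)
  moreover have "(x mod int p) [^]\<^bsub>residue_ring (int p)\<^esub> q = x ^ q mod int p" by (rule pow_cong)
  ultimately show ?thesis unfolding residue_powers_def by (metis image_eqI)
qed

lemma residue_powers_cong:
  assumes p: "Factorial_Ring.prime (p :: nat)" and y: "y \<in> residue_powers p q"
  shows "\<exists>x. \<not> int p dvd x \<and> [y = x ^ q] (mod int p)"
proof -
  interpret residues_prime p "residue_ring (int p)"
    by unfold_locales (use p in auto)
  obtain x where x: "x \<in> {1..int p - 1}" "y = x [^]\<^bsub>residue_ring (int p)\<^esub> q"
    using y prime_gt_0_nat[OF p] by (auto simp: residue_powers_def res_prime_units_eq of_nat_diff)
  have "y = x ^ q mod int p" using x pow_cong[of x q] by simp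
  moreover have "\<not> int p dvd x" using x by (auto dest: zdvd_imp_le)
  ultimately show ?thesis by (intro exI[of _ x]) simp
qed

lemma ex_generator:
  assumes p: "Factorial_Ring.prime (p :: nat)"
  shows "\<exists>g::nat. coprime p g \<and> ord p g = p - 1 \<and>
  (\<forall>x. \<not> int p dvd x \<longrightarrow> (\<exists>i. [x = int g ^ i] (mod int p)))"
proof -
  obtain g where g: "residue_primroot p g" using prime_primitive_root_exists[of p] p prime_gt_1_nat[OF p] by auto
  have "\<exists>i. [x = int g ^ i] (mod int p)" if "\<not> int p dvd x" for x
  proof -
    have "nat (x mod int p) \<in> totatives p"
    proof -
      have "x mod int p > 0" using that prime_gt_0_nat[OF p]
        by (metis dvd_eq_mod_eq_0 of_nat_0_less_iff order_le_less pos_mod_sign)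
      moreover have "x mod int p < int p" using prime_gt_0_nat[OF p] by simp
      ultimately have "0 < nat (x mod int p)" "nat (x mod int p) < p" by linarith+
      then show ?thesis using p by (simp add: totatives_prime)
    qed
    then obtain i where "nat (x mod int p) = g ^ i mod p"
      using residue_primroot_is_generator[OF prime_gt_1_nat[OF p] g] unfolding bij_betw_def by blast
    then have "int (nat (x mod int p)) = int g ^ i mod int p" by (simp add: zmod_int)
    then have "x mod int p = int g ^ i mod int p" using prime_gt_0_nat[OF p] by simp
    then show ?thesis unfolding cong_def by blast
  qed
  then show ?thesis using g p by (auto simp: residue_primroot_def totient_prime)
qed

context
  fixes p q :: nat
  assumes p: "Factorial_Ring.prime p" and q: "Factorial_Ring.prime q" and pq: "[p = 1] (mod q)"
begin

text \<open>Write x = g^i for a primitive root g of order p - 1 = q e. Then x^e = 1 means that q e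
  divides i e, so q divides i and x is a q-th power.\<close>

lemma nonresidue_power:
  assumes x: "\<not> int p dvd x" and nr: "x mod int p \<notin> residue_powers p q"
  shows "\<not> [x ^ ((p - 1) div q) = 1] (mod int p)"
proof
  assume *: "[x ^ ((p - 1) div q) = 1] (mod int p)"
  obtain g :: nat where g: "coprime p g" "ord p g = p - 1"
    and gen: "\<And>x. \<not> int p dvd x \<Longrightarrow> \<exists>i. [x = int g ^ i] (mod int p)" using ex_generator[OF p] by blast
  obtain i where i: "[x = int g ^ i] (mod int p)" using gen[OF x] by blast
  define e where "e = (p - 1) div q"
  have e: "p - 1 = q * e" using cong_to_1_nat[OF pq] by (simp add: e_def)
  then have e0: "e > 0" using prime_gt_1_nat[OF p] by (cases "e = 0") auto
  have "[(int g ^ i) ^ e = x ^ e] (mod int p)" by (rule cong_pow[OF cong_sym[OF i]])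
  then have "[(int g ^ i) ^ e = 1] (mod int p)" using *[folded e_def] by (rule cong_trans)
  then have "[int (g ^ (i * e)) = int 1] (mod int p)" by (simp add: power_mult)
  then have "[g ^ (i * e) = 1] (mod p)" by (simp only: cong_int_iff)
  then have "q * e dvd i * e" using ord_divides g(2) e by metis
  then have "q dvd i" using e0 by simp
  then obtain j where j: "i = j * q" by (metis dvd_def mult.commute)
  have "\<not> int p dvd int g ^ j"
  proof
    assume "int p dvd int g ^ j"
    then have "p dvd g ^ j" by (metis of_nat_dvd_iff of_nat_power)
    then have "p dvd g" using p prime_dvd_power by blast
    then show False using g(1) p by (metis coprime_absorb_left not_prime_unit)
  qed
  then have "(int g ^ j) ^ q mod int p \<in> residue_powers p q" by (rule mem_residue_powers[OF p])
  moreover have "(int g ^ j) ^ q mod int p = x mod int p"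
    using i unfolding cong_def j power_mult by simp
  ultimately show False using nr by simp
qed

text \<open>A primitive root g is such a class: g = x^q would give g^e = x^(p-1) = 1 with e = (p -
  1) / q smaller than the order p - 1.\<close>

lemma ex_nonresidue: "\<exists>x::int. \<not> int p dvd x \<and> x mod int p \<notin> residue_powers p q"
proof -
  obtain g :: nat where g: "coprime p g" "ord p g = p - 1" using ex_generator[OF p] by blast
  define e where "e = (p - 1) div q"
  have e: "p - 1 = q * e" using cong_to_1_nat[OF pq] by (simp add: e_def)
  then have e0: "e > 0" using prime_gt_1_nat[OF p] by (cases "e = 0") auto
  have pg: "\<not> p dvd g" using g(1) p by (metis coprime_absorb_left not_prime_unit)
  have "int g mod int p \<notin> residue_powers p q"
  proof
    assume "int g mod int p \<in> residue_powers p q"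
    then obtain x where x: "\<not> int p dvd x" "[int g mod int p = x ^ q] (mod int p)"
      using residue_powers_cong[OF p] by blast
    have pint: "Factorial_Ring.prime (int p)" using p by simp
    have "coprime x (int p)" using x(1) pint by (metis coprime_commute prime_imp_coprime)
    then have fermat: "[x ^ (p - 1) = 1] (mod int p)"
      using residues.euler_theorem[of "int p" x] prime_gt_1_nat[OF p] totient_prime[OF p]
      by (simp add: residues_def)
    have "[int g ^ e = (x ^ q) ^ e] (mod int p)" using x(2) by (intro cong_pow) (simp add: cong_def)
    then have "[int (g ^ e) = int 1] (mod int p)"
      using fermat cong_trans unfolding e power_mult by (simp add: cong_def)
    then have "[g ^ e = 1] (mod p)" by (simp only: cong_int_iff)
    then have "q * e dvd e" using ord_divides g(2) e by metis
    then have "q * e \<le> e" using e0 by (intro dvd_imp_le)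
    then show False using e0 prime_gt_1_nat[OF q] by simp
  qed
  then show ?thesis using pg by (intro exI[of _ "int g"]) simp
qed

end

section \<open>Polynomials with many roots modulo a prime\<close>

text \<open>Lagrange's bound on the number of roots over the field with \<open>r\<close> elements:
  synthetic division splits off one root, and primality of \<open>r\<close> passes the others on to
  the quotient.\<close>

lemma coeffs_dvd_of_roots:
  fixes F :: "int poly" and r :: int
  assumes r: "Factorial_Ring.prime r"
  shows "\<lbrakk>finite R; degree F < card R; \<forall>x\<in>R. r dvd poly F x; \<forall>x\<in>R. \<forall>y\<in>R. r dvd x - y \<longrightarrow> x = y\<rbrakk>
    \<Longrightarrow> r dvd coeff F i"
proof (induction "degree F" arbitrary: F R i)
  case 0
  then obtain x where x: "x \<in> R" by (metis card.empty ex_in_conv less_irrefl)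
  obtain c where c: "F = [:c:]" using 0(1) degree_eq_zeroE by metis
  have "r dvd c" using 0(4) x c by auto
  then show ?case by (auto simp: c coeff_pCons split: nat.splits)
next
  case (Suc d)
  then obtain x where x: "x \<in> R" by (metis card.empty ex_in_conv not_less_zero)
  define G where "G = synthetic_div F x"
  have FG: "F = [:- x, 1:] * G + [:poly F x:]" unfolding G_def by (rule synthetic_div_correct'[symmetric])
  have deg: "d = degree G" using Suc(2) by (simp add: G_def degree_synthetic_div)
  have "r dvd poly G y" if y: "y \<in> R - {x}" for y
  proof -
    have "poly F y = (y - x) * poly G y + poly F x" by (subst FG) (simp add: algebra_simps)
    then have "(y - x) * poly G y = poly F y - poly F x" by simp
    then have "r dvd (y - x) * poly G y" using Suc.prems(3) y x by simp
    moreover have "\<not> r dvd y - x" using Suc.prems(4) y x by auto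
    ultimately show ?thesis using r by (simp add: prime_dvd_mult_iff)
  qed
  moreover have "degree G < card (R - {x})" using Suc(2) Suc.prems(1,2) x deg by simp
  ultimately have IH: "r dvd coeff G j" for j
    using Suc.hyps(1)[OF deg, of "R - {x}"] Suc.prems(1,4) by auto
  have "coeff F i = (if i = 0 then 0 else coeff G (i - 1)) - x * coeff G i + (if i = 0 then poly F x else 0)"
    by (subst FG) (auto simp: coeff_pCons split: nat.splits)
  then show ?case using IH Suc.prems(3) x by (auto intro!: dvd_add dvd_diff)
qed

text \<open>Each step uses y^p - 1 = (y - 1)(1 + y + ... + y^(p-1)): for y = 1 modulo p the second
  factor is a sum of p ones modulo p. This drives the convergence of the Teichmueller
  sequences.\<close>

lemma power_prime_power_cong_1:
  fixes x :: int
  assumes x: "[x = 1] (mod int p)" shows "int p ^ Suc n dvd x ^ (p ^ n) - 1"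
proof (induction n)
  case 0
  then show ?case using x by (simp add: cong_iff_dvd_diff)
next
  case (Suc n)
  let ?y = "x ^ (p ^ n)"
  have y: "[?y = 1] (mod int p)" using cong_pow[OF x, of "p ^ n"] by simp
  have "[(\<Sum>i<p. ?y ^ i) = (\<Sum>i<p. 1)] (mod int p)"
    using cong_pow[OF y] by (intro cong_sum) simp
  then have "int p dvd (\<Sum>i<p. ?y ^ i)" by (simp add: cong_dvd_iff)
  then have "int p ^ Suc n * int p dvd (?y - 1) * (\<Sum>i<p. ?y ^ i)" using Suc by (rule mult_dvd_mono[rotated])
  also have "(?y - 1) * (\<Sum>i<p. ?y ^ i) = ?y ^ p - 1" by (rule power_diff_1_eq[symmetric])
  finally show ?case by (simp flip: power_mult add: mult.commute)
qed

section \<open>Cyclotomic fields\<close>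

abbreviation "CR \<equiv> (ring_of_type_algebra :: complex ring)"

lemma CR_simps: "carrier CR = UNIV" "x \<otimes>\<^bsub>CR\<^esub> y = x * y" "x \<oplus>\<^bsub>CR\<^esub> y = x + y" "\<one>\<^bsub>CR\<^esub> = 1" "\<zero>\<^bsub>CR\<^esub> = 0"
  by (simp_all add: ring_of_type_algebra_def)

lemma field_CR: "field CR"
  by (rule field_from_type_algebra)

lemma CR_uminus: "\<ominus>\<^bsub>CR\<^esub> x = - x"
proof -
  interpret CR: field CR by (rule field_CR)
  show ?thesis by (rule CR.minus_equality) (simp_all add: CR_simps)
qed

lemma CR_inverse:
  assumes "x \<noteq> 0" shows "inv\<^bsub>CR\<^esub> x = inverse x"
proof -
  interpret CR: field CR by (rule field_CR)
  show ?thesis using assms CR.comm_inv_char[of x "inverse x"] by (simp add: CR_simps)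
qed

definition ev :: "complex \<Rightarrow> rat poly \<Rightarrow> complex" where
  "ev z f = poly (map_poly of_rat f) z"

lemma ev_0 [simp]: "ev z 0 = 0"
  by (simp add: ev_def)

lemma ev_pCons [simp]: "ev z (pCons c f) = of_rat c + z * ev z f"
  by (simp add: ev_def map_poly_pCons)

lemma ev_add: "ev z (f + g) = ev z f + ev z g"
  by (induction f g rule: poly_induct2) (simp_all add: of_rat_add algebra_simps)

lemma ev_smult: "ev z (smult c f) = of_rat c * ev z f"
  by (induction f) (simp_all add: of_rat_mult algebra_simps)

lemma ev_mult: "ev z (f * g) = ev z f * ev z g"
  by (induction f) (simp_all add: ev_add ev_smult algebra_simps)

lemma ev_1 [simp]: "ev z 1 = 1"
  by (simp add: one_pCons)

lemma ev_uminus: "ev z (- f) = - ev z f"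
  using ev_smult[of z "-1" f] by simp

lemma ev_diff: "ev z (f - g) = ev z f - ev z g"
  using ev_add[of z f "- g"] by (simp add: ev_uminus)

lemma ev_monom: "ev z (monom c k) = of_rat c * z ^ k"
  by (induction k) (simp_all add: monom_0 monom_Suc)

locale minimal_polynomial =
  fixes z :: complex and m :: "rat poly"
  assumes m: "m \<noteq> 0" "ev z m = 0"
    and minimal: "\<And>f. \<lbrakk>f \<noteq> 0; ev z f = 0\<rbrakk> \<Longrightarrow> degree m \<le> degree f"
begin

lemma dvd_of_root:
  assumes "ev z f = 0" shows "m dvd f"
proof -
  have "ev z (f mod m) = 0"
    using assms m by (simp add: ev_diff ev_mult flip: minus_div_mult_eq_mod)
  then have "f mod m = 0"
    using minimal[of "f mod m"] degree_mod_less[OF m(1), of f] by force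
  then show ?thesis by auto
qed

lemma degree_pos: "0 < degree m"
proof (rule ccontr)
  assume "\<not> 0 < degree m"
  then obtain c where "m = [:c:]" using degree_eq_zeroE by auto
  then show False using m by simp
qed

text \<open>Minimality of the degree stands in for irreducibility: if d = gcd(f, m) and m = d e,
  then e vanishes at z, so deg e \<ge> deg m and d is constant. Bezout then yields the
  inverse.\<close>

lemma ex_inverse:
  assumes f: "ev z f \<noteq> 0" shows "\<exists>g. ev z g * ev z f = 1"
proof -
  define d where "d = gcd f m"
  obtain u v where uv: "u * f + v * m = d" unfolding d_def using bezout_coefficients_fst_snd by blast
  have ev_d: "ev z d = ev z u * ev z f" using m by (simp add: ev_add ev_mult flip: uv)
  obtain e where e: "m = d * e" unfolding d_def by (meson dvd_def gcd_dvd2)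
  obtain e' where e': "f = d * e'" unfolding d_def by (meson dvd_def gcd_dvd1)
  have "ev z d \<noteq> 0" using f by (auto simp: e' ev_mult)
  then have "ev z e = 0" using m(2) by (simp add: e ev_mult)
  moreover have "e \<noteq> 0" "d \<noteq> 0" using m(1) e by auto
  ultimately have "degree d = 0" using minimal[of e] degree_mult_eq[of d e] e by simp
  then obtain c where c: "d = [:c:]" using degree_eq_zeroE by blast
  have "ev z (smult (inverse c) u) * ev z f = of_rat (inverse c) * ev z d"
    by (simp add: ev_smult ev_d)
  also have "\<dots> = 1" using c \<open>d \<noteq> 0\<close> by (simp flip: of_rat_mult)
  finally show ?thesis by blast
qed

text \<open>By \<open>ex_inverse\<close> the values of rational polynomials are closed under
  inversion. A map out of the field generated by z can therefore be defined on polynomials.\<close>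

lemma generate_field_subset: "generate_field CR {z} \<subseteq> range (ev z)"
proof
  fix x assume "x \<in> generate_field CR {z}"
  then show "x \<in> range (ev z)"
  proof (induction rule: generate_field.induct)
    case one
    then show ?case by (intro image_eqI[of _ _ 1]) (simp_all add: CR_simps)
  next
    case (incl h)
    then show ?case by (intro image_eqI[of _ _ "[:0, 1:]"]) simp_all
  next
    case (a_inv h)
    then obtain f where "h = ev z f" by blast
    then show ?case by (intro image_eqI[of _ _ "- f"]) (simp_all add: CR_uminus ev_uminus)
  next
    case (m_inv h)
    then obtain f where f: "h = ev z f" by blast
    have "h \<noteq> 0" using m_inv(2) by (simp add: CR_simps)
    then obtain g where "ev z g * h = 1" using ex_inverse f by blast
    then show ?case using \<open>h \<noteq> 0\<close>
      by (intro image_eqI[of _ _ g]) (simp_all add: CR_inverse field_simps)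
  next
    case (eng_add h k)
    then obtain f g where "h = ev z f" "k = ev z g" by blast
    then show ?case by (intro image_eqI[of _ _ "f + g"]) (simp_all add: CR_simps ev_add)
  next
    case (eng_mult h k)
    then obtain f g where "h = ev z f" "k = ev z g" by blast
    then show ?case by (intro image_eqI[of _ _ "f * g"]) (simp_all add: CR_simps ev_mult)
  qed
qed

end

lemma ex_minimal_polynomial:
  assumes "f \<noteq> 0" "ev z f = 0" shows "\<exists>m. minimal_polynomial z m"
proof -
  let ?P = "\<lambda>f. f \<noteq> 0 \<and> ev z f = 0"
  define m where "m = (ARG_MIN degree f. ?P f)"
  have "?P m" unfolding m_def by (rule arg_min_natI[of ?P f]) (use assms in simp)
  moreover have "degree m \<le> degree g" if "?P g" for g
    unfolding m_def by (rule arg_min_nat_le[of ?P, OF that])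
  ultimately show ?thesis by (intro exI[of _ m] minimal_polynomial.intro) auto
qed

lemma field_cyclotomic_field: "field (cyclotomic_field z)"
  unfolding cyclotomic_field_def by (rule field.generate_field_is_field[OF field_CR]) (simp add: CR_simps)

lemma cyclotomic_field_simps:
  "x \<otimes>\<^bsub>cyclotomic_field z\<^esub> y = x * y" "x \<oplus>\<^bsub>cyclotomic_field z\<^esub> y = x + y"
  "\<one>\<^bsub>cyclotomic_field z\<^esub> = 1" "\<zero>\<^bsub>cyclotomic_field z\<^esub> = 0"
  "carrier (cyclotomic_field z) = generate_field CR {z}"
  by (simp_all add: cyclotomic_field_def CR_simps)

lemma cyclotomic_field_pow: "x [^]\<^bsub>cyclotomic_field z\<^esub> (k :: nat) = x ^ k"
  by (induction k) (simp_all add: cyclotomic_field_simps mult.commute nat_pow_def)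

lemma of_nat_mem_cyclotomic_field: "of_nat k \<in> carrier (cyclotomic_field z)"
proof -
  interpret K: field "cyclotomic_field z" by (rule field_cyclotomic_field)
  show ?thesis
  proof (induction k)
    case 0
    then show ?case using K.zero_closed by (simp add: cyclotomic_field_simps)
  next
    case (Suc k)
    then show ?case using K.add.m_closed[OF K.one_closed Suc] by (simp add: cyclotomic_field_simps)
  qed
qed

lemma cyclotomic_field_uminus:
  "x \<in> carrier (cyclotomic_field z) \<Longrightarrow> \<ominus>\<^bsub>cyclotomic_field z\<^esub> x = - x"
proof -
  interpret K: field "cyclotomic_field z" by (rule field_cyclotomic_field)
  assume x: "x \<in> carrier (cyclotomic_field z)"
  have "\<ominus>\<^bsub>cyclotomic_field z\<^esub> x + x = 0" using K.l_neg[OF x] by (simp add: cyclotomic_field_simps)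
  then show ?thesis by (simp add: eq_neg_iff_add_eq_0)
qed

lemma of_int_mem_cyclotomic_field: "of_int k \<in> carrier (cyclotomic_field z)"
proof -
  interpret K: field "cyclotomic_field z" by (rule field_cyclotomic_field)
  show ?thesis
  proof (cases k)
    case (nonneg n)
    then show ?thesis using of_nat_mem_cyclotomic_field[of n z] by simp
  next
    case (neg n)
    then show ?thesis
      using K.a_inv_closed[OF of_nat_mem_cyclotomic_field[of "Suc n" z]]
        cyclotomic_field_uminus[OF of_nat_mem_cyclotomic_field[of "Suc n" z]] by simp
  qed
qed

section \<open>Rational polynomials at p-adic points, and the embedding of the cyclotomic
  field\<close>

context padic
begin

lemma abs_int_power_dvd: "int p ^ k dvd m \<Longrightarrow> N (of_int m) \<le> (1 / p) ^ k"
proof -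
  assume "int p ^ k dvd m"
  then obtain c where "m = int p ^ k * c" by (elim dvdE)
  then have "N (of_int m) = (1 / p) ^ k * N (of_int c)" by (simp add: abs_mult abs_power abs_p)
  also have "\<dots> \<le> (1 / p) ^ k * 1" using abs_int_le_1 by (intro mult_left_mono) auto
  finally show ?thesis by simp
qed

lemma ex_power_less: "0 < e \<Longrightarrow> \<exists>M. (1 / real p) ^ M < e"
  using p_gt_1 by (intro real_arch_pow_inv) auto

text \<open>By the ultrametric inequality a long difference is no larger than the largest of its
  steps, so consecutive differences decide.\<close>

lemma Cauchy_of_steps:
  assumes step: "\<And>n. N (s (Suc n) - s n) \<le> (1 / p) ^ n" shows "padic_Cauchy p s"
  unfolding padic_Cauchy_def
proof (intro allI impI)
  fix e :: real assume "e > 0"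
  then obtain M where M: "(1 / real p) ^ M < e" using ex_power_less by blast
  have from_M: "N (s (M + k) - s M) \<le> (1 / p) ^ M" for k
  proof (induction k)
    case (Suc k)
    have "(1 / real p) ^ (M + k) \<le> (1 / p) ^ M" using p_gt_1 by (intro power_decreasing) auto
    then have "N (s (Suc (M + k)) - s (M + k)) \<le> (1 / p) ^ M" using step[of "M + k"] by linarith
    then have "N ((s (Suc (M + k)) - s (M + k)) + (s (M + k) - s M)) \<le> (1 / p) ^ M"
      using Suc by (rule abs_add_bound)
    then show ?case by simp
  qed simp
  have "N (s i - s j) < e" if "i \<ge> M" "j \<ge> M" for i j
  proof -
    have "N ((s i - s M) - (s j - s M)) \<le> (1 / p) ^ M"
      using from_M[of "i - M"] from_M[of "j - M"] that by (intro abs_diff_bound[of "s i - s M" _ "s j - s M"]) simp_all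
    then show ?thesis using M by simp
  qed
  then show "\<exists>M. \<forall>i\<ge>M. \<forall>j\<ge>M. N (s i - s j) < e" by blast
qed

text \<open>A rational polynomial of small degree cannot vanish at integral \<open>p\<close>-adic points with more
  distinct residues than its degree: after scaling it is integral and nonzero modulo \<open>p\<close>.\<close>

lemma rat_poly_null_at_many_points:
  fixes F :: "rat poly" and r :: "nat \<Rightarrow> nat \<Rightarrow> int" and c :: "nat \<Rightarrow> int"
  assumes deg: "degree F < q"
    and r: "\<And>i n. i < q \<Longrightarrow> [r i n = c i] (mod int p)"
    and distinct: "\<And>i j. \<lbrakk>i < q; j < q; [c i = c j] (mod int p)\<rbrakk> \<Longrightarrow> i = j"
    and null: "\<And>i. i < q \<Longrightarrow> (\<lambda>n. poly F (of_int (r i n))) \<in> padic_null p"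
  shows "F = 0"
proof (rule ccontr)
  assume F: "F \<noteq> 0"
  have "finite ((\<lambda>k. N (coeff F k)) ` {..degree F})" "(\<lambda>k. N (coeff F k)) ` {..degree F} \<noteq> {}" by auto
  then have mem: "Max ((\<lambda>k. N (coeff F k)) ` {..degree F}) \<in> (\<lambda>k. N (coeff F k)) ` {..degree F}"
    and le: "\<forall>k\<in>{..degree F}. N (coeff F k) \<le> Max ((\<lambda>k. N (coeff F k)) ` {..degree F})"
    by (auto intro: Max_in)
  from mem obtain k0 where k0: "Max ((\<lambda>k. N (coeff F k)) ` {..degree F}) = N (coeff F k0)" by (rule imageE)
  \<comment> \<open>Dividing by a coefficient of largest size makes all coefficients integral, with
    the one at \<open>k0\<close> equal to 1.\<close>
  define a where "a = coeff F k0"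
  have le_a: "N (coeff F k) \<le> N a" for k
    using le unfolding k0 a_def by (cases "k \<le> degree F") (auto simp: coeff_eq_0)
  have "N (coeff F (degree F)) > 0" using F by (intro abs_pos) simp
  then have a_pos: "N a > 0" using le_a[of "degree F"] by linarith
  then have a0: "a \<noteq> 0" by auto
  let ?b = "\<lambda>k. coeff F k / a"
  have b1: "N (?b k) \<le> 1" for k using le_a[of k] a_pos by (simp add: abs_divide)
  have "\<exists>f :: nat \<Rightarrow> int. \<forall>k. N (?b k - of_int (f k)) \<le> 1 / p"
    using ex_int_approx[OF b1] by metis
  then obtain f :: "nat \<Rightarrow> int" where f: "\<And>k. N (?b k - of_int (f k)) \<le> 1 / p" by blast
  define G where "G = (\<Sum>k\<le>degree F. monom (f k) k)"
  have coeff_G: "coeff G k = f k" if "k \<le> degree F" for k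
    using that by (simp add: G_def coeff_sum coeff_monom)
  have deg_G: "degree G \<le> degree F"
    unfolding G_def by (intro degree_sum_le) (auto intro: order_trans[OF degree_monom_le])
  have poly_G: "poly G x = (\<Sum>k\<le>degree F. f k * x ^ k)" for x
    by (simp add: G_def poly_sum poly_monom)
  have p1: "1 / real p < 1" using p_gt_1 by simp
  have root: "int p dvd poly G (c i)" if i: "i < q" for i
  proof -
    \<comment> \<open>At this index the null sequence has dropped below the scaling factor, so the
      scaled value is a nonunit.\<close>
    obtain n where n: "N (poly F (of_int (r i n))) < N a"
      using null[OF i] a_pos unfolding null_iff by blast
    let ?x = "of_int (r i n) :: rat"
    have "poly F ?x / a = (\<Sum>k\<le>degree F. ?b k * ?x ^ k)"
      by (simp add: poly_altdef sum_divide_distrib)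
    then have "poly F ?x / a - of_int (poly G (r i n)) = (\<Sum>k\<le>degree F. (?b k - of_int (f k)) * ?x ^ k)"
      by (simp add: poly_G left_diff_distrib sum_subtractf)
    also have "N \<dots> \<le> 1 / p"
    proof (rule abs_sum_bound)
      fix k
      have "N (?x ^ k) \<le> 1" using abs_int_le_1[of "r i n ^ k"] by simp
      then have "N (?b k - of_int (f k)) * N (?x ^ k) \<le> 1 / p * 1"
        using f by (intro mult_mono) auto
      then show "N ((?b k - of_int (f k)) * ?x ^ k) \<le> 1 / p" by (simp add: abs_mult)
    qed simp
    finally have d: "N (poly F ?x / a - of_int (poly G (r i n))) \<le> 1 / p" .
    have "N (poly F ?x / a) < 1" using n a_pos by (simp add: abs_divide)
    then have u: "N (poly F ?x / a) \<le> 1 / p" by (rule abs_less_1)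
    have "N (poly F ?x / a - (poly F ?x / a - of_int (poly G (r i n)))) \<le> 1 / p"
      by (rule abs_diff_bound[OF u d])
    then have "N (of_int (poly G (r i n))) < 1" using p1 by simp
    then have "int p dvd poly G (r i n)" by (simp only: abs_int_less_1_iff)
    moreover have "[poly G (r i n) = poly G (c i)] (mod int p)"
      unfolding poly_G by (intro cong_sum cong_mult cong_pow r i) simp
    ultimately show ?thesis by (simp add: cong_dvd_iff)
  qed
  have inj: "inj_on c {..<q}" using distinct by (auto intro!: inj_onI)
  \<comment> \<open>\<open>f k0\<close> approximates the scaled coefficient 1, so its divisibility
    by p is the contradiction sought.\<close>
  have "int p dvd coeff G k0"
  proof (rule coeffs_dvd_of_roots[OF prime_int_p])
    show "finite (c ` {..<q})" by simp
    show "degree G < card (c ` {..<q})" using deg deg_G by (simp add: card_image[OF inj])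
    show "\<forall>x\<in>c ` {..<q}. int p dvd poly G x" using root by auto
    show "\<forall>x\<in>c ` {..<q}. \<forall>y\<in>c ` {..<q}. int p dvd x - y \<longrightarrow> x = y"
      using distinct by (auto simp: cong_iff_dvd_diff)
  qed
  moreover have "k0 \<le> degree F" using a0 unfolding a_def by (rule le_degree)
  ultimately have "N (of_int (f k0)) < 1" by (simp add: abs_int_less_1_iff coeff_G)
  moreover have "N (1 - of_int (f k0)) \<le> 1 / p" using f[of k0] a0 by (simp add: a_def)
  then have "N (of_int (f k0)) = N 1" using p1 by (intro abs_eq_of_close) simp
  ultimately show False by simp
qed

definition eval :: "(nat \<Rightarrow> rat) \<Rightarrow> rat poly \<Rightarrow> (nat \<Rightarrow> rat) set" where
  "eval s f = \<pi> (\<lambda>n. poly f (s n))"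

lemma Cauchy_poly: "padic_Cauchy p s \<Longrightarrow> padic_Cauchy p (\<lambda>n. poly f (s n))"
  by (induction f) (auto intro: Cauchy_const Cauchy_add Cauchy_mult)

lemma eval_hom:
  assumes "padic_Cauchy p s"
  shows "eval s f \<in> carrier Qp" "eval s (f + g) = eval s f \<oplus>\<^bsub>Qp\<^esub> eval s g"
    "eval s (f * g) = eval s f \<otimes>\<^bsub>Qp\<^esub> eval s g" "eval s 1 = \<one>\<^bsub>Qp\<^esub>"
  using Cauchy_poly[OF assms] by (simp_all add: eval_def pi_add pi_mult pi_one)

lemma eval_eq_iff:
  assumes "padic_Cauchy p s"
  shows "eval s f = eval s g \<longleftrightarrow> eval s (f - g) = \<zero>\<^bsub>Qp\<^esub>"
  using pi_eq_iff[OF Cauchy_poly Cauchy_poly, OF assms assms, of f g]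
    pi_eq_zero_iff[OF Cauchy_poly, OF assms, of "f - g"]
  unfolding eval_def poly_diff by simp

end

text \<open>
  The minimal polynomial of \<open>\<xi>\<close> divides \<open>X\<^sup>q - 1\<close>, which has \<open>q\<close> roots in \<open>\<rat>\<^sub>p\<close>, the Teichmueller
  lifts; so it has one of them as a root, and \<open>\<xi>\<close> can be mapped to this root.
\<close>

lemma ex_cyclotomic_hom:
  assumes p: "Factorial_Ring.prime p" and q: "Factorial_Ring.prime q" and pq: "[p = 1] (mod q)"
    and \<xi>: "\<xi> ^ q = 1"
  shows "\<exists>\<iota>. \<iota> \<in> ring_hom (cyclotomic_field \<xi>) (padic_field p)"
proof -
  interpret padic p by (rule padic.intro[OF p])
  interpret Q: field Qp by (rule field_Qp)
  obtain g :: nat where g: "coprime p g" "ord p g = p - 1" using ex_generator[OF p] by blast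
  define u where "u = (p - 1) div q"
  have u: "p - 1 = q * u" using cong_to_1_nat[OF pq] by (simp add: u_def)
  then have u0: "u > 0" using p_gt_1 by (cases "u = 0") auto
  \<comment> \<open>\<open>t\<close> has order exactly \<open>q\<close> modulo p, so the t^i with i
    < q are the distinct q-th roots of unity modulo p.\<close>
  define t where "t = int (g ^ u)"
  \<comment> \<open>For fixed \<open>i\<close> this sequence converges to the Teichmueller lift of
    t^i.\<close>
  define r where "r i n = (t ^ i) ^ (p ^ n)" for i n
  have tq: "[t ^ q = 1] (mod int p)"
  proof -
    have "[g ^ (p - 1) = 1] (mod p)" using ord_divides[of g "p - 1" p] g(2) by simp
    then have "[int (g ^ (p - 1)) = int 1] (mod int p)" by (simp only: cong_int_iff)
    then have "[int g ^ (u * q) = 1] (mod int p)" unfolding u by (simp add: mult.commute)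
    then show ?thesis by (simp add: t_def power_mult)
  qed
  have distinct: "i = j" if ij: "i < q" "j < q" "[t ^ i = t ^ j] (mod int p)" for i j
  proof -
    have "[g ^ (u * i) = g ^ (u * j)] (mod p)"
    proof -
      have "[int (g ^ (u * i)) = int (g ^ (u * j))] (mod int p)"
        using ij(3) unfolding t_def by (simp add: power_mult)
      then show ?thesis by (simp only: cong_int_iff)
    qed
    then have "[u * i = u * j] (mod (p - 1))"
      using order_divides_expdiff[of p g "u * i" "u * j"] g by simp
    then have "(u * i) mod (u * q) = (u * j) mod (u * q)" unfolding cong_def u by (simp only: mult.commute)
    moreover have "u * i < u * q" "u * j < u * q" using ij u0 by simp_all
    ultimately show ?thesis using u0 ij by simp
  qed
  have tiq: "[(t ^ i) ^ q = 1] (mod int p)" for i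
    using cong_pow[OF tq, of i] by (simp add: mult.commute flip: power_mult)
  have dvd: "int p ^ Suc n dvd r i n ^ q - 1" for i n
  proof -
    have eq: "r i n ^ q = ((t ^ i) ^ q) ^ (p ^ n)"
      by (simp only: r_def power_mult[symmetric] ac_simps)
    show ?thesis unfolding eq by (rule power_prime_power_cong_1[OF tiq])
  qed
  \<comment> \<open>Since p - 1 = q u, passing from the exponent p^n to p^(n+1) multiplies
    \<open>r i n\<close> by \<open>(r i n ^ q) ^ u\<close>, which is 1 modulo p^(n+1).\<close>
  have dvd': "int p ^ Suc n dvd r i (Suc n) - r i n" for i n
  proof -
    have p_eq: "p = Suc (q * u)" using u prime_gt_1_nat[OF p] by linarith
    have "p ^ Suc n = p ^ n * p" by simp
    also have "\<dots> = p ^ n * Suc (q * u)" by (simp only: p_eq[symmetric])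
    also have "\<dots> = p ^ n + p ^ n * (q * u)" by simp
    finally have exponent: "p ^ Suc n = p ^ n + p ^ n * (q * u)" .
    have eq: "r i (Suc n) - r i n = r i n * ((r i n ^ q) ^ u - 1)"
      unfolding r_def exponent by (simp only: power_add power_mult right_diff_distrib mult_1_right)
    have "r i n ^ q - 1 dvd (r i n ^ q) ^ u - 1"
      unfolding power_diff_1_eq[of "r i n ^ q" u] by (rule dvd_triv_left)
    then have "int p ^ Suc n dvd (r i n ^ q) ^ u - 1" by (rule dvd_trans[OF dvd])
    then show ?thesis unfolding eq by (rule dvd_mult)
  qed
  have Cauchy: "padic_Cauchy p (\<lambda>n. of_int (r i n))" for i
  proof (rule Cauchy_of_steps)
    fix n
    have "N (of_int (r i (Suc n) - r i n)) \<le> (1 / p) ^ Suc n" by (rule abs_int_power_dvd[OF dvd'])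
    also have "\<dots> \<le> (1 / p) ^ n" using p_gt_1 by (intro power_decreasing) auto
    finally show "N (of_int (r i (Suc n)) - of_int (r i n)) \<le> (1 / p) ^ n" by simp
  qed
  define E where "E i = eval (\<lambda>n. of_int (r i n))" for i
  note E_hom = eval_hom[OF Cauchy, folded E_def]
  have root_q: "E i (monom 1 q - 1) = \<zero>\<^bsub>Qp\<^esub>" for i
  proof -
    have "(\<lambda>n. of_int (r i n) ^ q - 1 :: rat) \<in> padic_null p"
      unfolding null_iff
    proof (intro allI impI)
      fix e :: real assume "e > 0"
      then obtain M where M: "(1 / real p) ^ M < e" using ex_power_less by blast
      have "N (of_int (r i n) ^ q - 1) < e" if "n \<ge> M" for n
      proof -
        have "N (of_int (r i n ^ q - 1)) \<le> (1 / p) ^ Suc n" by (rule abs_int_power_dvd[OF dvd])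
        also have "\<dots> \<le> (1 / p) ^ M" using that p_gt_1 by (intro power_decreasing) auto
        finally show ?thesis using M by simp
      qed
      then show "\<exists>M. \<forall>n\<ge>M. N (of_int (r i n) ^ q - 1) < e" by blast
    qed
    then show ?thesis
      using pi_eq_zero_iff[OF Cauchy_poly[OF Cauchy[of i], of "monom 1 q - 1"]]
      by (simp add: E_def eval_def poly_monom)
  qed
  have q0: "0 < q" using prime_gt_0_nat[OF q] .
  have deg_q: "degree (monom 1 q - 1 :: rat poly) = q"
  proof -
    have "degree (monom 1 q + - 1 :: rat poly) = degree (monom 1 q :: rat poly)"
      using q0 by (intro degree_add_eq_left) (simp add: degree_monom_eq)
    then show ?thesis by (simp add: degree_monom_eq)
  qed
  have nz: "monom 1 q - 1 \<noteq> (0 :: rat poly)" using deg_q q0 by auto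
  have ev0: "ev \<xi> (monom 1 q - 1) = 0" using \<xi> by (simp add: ev_diff ev_monom)
  obtain m where "minimal_polynomial \<xi> m" using ex_minimal_polynomial[OF nz ev0] by blast
  then interpret m: minimal_polynomial \<xi> m .
  obtain h where h: "monom 1 q - 1 = m * h" using m.dvd_of_root[OF ev0] by (elim dvdE)
  have h0: "h \<noteq> 0" using h nz by auto
  have "degree h < q"
    using degree_mult_eq[OF m.m(1) h0] m.degree_pos deg_q h by simp
  \<comment> \<open>Otherwise each of the \<open>q\<close> lifts would be a root of the cofactor
    \<open>h\<close>, whose degree is less than \<open>q\<close>.\<close>
  have "\<exists>i. E i m = \<zero>\<^bsub>Qp\<^esub>"
  proof (rule ccontr)
    assume none: "\<not> ?thesis"
    have "E i h = \<zero>\<^bsub>Qp\<^esub>" for i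
    proof -
      have "E i m \<otimes>\<^bsub>Qp\<^esub> E i h = \<zero>\<^bsub>Qp\<^esub>"
        using root_q[of i] unfolding h E_hom(3) .
      then have "E i m = \<zero>\<^bsub>Qp\<^esub> \<or> E i h = \<zero>\<^bsub>Qp\<^esub>" by (rule Q.integral[OF _ E_hom(1) E_hom(1)])
      then show ?thesis using none by blast
    qed
    then have null: "(\<lambda>n. poly h (of_int (r i n))) \<in> padic_null p" for i
      using pi_eq_zero_iff[OF Cauchy_poly[OF Cauchy[of i], of h]] unfolding E_def eval_def by blast
    have rc: "[r i n = t ^ i] (mod int p)" for i n
    proof (induction n)
      case 0
      then show ?case by (simp add: r_def)
    next
      case (Suc n)
      have "int p dvd int p ^ Suc n" by simp
      then have "int p dvd r i (Suc n) - r i n" using dvd' by (rule dvd_trans)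
      then have "[r i (Suc n) = r i n] (mod int p)" by (simp only: cong_iff_dvd_diff)
      then show ?case using Suc by (rule cong_trans)
    qed
    have "h = 0"
    proof (rule rat_poly_null_at_many_points[where r = r and c = "\<lambda>i. t ^ i", OF \<open>degree h < q\<close>])
      show "[r i n = t ^ i] (mod int p)" for i n by (rule rc)
      show "i = j" if "i < q" "j < q" "[t ^ i = t ^ j] (mod int p)" for i j using that by (rule distinct)
      show "(\<lambda>n. poly h (of_int (r i n))) \<in> padic_null p" for i by (rule null)
    qed
    then show False using h0 by simp
  qed
  then obtain i where i: "E i m = \<zero>\<^bsub>Qp\<^esub>" by blast
  have E_ker: "E i f = \<zero>\<^bsub>Qp\<^esub>" if "ev \<xi> f = 0" for f
  proof -
    obtain c where c: "f = m * c" using m.dvd_of_root[OF \<open>ev \<xi> f = 0\<close>] by (elim dvdE)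
    show ?thesis unfolding c E_hom(3) i by (rule Qp.l_null[OF E_hom(1)])
  qed
  \<comment> \<open>The choice of polynomial is harmless: two candidates differ by a multiple of
    \<open>m\<close>, which \<open>E i\<close> annihilates.\<close>
  define \<iota> where "\<iota> z = E i (SOME f. ev \<xi> f = z)" for z
  have \<iota>: "\<iota> (ev \<xi> f) = E i f" for f
  proof -
    have "ev \<xi> (SOME f'. ev \<xi> f' = ev \<xi> f) = ev \<xi> f" by (rule someI) simp
    then have "ev \<xi> ((SOME f'. ev \<xi> f' = ev \<xi> f) - f) = 0" by (simp add: ev_diff)
    then show ?thesis using E_ker eval_eq_iff[OF Cauchy] unfolding \<iota>_def E_def by blast
  qed
  have range: "\<exists>f. z = ev \<xi> f" if "z \<in> carrier (cyclotomic_field \<xi>)" for z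
    using that m.generate_field_subset unfolding cyclotomic_field_simps(5) by blast
  have "\<iota> \<in> ring_hom (cyclotomic_field \<xi>) Qp"
  proof (rule ring_hom_memI)
    show "\<iota> \<one>\<^bsub>cyclotomic_field \<xi>\<^esub> = \<one>\<^bsub>Qp\<^esub>"
      using \<iota>[of 1] E_hom(4) by (simp add: cyclotomic_field_simps)
    fix z y assume "z \<in> carrier (cyclotomic_field \<xi>)" "y \<in> carrier (cyclotomic_field \<xi>)"
    then obtain f g where fg: "z = ev \<xi> f" "y = ev \<xi> g" using range by blast
    show "\<iota> z \<in> carrier Qp" unfolding fg \<iota> by (rule E_hom(1))
    show "\<iota> (z \<otimes>\<^bsub>cyclotomic_field \<xi>\<^esub> y) = \<iota> z \<otimes>\<^bsub>Qp\<^esub> \<iota> y"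
      unfolding fg cyclotomic_field_simps ev_mult[symmetric] \<iota> by (rule E_hom(3))
    show "\<iota> (z \<oplus>\<^bsub>cyclotomic_field \<xi>\<^esub> y) = \<iota> z \<oplus>\<^bsub>Qp\<^esub> \<iota> y"
      unfolding fg cyclotomic_field_simps ev_add[symmetric] \<iota> by (rule E_hom(2))
  qed
  then show ?thesis by blast
qed

text \<open>As for the presented algebra, homomorphisms run both ways: \<open>h\<close> maps the
  model over \<open>L\<close> onto the extension and carries inverses along, and \<open>k\<close>
  back into the model shows that the extension is not zero.\<close>

theorem division_scalar_extension:
  fixes K :: "('k, 'u) ring_scheme" and L :: "('l, 'v) ring_scheme"
  assumes K: "symbol_data K n \<omega> a b" and L: "symbol_data L n (\<iota> \<omega>) (\<iota> a) (\<iota> b)"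
    and \<iota>: "\<iota> \<in> ring_hom K L" and field: "field L"
    and T: "Units (symbol_model L n (\<iota> \<omega>) (\<iota> a) (\<iota> b)) =
      carrier (symbol_model L n (\<iota> \<omega>) (\<iota> a) (\<iota> b)) - {\<zero>\<^bsub>symbol_model L n (\<iota> \<omega>) (\<iota> a) (\<iota> b)\<^esub>}"
  shows "division_algebra L (scalar_extension K (symbol_algebra K n \<omega> a b) L \<iota>)"
proof -
  interpret K: symbol_data K n \<omega> a b by (rule K)
  interpret L: symbol_data L n "\<iota> \<omega>" "\<iota> a" "\<iota> b" by (rule L)
  have smult: "k \<odot>\<^bsub>K.A\<^esub> u = K.scalar_A k \<otimes>\<^bsub>K.A\<^esub> u" if "k \<in> carrier K" for k u
    unfolding K.smult_one_W[OF that, symmetric] by (simp add: symbol_algebra_def quot_algebra_def)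
  have scalar_closed: "K.scalar_A k \<in> carrier K.A" if "k \<in> carrier K" for k
    by (rule central_homD(3)[OF K.central_hom_scalar_A that])
  have bc: "base_change K K.A L \<iota>"
  proof (intro base_change.intro base_change_axioms.intro K.A.ring_axioms L.R.cring_axioms)
    show "k \<odot>\<^bsub>K.A\<^esub> u \<in> carrier K.A" if "k \<in> carrier K" "u \<in> carrier K.A" for k u
      unfolding smult[OF that(1)] by (rule K.A.m_closed[OF scalar_closed[OF that(1)] that(2)])
  qed (rule ring_hom_closed[OF \<iota>])
  interpret BC: base_change K K.A L \<iota> by (rule bc)
  let ?t = "\<lambda>u l. BC.t u l"
  have \<eta>: "central_hom L BC.E (\<lambda>l. ?t \<one>\<^bsub>K.A\<^esub> l)"
    using central_hom_base_change[OF bc] unfolding BC.single_int .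
  have j_closed: "?t u \<one>\<^bsub>L\<^esub> \<in> carrier BC.E" if "u \<in> carrier K.A" for u
    by (rule BC.t_closed[OF that L.R.one_closed])
  have j_mult: "?t (u \<otimes>\<^bsub>K.A\<^esub> v) \<one>\<^bsub>L\<^esub> = ?t u \<one>\<^bsub>L\<^esub> \<otimes>\<^bsub>BC.E\<^esub> ?t v \<one>\<^bsub>L\<^esub>"
    if "u \<in> carrier K.A" "v \<in> carrier K.A" for u v
    unfolding BC.t_mult[OF that(1) L.R.one_closed that(2) L.R.one_closed] L.R.l_one[OF L.R.one_closed] ..
  have j_pow: "?t u \<one>\<^bsub>L\<^esub> [^]\<^bsub>BC.E\<^esub> (k :: nat) = ?t (u [^]\<^bsub>K.A\<^esub> k) \<one>\<^bsub>L\<^esub>" if "u \<in> carrier K.A" for u k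
  proof (induction k)
    case 0
    show ?case unfolding K.A.nat_pow_0 BC.E.nat_pow_0 by (rule BC.t_one[symmetric])
  next
    case (Suc k)
    show ?case unfolding K.A.nat_pow_Suc BC.E.nat_pow_Suc Suc
      by (rule j_mult[symmetric, OF K.A.nat_pow_closed[OF that] that])
  qed
  have j_scalar: "?t (K.scalar_A k) \<one>\<^bsub>L\<^esub> = ?t \<one>\<^bsub>K.A\<^esub> (\<iota> k)" if k: "k \<in> carrier K" for k
  proof -
    have "K.scalar_A k = k \<odot>\<^bsub>K.A\<^esub> \<one>\<^bsub>K.A\<^esub>"
      unfolding smult[OF k] by (rule K.A.r_one[symmetric, OF scalar_closed[OF k]])
    then show ?thesis
      using BC.t_smult[OF k K.A.one_closed L.R.one_closed] L.R.r_one[OF ring_hom_closed[OF \<iota> k]] by (simp only:)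
  qed
  have rel: "K.x_A \<in> carrier K.A" "K.y_A \<in> carrier K.A"
      "K.x_A [^]\<^bsub>K.A\<^esub> n = K.scalar_A a" "K.y_A [^]\<^bsub>K.A\<^esub> n = K.scalar_A b"
      "K.y_A \<otimes>\<^bsub>K.A\<^esub> K.x_A = K.scalar_A \<omega> \<otimes>\<^bsub>K.A\<^esub> (K.x_A \<otimes>\<^bsub>K.A\<^esub> K.y_A)"
    using K.symbol_relations_A unfolding symbol_relations_def by blast+
  note xy = K.A.m_closed[OF rel(1,2)]
  \<comment> \<open>x \<otimes> 1 and y \<otimes> 1 satisfy the relations over \<open>L\<close>,
    because c \<otimes> 1 = 1 \<otimes> \<iota> c turns scalars from \<open>K\<close> into scalars
    from \<open>L\<close>.\<close>
  have "symbol_relations L BC.E (\<lambda>l. ?t \<one>\<^bsub>K.A\<^esub> l) n (\<iota> \<omega>) (\<iota> a) (\<iota> b) (?t K.x_A \<one>\<^bsub>L\<^esub>) (?t K.y_A \<one>\<^bsub>L\<^esub>)"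
    unfolding symbol_relations_def j_pow[OF rel(1)] j_pow[OF rel(2)] rel(3,4)
      j_scalar[OF K.parameters_closed(1), symmetric] j_mult[OF rel(1,2), symmetric] j_mult[OF rel(2,1), symmetric]
      j_mult[OF scalar_closed[OF K.parameters_closed(1)] xy, symmetric] rel(5)
    by (intro conjI j_closed rel(1,2) j_scalar K.parameters_closed refl)
  from L.model_onto_algebra[OF BC.E.ring_axioms \<eta> this]
  obtain h where h: "h \<in> ring_hom L.T BC.E"
    and h_scalar: "\<And>l. l \<in> carrier L \<Longrightarrow> h (L.scalar l) = ?t \<one>\<^bsub>K.A\<^esub> l"
    and h_x: "h L.gen_x = ?t K.x_A \<one>\<^bsub>L\<^esub>" and h_y: "h L.gen_y = ?t K.y_A \<one>\<^bsub>L\<^esub>" by blast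
  have one_n: "(0, 0) \<in> carrier (residue_square n)" "(Suc 0, 0) \<in> carrier (residue_square n)"
    "(0, Suc 0) \<in> carrier (residue_square n)" using L.n by auto
  let ?im = "h ` carrier L.T"
  have im_scalar: "?t \<one>\<^bsub>K.A\<^esub> l \<in> ?im" if "l \<in> carrier L" for l
    unfolding h_scalar[OF that, symmetric] by (rule imageI[OF L.T.monomial_closed[OF that one_n(1)]])
  have im_mult: "u \<otimes>\<^bsub>BC.E\<^esub> v \<in> ?im" if "u \<in> ?im" "v \<in> ?im" for u v
  proof -
    from that(1) obtain u' where u: "u = h u'" "u' \<in> carrier L.T" by (rule imageE)
    from that(2) obtain v' where v: "v = h v'" "v' \<in> carrier L.T" by (rule imageE)
    show ?thesis unfolding u(1) v(1) ring_hom_mult[OF h u(2) v(2), symmetric]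
      by (rule imageI[OF L.T.P.m_closed[OF u(2) v(2)]])
  qed
  have im_add: "u \<oplus>\<^bsub>BC.E\<^esub> v \<in> ?im" if "u \<in> ?im" "v \<in> ?im" for u v
  proof -
    from that(1) obtain u' where u: "u = h u'" "u' \<in> carrier L.T" by (rule imageE)
    from that(2) obtain v' where v: "v = h v'" "v' \<in> carrier L.T" by (rule imageE)
    show ?thesis unfolding u(1) v(1) ring_hom_add[OF h u(2) v(2), symmetric]
      by (rule imageI[OF ring.ring_simprules(1)[OF L.T.ring u(2) v(2)]])
  qed
  have im_j: "?t u \<one>\<^bsub>L\<^esub> \<in> ?im" if "u \<in> carrier K.A" for u
    using that
  proof (induction u rule: K.symbol_algebra_induct)
    case (scalar r)
    show ?case unfolding j_scalar[OF scalar] by (rule im_scalar[OF ring_hom_closed[OF \<iota> scalar]])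
  next
    case x
    show ?case unfolding h_x[symmetric] by (rule imageI[OF L.T.monomial_closed[OF L.R.one_closed one_n(2)]])
  next
    case y
    show ?case unfolding h_y[symmetric] by (rule imageI[OF L.T.monomial_closed[OF L.R.one_closed one_n(3)]])
  next
    case (add u v)
    show ?case unfolding BC.t_add_left[OF add(1,2) L.R.one_closed] by (rule im_add[OF add(3,4)])
  next
    case (mult u v)
    show ?case unfolding j_mult[OF mult(1,2)] by (rule im_mult[OF mult(3,4)])
  qed
  have surj: "u \<in> ?im" if "u \<in> carrier BC.E" for u
    using that
  proof (induction u rule: BC.base_change_induct)
    case (tensor u l)
    have "?t u l = ?t \<one>\<^bsub>K.A\<^esub> l \<otimes>\<^bsub>BC.E\<^esub> ?t u \<one>\<^bsub>L\<^esub>"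
      unfolding BC.t_mult[OF K.A.one_closed tensor(2) tensor(1) L.R.one_closed]
        K.A.l_one[OF tensor(1)] L.R.r_one[OF tensor(2)] ..
    then show ?case using im_mult[OF im_scalar[OF tensor(2)] im_j[OF tensor(1)]] by (simp only:)
  next
    case (add u v)
    show ?case by (rule im_add[OF add(3,4)])
  next
    case (uminus u)
    then obtain d where d: "d \<in> carrier L.T" "u = h d" by blast
    interpret h: ring_hom_ring L.T BC.E h
      by (rule ring_hom_ringI2[OF L.T.ring BC.E.ring_axioms h])
    show ?case unfolding d(2) h.hom_a_inv[OF d(1), symmetric] by (rule imageI[OF L.T.a_inv_closed[OF d(1)]])
  qed
  have one_T: "\<one>\<^bsub>L.T\<^esub> \<noteq> \<zero>\<^bsub>L.T\<^esub>" using L.T.P.Units_one_closed unfolding T by blast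
  \<comment> \<open>For the way back, the generators of the model over \<open>L\<close> satisfy the
    relations over \<open>K\<close> through \<iota>. This gives \<kappa> on \<open>K.A\<close>,
    which then extends to the tensor product.\<close>
  have \<eta>T: "central_hom K L.T (\<lambda>r. L.scalar (\<iota> r))"
    by (rule central_hom_compose[OF \<iota> L.central_hom_scalar])
  have "symbol_relations K L.T (\<lambda>r. L.scalar (\<iota> r)) n \<omega> a b L.gen_x L.gen_y"
    using L.symbol_relations_model unfolding symbol_relations_def .
  from K.symbol_algebra_universal[OF L.T.ring \<eta>T this]
  obtain \<kappa> where \<kappa>: "\<kappa> \<in> ring_hom K.A L.T"
    and \<kappa>_scalar: "\<And>r. r \<in> carrier K \<Longrightarrow> \<kappa> (K.scalar_A r) = L.scalar (\<iota> r)" by blast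
  have \<kappa>_smult: "\<kappa> (k \<odot>\<^bsub>K.A\<^esub> u) = L.scalar (\<iota> k) \<otimes>\<^bsub>L.T\<^esub> \<kappa> u"
    if "k \<in> carrier K" "u \<in> carrier K.A" for k u
    unfolding smult[OF that(1)] ring_hom_mult[OF \<kappa> scalar_closed[OF that(1)] that(2)] \<kappa>_scalar[OF that(1)] ..
  obtain k where k: "k \<in> ring_hom BC.E L.T"
    using BC.base_change_universal[OF L.T.ring L.central_hom_scalar \<kappa> \<kappa>_smult] by blast
  have one_E: "\<one>\<^bsub>BC.E\<^esub> \<noteq> \<zero>\<^bsub>BC.E\<^esub>"
  proof
    assume "\<one>\<^bsub>BC.E\<^esub> = \<zero>\<^bsub>BC.E\<^esub>"
    from arg_cong[OF this, of k] show False
      unfolding ring_hom_one[OF k] ring_hom_zero[OF k BC.E.ring_axioms L.T.ring] using one_T by contradiction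
  qed
  have units: "Units BC.E = carrier BC.E - {\<zero>\<^bsub>BC.E\<^esub>}"
    by (rule Units_surjective_image[OF L.T.ring T BC.E.ring_axioms one_E h subsetI[OF surj]])
  let ?B = "scalar_extension K K.A L \<iota>"
  have "assoc_algebra L ?B"
    unfolding scalar_extension_def
    by (rule assoc_algebra_quot_algebra[OF L.R.cring_axioms BC.J.is_ideal central_hom_base_change[OF bc]])
  moreover have "Units ?B = carrier ?B - {\<zero>\<^bsub>?B\<^esub>}"
    unfolding scalar_extension_def Units_quot_algebra units by (simp add: quot_algebra_def)
  ultimately show ?thesis using field by (simp add: division_algebra_def)
qed

text \<open>A ring homomorphism is determined on the integers, so every \<iota> sends \<alpha> and p
  to the constant sequences that \<open>symbol_model_integral\<close> expects.\<close>

lemma (in padic) cyclotomic_hom_int: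
  assumes \<iota>: "\<iota> \<in> ring_hom (cyclotomic_field \<xi>) Qp"
  shows "\<iota> (of_int k) = \<pi> (\<lambda>_. of_int k)"
proof -
  interpret K: field "cyclotomic_field \<xi>" by (rule field_cyclotomic_field)
  interpret \<iota>: ring_hom_ring "cyclotomic_field \<xi>" Qp \<iota>
    by (rule ring_hom_ringI2[OF K.ring_axioms Qp.ring_axioms \<iota>])
  have nat: "\<iota> (of_nat m) = \<pi> (\<lambda>_. of_nat m)" for m
  proof (induction m)
    case 0
    have "(\<lambda>_. 0) \<in> padic_null p" by (simp add: null_iff)
    then have "\<pi> (\<lambda>_. 0) = \<zero>\<^bsub>Qp\<^esub>" using pi_eq_zero_iff[OF Cauchy_const] by blast
    moreover have "\<iota> 0 = \<zero>\<^bsub>Qp\<^esub>" using \<iota>.hom_zero by (simp add: cyclotomic_field_simps)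
    ultimately show ?case by simp
  next
    case (Suc m)
    have "\<iota> (1 + of_nat m) = \<iota> 1 \<oplus>\<^bsub>Qp\<^esub> \<iota> (of_nat m)"
      using \<iota>.hom_add[OF K.one_closed of_nat_mem_cyclotomic_field[of m]] by (simp add: cyclotomic_field_simps)
    also have "\<iota> 1 = \<pi> (\<lambda>_. 1)" using \<iota>.hom_one by (simp add: cyclotomic_field_simps pi_one)
    finally show ?case unfolding Suc by (simp add: pi_add Cauchy_const)
  qed
  show ?thesis
  proof (cases k)
    case (nonneg m)
    then show ?thesis using nat by simp
  next
    case (neg m)
    let ?m = "of_nat (Suc m)"
    have "\<iota> (- ?m) = \<ominus>\<^bsub>Qp\<^esub> \<iota> ?m"
      using \<iota>.hom_a_inv[OF of_nat_mem_cyclotomic_field[of "Suc m"]]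
      unfolding cyclotomic_field_uminus[OF of_nat_mem_cyclotomic_field] .
    also have "\<dots> = \<ominus>\<^bsub>Qp\<^esub> \<pi> (\<lambda>_. ?m)" unfolding nat ..
    also have "\<dots> = \<pi> (\<lambda>_. - ?m)"
    proof (rule Qp.minus_equality)
      have "(\<lambda>_. 0) \<in> padic_null p" by (simp add: null_iff)
      then have "\<pi> (\<lambda>_. 0) = \<zero>\<^bsub>Qp\<^esub>" using pi_eq_zero_iff[OF Cauchy_const] by blast
      then show "\<pi> (\<lambda>_. - ?m) \<oplus>\<^bsub>Qp\<^esub> \<pi> (\<lambda>_. ?m) = \<zero>\<^bsub>Qp\<^esub>"
        using pi_add[OF Cauchy_const[of "- ?m"] Cauchy_const[of ?m]] by simp
    qed (simp_all add: Cauchy_const)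
    finally show ?thesis using neg by simp
  qed
qed

theorem theorem3p2:
  fixes p q :: nat and \<xi> :: complex
  assumes "Factorial_Ring.prime p" and "Factorial_Ring.prime q" and "[p = 1] (mod q)"
    and "primitive_root_of_unity q \<xi>"
  defines "K \<equiv> cyclotomic_field \<xi>"
  shows "(\<exists>\<alpha>::int. \<not> int p dvd \<alpha> \<and> \<alpha> mod int p \<notin> residue_powers p q)
    \<and> (\<exists>\<iota>. \<iota> \<in> ring_hom K (padic_field p))
    \<and> (\<forall>\<alpha>::int. \<not> int p dvd \<alpha> \<and> \<alpha> mod int p \<notin> residue_powers p q \<longrightarrow>
         (\<forall>\<iota>\<in>ring_hom K (padic_field p).
            division_algebra (padic_field p)
              (scalar_extension K (symbol_algebra K q \<xi> (of_int \<alpha>) (of_nat p)) (padic_field p) \<iota>))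
         \<and> division_algebra K (symbol_algebra K q \<xi> (of_int \<alpha>) (of_nat p)))"
proof -
  note p = assms(1) and q = assms(2) and pq = assms(3)
  have \<xi>: "\<xi> ^ q = 1" using assms(4) by (simp add: primitive_root_of_unity_def)
  have hom: "\<exists>\<iota>. \<iota> \<in> ring_hom K (padic_field p)"
    unfolding K_def by (rule ex_cyclotomic_hom[OF p q pq \<xi>])
  \<comment> \<open>The claim over \<open>K\<close> is proved through Q_p as well, so both claims
    are derived for a given \<iota>; the existence statement \<open>hom\<close> supplies
    one.\<close>
  have main: "division_algebra (padic_field p)
        (scalar_extension K (symbol_algebra K q \<xi> (of_int \<alpha>) (of_nat p)) (padic_field p) \<iota>)
      \<and> division_algebra K (symbol_algebra K q \<xi> (of_int \<alpha>) (of_nat p))"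
    if \<alpha>: "\<not> int p dvd \<alpha>" "\<alpha> mod int p \<notin> residue_powers p q" and \<iota>: "\<iota> \<in> ring_hom K (padic_field p)"
    for \<alpha> :: int and \<iota>
  proof -
    interpret padic_symbol p q \<alpha>
      by (intro padic_symbol.intro kummer_residue.intro padic.intro p q pq \<alpha>(1)
          nonresidue_power[OF p q pq \<alpha>])
    have field_K: "field K" unfolding K_def by (rule field_cyclotomic_field)
    interpret K: field K by (rule field_K)
    interpret \<iota>: ring_hom_ring K Qp \<iota> by (rule ring_hom_ringI2[OF K.ring_axioms Qp.ring_axioms \<iota>])
    let ?\<alpha> = "of_int \<alpha> :: complex" and ?p = "of_nat p :: complex"
    have mem: "\<xi> \<in> carrier K" "?\<alpha> \<in> carrier K" "?p \<in> carrier K"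
      unfolding K_def by (simp_all add: of_int_mem_cyclotomic_field of_nat_mem_cyclotomic_field)
        (simp add: cyclotomic_field_simps generate_field.incl)
    have pow: "\<xi> [^]\<^bsub>K\<^esub> q = \<one>\<^bsub>K\<^esub>" unfolding K_def cyclotomic_field_pow using \<xi> by (simp add: cyclotomic_field_simps)
    have sd_K: "symbol_data K q \<xi> ?\<alpha> ?p"
      by (intro symbol_data.intro symbol_data_axioms.intro K.cring_axioms mem pow prime_gt_1_nat[OF q])
    have pow': "\<iota> \<xi> [^]\<^bsub>Qp\<^esub> q = \<one>\<^bsub>Qp\<^esub>"
      using \<iota>.hom_nat_pow[OF mem(1), of q] \<iota>.hom_one unfolding pow by simp
    have sd_Q: "symbol_data Qp q (\<iota> \<xi>) (\<iota> ?\<alpha>) (\<iota> ?p)"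
      by (intro symbol_data.intro symbol_data_axioms.intro Qp.cring_axioms \<iota>.hom_closed mem pow' prime_gt_1_nat[OF q])
    have images: "\<iota> ?\<alpha> = \<pi> (\<lambda>_. of_int \<alpha>)" "\<iota> ?p = \<pi> (\<lambda>_. of_nat p)"
      using cyclotomic_hom_int[OF \<iota>[unfolded K_def]] cyclotomic_hom_int[OF \<iota>[unfolded K_def], of "int p"] by simp_all
    note integral_Q = symbol_model_integral[OF sd_Q images]
    have inj: "k = \<zero>\<^bsub>K\<^esub>" if "k \<in> carrier K" "\<iota> k = \<zero>\<^bsub>Qp\<^esub>" for k
    proof (rule ccontr)
      interpret Q: field Qp by (rule field_Qp)
      assume "k \<noteq> \<zero>\<^bsub>K\<^esub>"
      then have k: "k \<in> Units K" using that(1) by (simp add: K.field_Units)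
      have "\<iota> (k \<otimes>\<^bsub>K\<^esub> inv\<^bsub>K\<^esub> k) = \<zero>\<^bsub>Qp\<^esub>"
        unfolding \<iota>.hom_mult[OF that(1) K.Units_inv_closed[OF k]] that(2)
        by (rule Qp.l_null[OF \<iota>.hom_closed[OF K.Units_inv_closed[OF k]]])
      then have "\<one>\<^bsub>Qp\<^esub> = \<zero>\<^bsub>Qp\<^esub>" unfolding K.Units_r_inv[OF k] \<iota>.hom_one .
      then show False using Q.one_not_zero by blast
    qed
    note integral_K = symbol_model_integral_hom[OF sd_K sd_Q \<iota> inj integral_Q]
    have "division_algebra K (symbol_algebra K q \<xi> ?\<alpha> ?p)"
      by (intro symbol_data.division_symbol_algebra[OF sd_K field_K]
          symbol_data.Units_model[OF sd_K field_K] integral_K)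
    moreover have "division_algebra Qp (scalar_extension K (symbol_algebra K q \<xi> ?\<alpha> ?p) Qp \<iota>)"
      by (intro division_scalar_extension[OF sd_K sd_Q \<iota> field_Qp]
          symbol_data.Units_model[OF sd_Q field_Qp] integral_Q)
    ultimately show ?thesis by blast
  qed
  show ?thesis using ex_nonresidue[OF p q pq] hom main by blast
qed

end
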